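(* Let $\alpha>-1$ and let $X=\{(\lambda,m_\lambda)\}_{\lambda\in\Lambda}$ be a divisor in $\mathbb{D}$ which is either a sampling divisor or an interpolating divisor for $\mathcal{A}^2_\alpha$. Then $$\sum_{\lambda\in\Lambda}\bigl(m_\lambda(1-|\lambda|^2)\bigr)^2<+\infty.$$
   Context: $\mathbb{D}$ is the open unit disk in $\mathbb{C}$. For $\alpha>-1$, $\mathcal{A}^2_\alpha$ is the space of holomorphic functions $f$ on $\mathbb{D}$ with $\|f\|_{\alpha,2}^2=\int_{\mathbb{D}}|f|^2\,dA_\alpha<\infty$, where $dA_\alpha(z)=(1+\alpha)(1-|z|^2)^\alpha\,dx\,dy/\pi$, with scalar product $\langle f,g\rangle=\int_{\mathbb{D}} f\overline{g}\,dA_\alpha$. Its standard orthonormal basis is $e_n(z)=\sqrt{\frac{\Gamma(n+2+\alpha)}{n!\,\Gamma(2+\alpha)}}\,z^n$, $n\ge 0$. For $\lambda\in\mathbb{D}$ put $\varphi_\lambda(z)=\frac{\lambda-z}{1-\overline{\lambda}z}$ and let $T_\lambda f(z)=[\varphi_\lambda'(z)]^{(2+\alpha)/2}f(\varphi_\lambda(z))$, an isometry of $\mathcal{A}^2_\alpha$ (a holomorphic branch of the power is fixed; changing it only multiplies $T_\lambda$ by a unimodular constant and is immaterial here). A divisor is a set $X=\{(\lambda,m_\lambda)\}_{\lambda\in\Lambda}$, where $\Lambda\subset\mathbb{D}$ is a set of (distinct) points and each $m_\lambda\ge 1$ is an integer (multiplicity). $X$ is sampling for $\mathcal{A}^2_\alpha$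 if there is a constant $C>0$ such that for all $f\in\mathcal{A}^2_\alpha$: $\frac1{C}\sum_{\lambda\in\Lambda}\sum_{0\le j<m_\lambda}|\langle f,T_\lambda e_j\rangle|^2\le\|f\|_{\alpha,2}^2\le C\sum_{\lambda\in\Lambda}\sum_{0\le j<m_\lambda}|\langle f,T_\lambda e_j\rangle|^2$. Let $\ell^2(X)$ be the set of families of complex numbers $v=(v_\lambda^j)_{\lambda\in\Lambda,\,0\le j<m_\lambda}$ with $\sum_{\lambda\in\Lambda}\sum_{j<m_\lambda}|v_\lambda^j|^2<\infty$. $X$ is interpolating for $\mathcal{A}^2_\alpha$ if for every $v\in\ell^2(X)$ there exists $f\in\mathcal{A}^2_\alpha$ such that $\langle f,T_\lambda e_j\rangle=v_\lambda^j$ for all $\lambda\in\Lambda$ and $0\le j<m_\lambda$. *)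

theory Defs
  imports "HOL-Complex_Analysis.Complex_Analysis"
begin

definition bergman_measure :: "real \<Rightarrow> complex measure" where
  "bergman_measure \<alpha> =
     density (restrict_space lborel (ball 0 1))
       (\<lambda>z. ennreal ((1 + \<alpha>) * (1 - (cmod z)\<^sup>2) powr \<alpha> / pi))"

text \<open>Elements of the Bergman space are total functions; their values outside the unit
  disc are irrelevant, since the measure above lives on the disc.\<close>

definition bergman_space :: "real \<Rightarrow> (complex \<Rightarrow> complex) set" where
  "bergman_space \<alpha> =
     {f. f holomorphic_on ball 0 1 \<and> integrable (bergman_measure \<alpha>) (\<lambda>z. (cmod (f z))\<^sup>2)}"

definition bergman_norm :: "real \<Rightarrow> (complex \<Rightarrow> complex) \<Rightarrow> real" where
  "bergman_norm \<alpha> f = sqrt (\<integral>z. (cmod (f z))\<^sup>2 \<partial>bergman_measure \<alpha>)"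

definition bergman_inner :: "real \<Rightarrow> (complex \<Rightarrow> complex) \<Rightarrow> (complex \<Rightarrow> complex) \<Rightarrow> complex" where
  "bergman_inner \<alpha> f g = (\<integral>z. f z * cnj (g z) \<partial>bergman_measure \<alpha>)"

definition bergman_basis :: "real \<Rightarrow> nat \<Rightarrow> complex \<Rightarrow> complex" where
  "bergman_basis \<alpha> n z =
     of_real (sqrt (Gamma (real n + 2 + \<alpha>) / (fact n * Gamma (2 + \<alpha>)))) * z ^ n"

definition disc_aut :: "complex \<Rightarrow> complex \<Rightarrow> complex" where
  "disc_aut a z = (a - z) / (1 - cnj a * z)"

text \<open>A holomorphic branch on the unit disc of the logarithm of
  \<open>deriv (disc_aut a) z = - (1 - \<bar>a\<bar>\<^sup>2) / (1 - cnj a * z)\<^sup>2\<close>; the lemmas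
  below show that it is one. It fixes the branch of the power in the operator \<open>bergman_T\<close>.\<close>

definition log_deriv_disc_aut :: "complex \<Rightarrow> complex \<Rightarrow> complex" where
  "log_deriv_disc_aut a z =
     of_real (ln (1 - (cmod a)\<^sup>2)) + \<i> * of_real pi - 2 * Ln (1 - cnj a * z)"

lemma disc_aut_denominator_Re_pos:
  assumes "a \<in> ball 0 1" "z \<in> ball 0 1"
  shows "Re (1 - cnj a * z) > 0"
proof -
  have "cmod (cnj a * z) < 1"
    using assms mult_strict_mono'[of "cmod a" 1 "cmod z" 1] by (simp add: norm_mult)
  then show ?thesis
    using complex_Re_le_cmod[of "cnj a * z"] by simp
qed

lemma holomorphic_log_deriv_disc_aut:
  assumes "a \<in> ball 0 1"
  shows "log_deriv_disc_aut a holomorphic_on ball 0 1"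
proof -
  have "1 - cnj a * z \<notin> \<real>\<^sub>\<le>\<^sub>0" if "z \<in> ball 0 1" for z
    using disc_aut_denominator_Re_pos[OF assms that] by (auto simp: complex_nonpos_Reals_iff)
  then show ?thesis
    unfolding log_deriv_disc_aut_def by (intro holomorphic_intros) auto
qed

lemma exp_log_deriv_disc_aut:
  assumes l: "a \<in> ball 0 1" and z: "z \<in> ball 0 1"
  shows "exp (log_deriv_disc_aut a z) = deriv (disc_aut a) z"
proof -
  define w where "w = 1 - cnj a * z"
  have w: "w \<noteq> 0"
    using disc_aut_denominator_Re_pos[OF l z] unfolding w_def by force
  have "(cmod a)\<^sup>2 < 1"
    using l by (simp add: abs_square_less_1)
  then have "exp (of_real (ln (1 - (cmod a)\<^sup>2))) = 1 - a * cnj a"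
    by (simp add: exp_of_real flip: complex_norm_square)
  moreover have "exp (2 * Ln w) = w\<^sup>2"
    using w by (simp add: exp_double)
  ultimately have "exp (log_deriv_disc_aut a z) = - (1 - a * cnj a) / w\<^sup>2"
    by (simp add: log_deriv_disc_aut_def exp_diff exp_add flip: w_def)
  moreover have "(disc_aut a has_field_derivative - (1 - a * cnj a) / w\<^sup>2) (at z)"
    unfolding disc_aut_def using w unfolding w_def
    by (auto intro!: derivative_eq_intros simp: field_simps power2_eq_square)
  ultimately show ?thesis
    by (simp add: DERIV_imp_deriv)
qed

definition bergman_T ::
    "real \<Rightarrow> complex \<Rightarrow> (complex \<Rightarrow> complex) \<Rightarrow> complex \<Rightarrow> complex" where
  "bergman_T \<alpha> a f z =
     exp (of_real ((2 + \<alpha>) / 2) * log_deriv_disc_aut a z) * f (disc_aut a z)"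

text \<open>A divisor is given by its set of points \<open>\<Lambda>\<close> and a multiplicity function \<open>m\<close>, of which
  only the values on \<open>\<Lambda>\<close> matter.\<close>

definition divisor :: "complex set \<Rightarrow> (complex \<Rightarrow> nat) \<Rightarrow> bool" where
  "divisor \<Lambda> m \<longleftrightarrow> \<Lambda> \<subseteq> ball 0 1 \<and> (\<forall>a\<in>\<Lambda>. m a \<ge> 1)"

text \<open>The summability clause is part of the lower estimate: a divergent real \<open>infsum\<close> is \<open>0\<close>
  by convention.\<close>

definition sampling_divisor :: "real \<Rightarrow> complex set \<Rightarrow> (complex \<Rightarrow> nat) \<Rightarrow> bool" where
  "sampling_divisor \<alpha> \<Lambda> m \<longleftrightarrow>
     (\<exists>C>0. \<forall>f\<in>bergman_space \<alpha>.
        let S = (\<lambda>a. \<Sum>j<m a. (cmod (bergman_inner \<alpha> f (bergman_T \<alpha> a (bergman_basis \<alpha> j))))\<^sup>2)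
        in S summable_on \<Lambda> \<and>
           1 / C * (\<Sum>\<^sub>\<infinity>a\<in>\<Lambda>. S a) \<le> (bergman_norm \<alpha> f)\<^sup>2 \<and>
           (bergman_norm \<alpha> f)\<^sup>2 \<le> C * (\<Sum>\<^sub>\<infinity>a\<in>\<Lambda>. S a))"

definition l2_divisor ::
    "complex set \<Rightarrow> (complex \<Rightarrow> nat) \<Rightarrow> (complex \<Rightarrow> nat \<Rightarrow> complex) set" where
  "l2_divisor \<Lambda> m = {v. (\<lambda>a. \<Sum>j<m a. (cmod (v a j))\<^sup>2) summable_on \<Lambda>}"

definition interpolating_divisor :: "real \<Rightarrow> complex set \<Rightarrow> (complex \<Rightarrow> nat) \<Rightarrow> bool" where
  "interpolating_divisor \<alpha> \<Lambda> m \<longleftrightarrow>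
     (\<forall>v\<in>l2_divisor \<Lambda> m. \<exists>f\<in>bergman_space \<alpha>. \<forall>a\<in>\<Lambda>. \<forall>j<m a.
        bergman_inner \<alpha> f (bergman_T \<alpha> a (bergman_basis \<alpha> j)) = v a j)"

end

theory Submission
  imports Defs
begin

text \<open>
  Both cases provide functions \<open>y a j\<close> with \<open>\<langle>y a j, T\<^sub>a e\<^sub>k\<rangle> = \<delta>\<^sub>j\<^sub>k\<close> that satisfy a Bessel
  inequality on every finite part of the divisor: for a sampling divisor the system \<open>T\<^sub>a e\<^sub>j\<close>
  itself, for an interpolating one a dual system, which is Bessel because interpolation is
  equivalent to a Riesz--Fischer inequality (uniform boundedness). Testing the Bessel inequality
  on normalised reproducing kernels and integrating over the disc bounds the sum of all
  \<open>\<integral> |y a j|\<^sup>2 (1 - |w|\<^sup>2)\<^sup>2 dA\<^sub>\<alpha>\<close>.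

  Fix \<open>a\<close>, a polynomial \<open>p = \<Sum> g\<^sub>k e\<^sub>k\<close> of degree less than \<open>m\<close> and \<open>Y = \<Sum> g\<^sub>j y a j\<close>. Then \<open>\<Sum> |g\<^sub>k|\<^sup>2\<close> is
  \<open>\<langle>T\<^sub>a Y, p\<rangle>\<close> up to a unimodular factor, hence the pairing in \<open>\<A>\<^sup>2\<^sub>\<alpha>\<^sub>+\<^sub>1\<close> of \<open>T\<^sub>a Y\<close> with a first order
  derivative \<open>q\<close> of \<open>p\<close>. Cauchy--Schwarz and the substitution \<open>\<phi>\<^sub>a\<close> give
  \<open>(1 - |a|\<^sup>2)\<^sup>2 \<Sum> |g\<^sub>k|\<^sup>2 \<lesssim> (\<Sum>\<^sub>j \<integral> |y a j|\<^sup>2 (1 - |w|\<^sup>2)\<^sup>2 dA\<^sub>\<alpha>) \<parallel>q (1 - cnj a z)\<^sup>2\<parallel>\<^sup>2\<close>.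
  With \<open>q = u\<^sup>L (1 + u + \<dots> + u\<^sup>L\<^sup>-\<^sup>1)\<^sup>3\<close>, \<open>u = cnj a z\<close> and \<open>L\<close> comparable to
  \<open>min m (1 / (1 - |a|\<^sup>2))\<close>, the last factor is \<open>\<lesssim> L\<^sup>-\<^sup>2 \<Sum> |g\<^sub>k|\<^sup>2\<close>, because
  \<open>(1 - u)\<^sup>2\<close> acts on the coefficients as a second difference.
\<close>

text \<open>The kernels are integrated against Euclidean area because the invariant area of the disc
  is infinite; the price is that \<open>y a j\<close> is controlled only with the weight
  \<open>(1 - (cmod w)\<^sup>2)\<^sup>2\<close>. The pairing must therefore put a factor
  \<open>1 - (cmod z)\<^sup>2\<close> next to \<open>y\<close>, and passing to \<alpha> + 1 provides
  it. That passage multiplies the coefficient of degree \<open>k\<close> by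
  \<open>k + 2 + \<alpha>\<close>, which costs \<open>L\<^sup>2\<close> in squared norm, while the
  goal is to win \<open>L\<^sup>2\<close>. So the factor \<open>(1 - u)\<^sup>2\<close> left by the
  substitution has to win \<open>L ^ 4\<close>: it telescopes two geometric sums, and the third
  leaves a full block of \<open>L\<close> monomials. The size of \<open>L\<close> is capped by
  \<open>m\<close>, because dual functions exist only for \<open>j < m\<close>, and by
  \<open>1 / (1 - (cmod a)\<^sup>2)\<close>, because at higher degrees the powers of
  \<open>cmod a\<close> hidden in \<open>u\<close> become small. For this reason the estimate at a
  point sees only the minimum of \<open>m (1 - (cmod a)\<^sup>2)\<close> and 1. Summing these minima
  still allows only finitely many points where the first quantity reaches 1, and those add a finite
  amount.\<close>

section \<open>Holomorphic change of variables in the plane\<close>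

text \<open>The change of variables theorem with a Jacobian determinant speaks of
  \<open>real ^ 'n\<close>. This map and its inverse \<open>vec2_of_complex\<close> carry it over to
  \<open>complex\<close>.\<close>

definition complex_of_vec2 :: "real ^ 2 \<Rightarrow> complex" where
  "complex_of_vec2 v = Complex (v $ 1) (v $ 2)"

definition vec2_of_complex :: "complex \<Rightarrow> real ^ 2" where
  "vec2_of_complex z = (\<chi> i. if i = 1 then Re z else Im z)"

lemma vec2_of_complex_nth [simp]: "vec2_of_complex z $ 1 = Re z" "vec2_of_complex z $ 2 = Im z"
  by (simp_all add: vec2_of_complex_def)

lemma complex_vec2_inverse [simp]:
  "complex_of_vec2 (vec2_of_complex z) = z" "vec2_of_complex (complex_of_vec2 v) = v"
  by (simp_all add: complex_of_vec2_def vec_eq_iff forall_2)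

lemma bounded_linear_complex_of_vec2: "bounded_linear complex_of_vec2"
  by (intro linear_conv_bounded_linear[THEN iffD1] linearI)
     (simp_all add: complex_of_vec2_def complex_eq_iff)

lemma bounded_linear_vec2_of_complex: "bounded_linear vec2_of_complex"
  by (intro linear_conv_bounded_linear[THEN iffD1] linearI)
     (simp_all add: vec_eq_iff forall_2)

lemma complex_of_vec2_measurable [measurable]: "complex_of_vec2 \<in> borel_measurable borel"
  by (intro borel_measurable_continuous_onI linear_continuous_on bounded_linear_complex_of_vec2)

text \<open>Preimages of boxes are boxes with the same side lengths, and the volumes of boxes
  determine Lebesgue measure.\<close>

lemma lborel_complex_of_vec2: "(lborel :: complex measure) = distr lborel borel complex_of_vec2"
proof (rule lborel_eqI)
  fix l u :: complex assume lu: "\<And>b. b \<in> Basis \<Longrightarrow> l \<bullet> b \<le> u \<bullet> b"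
  then have le: "Re l \<le> Re u" "Im l \<le> Im u"
    using lu[of 1] lu[of \<i>] by (simp_all add: Basis_complex_def)
  have eq: "complex_of_vec2 -` box l u = box (vec2_of_complex l) (vec2_of_complex u)"
  proof (intro set_eqI)
    fix v
    have "v \<in> complex_of_vec2 -` box l u \<longleftrightarrow> (Re l < v $ 1 \<and> v $ 1 < Re u) \<and> (Im l < v $ 2 \<and> v $ 2 < Im u)"
      by (simp add: complex_of_vec2_def box_def Basis_complex_def)
    also have "\<dots> \<longleftrightarrow> v \<in> box (vec2_of_complex l) (vec2_of_complex u)"
      by (simp add: mem_box_cart forall_2)
    finally show "v \<in> complex_of_vec2 -` box l u \<longleftrightarrow> v \<in> box (vec2_of_complex l) (vec2_of_complex u)" .
  qed
  have B: "(Basis :: (real^2) set) = {axis 1 1, axis 2 1}"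
    by (auto simp: Basis_vec_def UNIV_2)
  have ne: "(axis 1 1 :: real^2) \<noteq> axis 2 1" by (simp add: axis_eq_axis)
  have "emeasure (distr lborel borel complex_of_vec2) (box l u)
     = emeasure lborel (box (vec2_of_complex l) (vec2_of_complex u))"
    by (subst emeasure_distr) (auto simp: eq)
  also have "\<dots> = (\<Prod>b\<in>Basis. (vec2_of_complex u - vec2_of_complex l) \<bullet> b)"
    using le by (intro emeasure_lborel_box) (auto simp: B inner_axis)
  also have "\<dots> = (\<Prod>b\<in>Basis. (u - l) \<bullet> b)"
    by (simp add: B ne inner_axis Basis_complex_def inner_complex_def)
  finally show "emeasure (distr lborel borel complex_of_vec2) (box l u) = (\<Prod>b\<in>Basis. (u - l) \<bullet> b)" .
qed simp

text \<open>As a real 2 by 2 matrix, multiplication by \<open>\<phi>' z\<close> has determinant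
  \<open>(cmod (\<phi>' z))\<^sup>2\<close>. Boundedness gives the image finite measure, so the
  real-valued theorem on differentiable images applies before its value is read as an extended
  nonnegative integral.\<close>

lemma emeasure_image_holomorphic:
  fixes \<phi> \<phi>' :: "complex \<Rightarrow> complex"
  assumes A: "A \<in> sets borel" "\<phi> ` A \<in> sets borel" "bounded (\<phi> ` A)"
    and der: "\<And>z. z \<in> A \<Longrightarrow> (\<phi> has_field_derivative \<phi>' z) (at z)"
    and inj: "inj_on \<phi> A"
    and meas: "(\<lambda>z. indicator A z * (cmod (\<phi>' z))\<^sup>2) \<in> borel_measurable borel"
  shows "emeasure lborel (\<phi> ` A) = (\<integral>\<^sup>+z. indicator A z * ennreal ((cmod (\<phi>' z))\<^sup>2) \<partial>lborel)"
proof -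
  define G where "G = vec2_of_complex \<circ> \<phi> \<circ> complex_of_vec2"
  define G' where "G' = (\<lambda>v x. vec2_of_complex (\<phi>' (complex_of_vec2 v) * complex_of_vec2 x))"
  define A' where "A' = complex_of_vec2 -` A"
  have A': "A' \<in> sets borel"
    unfolding A'_def using measurable_sets[OF complex_of_vec2_measurable, of A] A by simp
  have GA: "G ` A' = complex_of_vec2 -` (\<phi> ` A)"
  proof (intro set_eqI iffI)
    fix v assume "v \<in> complex_of_vec2 -` (\<phi> ` A)"
    then obtain z where z: "z \<in> A" "complex_of_vec2 v = \<phi> z" by auto
    then have "v = G (vec2_of_complex z)" unfolding G_def by (metis comp_apply complex_vec2_inverse)
    then show "v \<in> G ` A'" using z unfolding A'_def by auto
  qed (auto simp: G_def A'_def)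
  have GAb: "G ` A' \<in> sets borel"
    unfolding GA using measurable_sets[OF complex_of_vec2_measurable, of "\<phi> ` A"] A by simp
  have "G ` A' = vec2_of_complex ` (\<phi> ` A)"
    unfolding GA by (auto simp: image_iff) (metis complex_vec2_inverse)
  then have bdd: "bounded (G ` A')"
    using bounded_linear_image[OF A(3) bounded_linear_vec2_of_complex] by simp
  have lm: "G ` A' \<in> lmeasurable"
    using bdd GAb by (intro bounded_set_imp_lmeasurable) auto
  have dG: "(G has_derivative G' v) (at v within A')" if "v \<in> A'" for v
  proof -
    have "(\<phi> has_derivative (*) (\<phi>' (complex_of_vec2 v))) (at (complex_of_vec2 v))"
      using der[of "complex_of_vec2 v"] that by (simp add: A'_def has_field_derivative_def)
    then have "((\<lambda>x. \<phi> (complex_of_vec2 x)) has_derivative (\<lambda>x. \<phi>' (complex_of_vec2 v) * complex_of_vec2 x)) (at v within A')"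
      using has_derivative_compose[OF bounded_linear_imp_has_derivative[OF bounded_linear_complex_of_vec2]] by blast
    from bounded_linear.has_derivative[OF bounded_linear_vec2_of_complex this]
    show ?thesis by (simp add: G_def G'_def o_def)
  qed
  have injG: "inj_on G A'"
    by (intro inj_onI) (use inj in \<open>auto simp: G_def A'_def inj_on_def dest!: arg_cong[where f = complex_of_vec2]\<close>, metis complex_vec2_inverse)
  have det: "\<bar>det (matrix (G' v))\<bar> = (cmod (\<phi>' (complex_of_vec2 v)))\<^sup>2" for v
  proof -
    have "det (matrix (G' v)) = (cmod (\<phi>' (complex_of_vec2 v)))\<^sup>2"
      by (simp add: det_2 matrix_def G'_def complex_of_vec2_def axis_def cmod_power2)
         (simp add: power2_eq_square)
    then show ?thesis by simp
  qed
  have "((\<lambda>v. (cmod (\<phi>' (complex_of_vec2 v)))\<^sup>2) has_integral measure lebesgue (G ` A')) A'"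
    using has_measure_differentiable_image[OF _ dG injG, of "measure lebesgue (G ` A')"] A' lm
    unfolding det by (auto simp: sets_completionI_sets)
  then have "(\<integral>\<^sup>+v. ennreal (indicator A' v * (cmod (\<phi>' (complex_of_vec2 v)))\<^sup>2) \<partial>lborel) = ennreal (measure lebesgue (G ` A'))"
    by (intro nn_integral_has_integral_lebesgue) auto
  also have "\<dots> = emeasure lborel (G ` A')"
    using lm GAb by (simp add: emeasure_eq_measure2[symmetric] fmeasurable_def)
  also have "\<dots> = emeasure (lborel :: complex measure) (\<phi> ` A)"
    unfolding lborel_complex_of_vec2 GA by (subst emeasure_distr) (use A in auto)
  finally have "emeasure (lborel :: complex measure) (\<phi> ` A) = 
    (\<integral>\<^sup>+v. ennreal (indicator A' v * (cmod (\<phi>' (complex_of_vec2 v)))\<^sup>2) \<partial>lborel)" by simp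
  also have "\<dots> = (\<integral>\<^sup>+z. ennreal (indicator A z * (cmod (\<phi>' z))\<^sup>2) \<partial>lborel)"
    unfolding lborel_complex_of_vec2
    by (subst nn_integral_distr) (use meas in \<open>auto simp: A'_def indicator_def\<close>)
  also have "\<dots> = (\<integral>\<^sup>+z. indicator A z * ennreal ((cmod (\<phi>' z))\<^sup>2) \<partial>lborel)"
    by (intro nn_integral_cong) (auto simp: indicator_def)
  finally show ?thesis .
qed

section \<open>Automorphisms of the disc and the Bergman measure\<close>

text \<open>Stated as an equality of measures so that integrals, integrability and further densities
  can be pushed through it. The inverse \<open>\<psi>\<close> makes \<open>\<phi>\<close> injective
  and exhibits each Borel subset of \<open>S\<close> as the image of its preimage.\<close>

lemma distr_density_holomorphic_bij:
  fixes \<phi> \<psi> \<phi>' :: "complex \<Rightarrow> complex"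
  assumes S: "open S" "bounded S"
    and maps: "\<And>z. z \<in> S \<Longrightarrow> \<phi> z \<in> S" "\<And>z. z \<in> S \<Longrightarrow> \<psi> z \<in> S"
    and inv: "\<And>z. z \<in> S \<Longrightarrow> \<psi> (\<phi> z) = z" "\<And>z. z \<in> S \<Longrightarrow> \<phi> (\<psi> z) = z"
    and der: "\<And>z. z \<in> S \<Longrightarrow> (\<phi> has_field_derivative \<phi>' z) (at z)"
    and cont: "continuous_on S \<phi>'"
  shows "distr (density (restrict_space lborel S) (\<lambda>z. ennreal ((cmod (\<phi>' z))\<^sup>2))) (restrict_space borel S) \<phi>
     = restrict_space lborel S" (is "?M = ?N")
proof (rule measure_eqI)
  have Sb [measurable]: "S \<in> sets borel" using S by simp
  have c\<phi>: "continuous_on S \<phi>"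
    using der by (meson DERIV_isCont continuous_at_imp_continuous_on)
  have m\<phi>: "\<phi> \<in> restrict_space borel S \<rightarrow>\<^sub>M restrict_space borel S"
    by (intro measurable_restrict_space2 borel_measurable_continuous_on_restrict c\<phi>)
       (auto simp: space_restrict_space maps)
  have m\<phi>': "(\<lambda>z. ennreal ((cmod (\<phi>' z))\<^sup>2)) \<in> borel_measurable (restrict_space borel S)"
    by (intro measurable_compose[OF borel_measurable_continuous_on_restrict measurable_ennreal])
       (intro continuous_intros cont)
  have mr\<phi>': "(\<lambda>z. (cmod (\<phi>' z))\<^sup>2) \<in> borel_measurable (restrict_space borel S)"
    by (intro borel_measurable_continuous_on_restrict continuous_intros cont)
  show "sets ?M = sets ?N" by (simp add: sets_restrict_space)
  fix B assume "B \<in> sets ?M"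
  then have B: "B \<in> sets borel" "B \<subseteq> S"
    using Sb by (auto simp: sets_restrict_space)
  define A where "A = \<phi> -` B \<inter> S"
  have Ares: "A \<in> sets (restrict_space borel S)"
    using measurable_sets[OF m\<phi>, of B] B Sb
    by (simp add: A_def space_restrict_space sets_restrict_space image_iff) (metis Int_absorb2 Int_commute)
  then have A: "A \<in> sets borel" "A \<subseteq> S"
    using Sb by (auto simp: sets_restrict_space)
  have im: "\<phi> ` A = B"
    using B inv maps by (force simp: A_def image_iff)
  have "emeasure ?M B = emeasure (density (restrict_space lborel S) (\<lambda>z. ennreal ((cmod (\<phi>' z))\<^sup>2))) A"
    using \<open>B \<in> sets ?M\<close> m\<phi>
    by (subst emeasure_distr)
       (auto simp: A_def space_restrict_space cong: measurable_cong_sets)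
  also have "\<dots> = (\<integral>\<^sup>+z. ennreal ((cmod (\<phi>' z))\<^sup>2) * indicator A z \<partial>restrict_space lborel S)"
    using m\<phi>' Ares by (intro emeasure_density) (auto cong: measurable_cong_sets sets_restrict_space_cong)
  also have "\<dots> = (\<integral>\<^sup>+z. indicator A z * ennreal ((cmod (\<phi>' z))\<^sup>2) \<partial>lborel)"
    using A by (subst nn_integral_restrict_space) (auto intro!: nn_integral_cong simp: indicator_def)
  also have "\<dots> = emeasure lborel (\<phi> ` A)"
  proof (rule emeasure_image_holomorphic[symmetric])
    show "bounded (\<phi> ` A)" using im B S bounded_subset by metis
    show "inj_on \<phi> A" using A inv by (metis inj_onI subsetD)
    \<comment> \<open>Nothing is known about \<open>\<phi>'\<close> outside \<open>S\<close>. The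
      indicator of \<open>A\<close> removes those values, so measurability on \<open>S\<close>
      extends to the plane.\<close>
    have "(\<lambda>z. indicator A z * (cmod (\<phi>' z))\<^sup>2) = (\<lambda>z. indicator S z *\<^sub>R (indicator A z * (cmod (\<phi>' z))\<^sup>2))"
      using A by (auto simp: fun_eq_iff indicator_def)
    moreover have "(\<lambda>z. indicator A z * (cmod (\<phi>' z))\<^sup>2) \<in> borel_measurable (restrict_space borel S)"
      using A by (intro borel_measurable_times mr\<phi>' measurable_restrict_space1) auto
    ultimately show "(\<lambda>z. indicator A z * (cmod (\<phi>' z))\<^sup>2) \<in> borel_measurable borel"
      using borel_measurable_restrict_space_iff[of S borel] Sb by (metis space_borel Int_UNIV_right)
  qed (use A B im der in auto)
  also have "\<dots> = emeasure ?N B"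
    using B im by (simp add: emeasure_restrict_space)
  finally show "emeasure ?M B = emeasure ?N B" .
qed

section \<open>The Bergman measure under conformal self-maps of the disc\<close>

lemma sets_bergman_measure: "sets (bergman_measure \<alpha>) = sets (restrict_space borel (ball 0 1))"
  by (simp add: bergman_measure_def sets_restrict_space)

lemma space_bergman_measure [simp]: "space (bergman_measure \<alpha>) = ball 0 1"
  by (simp add: bergman_measure_def space_restrict_space)

lemma measurable_bergman_measure_eq:
  "measurable (bergman_measure \<alpha>) N = measurable (restrict_space borel (ball 0 1)) N"
  by (intro measurable_cong_sets sets_bergman_measure refl)

lemma continuous_on_bergman_measurable:
  fixes f :: "complex \<Rightarrow> 'b::topological_space"
  shows "continuous_on (ball 0 1) f \<Longrightarrow> f \<in> borel_measurable (bergman_measure \<alpha>)"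
  by (simp add: measurable_bergman_measure_eq borel_measurable_continuous_on_restrict)

lemma borel_measurable_bergman:
  "f \<in> borel_measurable borel \<Longrightarrow> f \<in> borel_measurable (bergman_measure \<alpha>)"
  by (simp add: measurable_bergman_measure_eq measurable_restrict_space1)

lemma bergman_density_measurable:
  "(\<lambda>z. ennreal ((1 + \<alpha>) * (1 - (cmod z)\<^sup>2) powr \<alpha> / pi)) \<in> borel_measurable (restrict_space lborel (ball 0 1))"
  by (intro measurable_restrict_space1) measurable

text \<open>The assumption \<open>jac\<close> is the equality case of the Schwarz--Pick inequality.
  In the exponent \<open>2 + \<alpha>\<close>, the 2 is the real Jacobian and the \<alpha> comes
  from the density of the measure. Rotations and the maps \<open>disc_aut a\<close> are both
  instances.\<close>

lemma bergman_measure_change_of_variables: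
  assumes maps: "\<And>z. z \<in> ball 0 1 \<Longrightarrow> \<phi> z \<in> ball 0 1" "\<And>z. z \<in> ball 0 1 \<Longrightarrow> \<psi> z \<in> ball 0 1"
    and inv: "\<And>z. z \<in> ball 0 1 \<Longrightarrow> \<psi> (\<phi> z) = z" "\<And>z. z \<in> ball 0 1 \<Longrightarrow> \<phi> (\<psi> z) = z"
    and der: "\<And>z. z \<in> ball 0 1 \<Longrightarrow> (\<phi> has_field_derivative \<phi>' z) (at z)"
    and cont: "continuous_on (ball 0 1) \<phi>'"
    and jac: "\<And>z. z \<in> ball 0 1 \<Longrightarrow> 1 - (cmod (\<phi> z))\<^sup>2 = cmod (\<phi>' z) * (1 - (cmod z)\<^sup>2)"
    and nz: "\<And>z. z \<in> ball 0 1 \<Longrightarrow> \<phi>' z \<noteq> 0"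
  shows "distr (density (bergman_measure \<alpha>) (\<lambda>z. ennreal (cmod (\<phi>' z) powr (2 + \<alpha>)))) (bergman_measure \<alpha>) \<phi>
    = bergman_measure \<alpha>"
proof -
  let ?D = "ball 0 1 :: complex set"
  let ?R = "restrict_space lborel ?D :: complex measure"
  let ?J = "\<lambda>z. ennreal ((cmod (\<phi>' z))\<^sup>2)"
  let ?w = "\<lambda>z. ennreal ((1 + \<alpha>) * (1 - (cmod z)\<^sup>2) powr \<alpha> / pi)"
  let ?K = "\<lambda>z. ennreal (cmod (\<phi>' z) powr (2 + \<alpha>))"
  have c\<phi>: "continuous_on ?D \<phi>"
    using der by (meson DERIV_isCont continuous_at_imp_continuous_on)
  have mR: "measurable ?R N = measurable (restrict_space borel ?D) N" for N
    by (intro measurable_cong_sets) (auto simp: sets_restrict_space)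
  have m\<phi>: "\<phi> \<in> ?R \<rightarrow>\<^sub>M restrict_space borel ?D"
    unfolding mR by (intro measurable_restrict_space2 borel_measurable_continuous_on_restrict c\<phi>)
       (use maps in \<open>auto simp: space_restrict_space\<close>)
  have mJ [measurable]: "?J \<in> borel_measurable ?R"
    unfolding mR by (intro measurable_compose[OF borel_measurable_continuous_on_restrict measurable_ennreal])
       (intro continuous_intros cont)
  have mK [measurable]: "?K \<in> borel_measurable ?R"
    unfolding mR by (intro measurable_compose[OF borel_measurable_continuous_on_restrict measurable_ennreal])
       (intro continuous_intros cont, use nz in auto)
  have mw: "?w \<in> borel_measurable ?R" by (rule bergman_density_measurable)
  have mw': "?w \<in> borel_measurable (restrict_space borel ?D)" using mw unfolding mR .
  have mw\<phi> [measurable]: "(\<lambda>z. ?w (\<phi> z)) \<in> borel_measurable ?R"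
    by (rule measurable_compose[OF m\<phi> mw'])
  have "bergman_measure \<alpha> = density (distr (density ?R ?J) (restrict_space borel ?D) \<phi>) ?w"
    unfolding bergman_measure_def
    by (subst distr_density_holomorphic_bij[where \<psi> = \<psi>]) (use maps inv der cont in auto)
  also have "\<dots> = distr (density (density ?R ?J) (\<lambda>z. ?w (\<phi> z))) (restrict_space borel ?D) \<phi>"
    using m\<phi> mw' by (intro density_distr) (auto cong: measurable_cong_sets)
  also have "density (density ?R ?J) (\<lambda>z. ?w (\<phi> z)) = density ?R (\<lambda>z. ?J z * ?w (\<phi> z))"
    by (rule density_density_eq) measurable
  also have "\<dots> = density ?R (\<lambda>z. ?w z * ?K z)"
  proof (intro density_cong AE_I2)
    fix z assume "z \<in> space ?R"
    then have z: "z \<in> ball 0 1" by (simp add: space_restrict_space)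
    then have pos: "0 < 1 - (cmod z)\<^sup>2" by (simp add: abs_square_less_1)
    have "(1 - (cmod (\<phi> z))\<^sup>2) powr \<alpha> = cmod (\<phi>' z) powr \<alpha> * (1 - (cmod z)\<^sup>2) powr \<alpha>"
      unfolding jac[OF z] using pos by (simp add: powr_mult)
    moreover have "(cmod (\<phi>' z))\<^sup>2 * cmod (\<phi>' z) powr \<alpha> = cmod (\<phi>' z) powr (2 + \<alpha>)"
      using nz[OF z] by (simp add: powr_add)
    ultimately have "(cmod (\<phi>' z))\<^sup>2 * ((1 + \<alpha>) * (1 - (cmod (\<phi> z))\<^sup>2) powr \<alpha> / pi)
      = (1 + \<alpha>) * (1 - (cmod z)\<^sup>2) powr \<alpha> / pi * cmod (\<phi>' z) powr (2 + \<alpha>)"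
      by (simp add: mult_ac)
    from arg_cong[OF this, of ennreal] show "?J z * ?w (\<phi> z) = ?w z * ?K z"
      by (subst (asm) ennreal_mult', simp, subst (asm) ennreal_mult'', simp)
  qed (intro borel_measurable_times_ennreal mw mJ mK mw\<phi>)+
  also have "\<dots> = density (bergman_measure \<alpha>) ?K"
    unfolding bergman_measure_def by (intro density_density_eq[symmetric] mw mK)
  also have "distr (density (bergman_measure \<alpha>) ?K) (restrict_space borel ?D) \<phi>
     = distr (density (bergman_measure \<alpha>) ?K) (bergman_measure \<alpha>) \<phi>"
    by (intro distr_cong) (auto simp: sets_bergman_measure)
  finally show ?thesis by simp
qed

lemma
  fixes f :: "complex \<Rightarrow> 'b::{banach, second_countable_topology}"
  assumes D: "distr (density M (\<lambda>z. ennreal (h z))) M \<phi> = M"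
    and m [measurable]: "\<phi> \<in> M \<rightarrow>\<^sub>M M" "h \<in> borel_measurable M" "f \<in> borel_measurable M"
    and h: "\<And>z. h z \<ge> 0"
  shows integrable_weighted_substitution: "integrable M f \<longleftrightarrow> integrable M (\<lambda>z. h z *\<^sub>R f (\<phi> z))"
    and integral_weighted_substitution: "integral\<^sup>L M f = integral\<^sup>L M (\<lambda>z. h z *\<^sub>R f (\<phi> z))"
proof -
  have "integrable M f \<longleftrightarrow> integrable (distr (density M (\<lambda>z. ennreal (h z))) M \<phi>) f"
    by (simp add: D)
  also have "\<dots> \<longleftrightarrow> integrable M (\<lambda>z. h z *\<^sub>R f (\<phi> z))"
    using h by (subst integrable_distr_eq) (simp_all add: integrable_density)
  finally show "integrable M f \<longleftrightarrow> integrable M (\<lambda>z. h z *\<^sub>R f (\<phi> z))" .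
  have "integral\<^sup>L M f = integral\<^sup>L (distr (density M (\<lambda>z. ennreal (h z))) M \<phi>) f"
    by (simp add: D)
  also have "\<dots> = integral\<^sup>L M (\<lambda>z. h z *\<^sub>R f (\<phi> z))"
    using h by (subst integral_distr) (simp_all add: integral_density)
  finally show "integral\<^sup>L M f = integral\<^sup>L M (\<lambda>z. h z *\<^sub>R f (\<phi> z))" .
qed

lemma bergman_integral_rotation:
  fixes f :: "complex \<Rightarrow> 'b::{banach, second_countable_topology}"
  assumes u: "cmod u = 1" and f: "f \<in> borel_measurable (bergman_measure \<alpha>)"
  shows "integral\<^sup>L (bergman_measure \<alpha>) f = (\<integral>z. f (u * z) \<partial>bergman_measure \<alpha>)"
proof -
  have nz: "u \<noteq> 0" using u by auto
  have "distr (density (bergman_measure \<alpha>) (\<lambda>z. ennreal (cmod u powr (2 + \<alpha>)))) (bergman_measure \<alpha>) ((*) u)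
    = bergman_measure \<alpha>"
    by (rule bergman_measure_change_of_variables[where \<psi> = "\<lambda>z. z / u"])
       (use u nz in \<open>auto simp: norm_mult norm_divide intro!: derivative_eq_intros\<close>)
  then have D: "distr (density (bergman_measure \<alpha>) (\<lambda>z. ennreal 1)) (bergman_measure \<alpha>) ((*) u) = bergman_measure \<alpha>"
    using u by simp
  have m: "(*) u \<in> bergman_measure \<alpha> \<rightarrow>\<^sub>M bergman_measure \<alpha>"
    by (subst measurable_cong_sets[OF refl sets_bergman_measure])
       (auto intro!: measurable_restrict_space2 borel_measurable_bergman simp: norm_mult u)
  show ?thesis
    using integral_weighted_substitution[OF D m _ f] by simp
qed

text \<open>On the disc this is the modulus of the derivative of \<open>disc_aut a\<close> at
  \<open>z\<close>.\<close>

definition disc_aut_jac :: "complex \<Rightarrow> complex \<Rightarrow> real" where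
  "disc_aut_jac a z = (1 - (cmod a)\<^sup>2) / (cmod (1 - cnj a * z))\<^sup>2"

lemma disc_aut_denominator_nonzero:
  "a \<in> ball 0 1 \<Longrightarrow> z \<in> ball 0 1 \<Longrightarrow> 1 - cnj a * z \<noteq> 0"
  using disc_aut_denominator_Re_pos[of a z] by force

lemma one_minus_cmod_square_pos: "a \<in> ball 0 1 \<Longrightarrow> 0 < 1 - (cmod a)\<^sup>2"
  by (simp add: abs_square_less_1)

lemma disc_aut_jac_pos: "a \<in> ball 0 1 \<Longrightarrow> z \<in> ball 0 1 \<Longrightarrow> 0 < disc_aut_jac a z"
  unfolding disc_aut_jac_def
  by (intro divide_pos_pos one_minus_cmod_square_pos) (use disc_aut_denominator_nonzero in auto)

lemma one_minus_disc_aut_square: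
  assumes "a \<in> ball 0 1" "z \<in> ball 0 1"
  shows "1 - (cmod (disc_aut a z))\<^sup>2 = disc_aut_jac a z * (1 - (cmod z)\<^sup>2)"
proof -
  have "(cmod (1 - cnj a * z))\<^sup>2 - (cmod (a - z))\<^sup>2 = (1 - (cmod a)\<^sup>2) * (1 - (cmod z)\<^sup>2)"
    by (simp add: cmod_power2) algebra
  moreover have "cmod (1 - cnj a * z) \<noteq> 0" using disc_aut_denominator_nonzero[OF assms] by simp
  ultimately show ?thesis
    unfolding disc_aut_def disc_aut_jac_def norm_divide power_divide by (simp add: divide_simps)
qed

lemma disc_aut_in_ball:
  assumes "a \<in> ball 0 1" "z \<in> ball 0 1"
  shows "disc_aut a z \<in> ball 0 1"
proof -
  have "0 < 1 - (cmod (disc_aut a z))\<^sup>2"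
    unfolding one_minus_disc_aut_square[OF assms]
    by (intro mult_pos_pos disc_aut_jac_pos one_minus_cmod_square_pos assms)
  then show ?thesis by (simp add: abs_square_less_1)
qed

lemma of_real_cmod_square: "(complex_of_real (cmod a))\<^sup>2 = a * cnj a"
  using complex_norm_square[of a] by simp

lemma one_minus_cnj_mult_disc_aut:
  assumes "a \<in> ball 0 1" "z \<in> ball 0 1"
  shows "1 - cnj a * disc_aut a z = of_real (1 - (cmod a)\<^sup>2) / (1 - cnj a * z)"
  using disc_aut_denominator_nonzero[OF assms]
  by (simp add: disc_aut_def field_simps of_real_cmod_square mult.commute)

lemma disc_aut_involution:
  assumes "a \<in> ball 0 1" "z \<in> ball 0 1"
  shows "disc_aut a (disc_aut a z) = z"
proof -
  have nz: "1 - cnj a * z \<noteq> 0" by (rule disc_aut_denominator_nonzero[OF assms])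
  have e: "complex_of_real (1 - (cmod a)\<^sup>2) \<noteq> 0" 
    using one_minus_cmod_square_pos[OF assms(1)] by (metis less_irrefl of_real_eq_0_iff)
  have "a - disc_aut a z = z * of_real (1 - (cmod a)\<^sup>2) / (1 - cnj a * z)"
    using nz by (simp add: disc_aut_def field_simps of_real_cmod_square mult.commute)
  then show ?thesis
    unfolding disc_aut_def[of a "disc_aut a z"] one_minus_cnj_mult_disc_aut[OF assms]
    using e nz by simp
qed

lemma disc_aut_has_field_derivative:
  assumes "a \<in> ball 0 1" "z \<in> ball 0 1"
  shows "(disc_aut a has_field_derivative - of_real (1 - (cmod a)\<^sup>2) / (1 - cnj a * z)\<^sup>2) (at z)"
proof -
  have "((\<lambda>z. (a - z) / (1 - cnj a * z)) has_field_derivative - of_real (1 - (cmod a)\<^sup>2) / (1 - cnj a * z)\<^sup>2) (at z)"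
    using disc_aut_denominator_nonzero[OF assms]
    by (auto intro!: derivative_eq_intros simp: of_real_cmod_square divide_simps)
       (simp_all add: power2_eq_square algebra_simps)
  then show ?thesis by (simp add: disc_aut_def[abs_def])
qed

lemma continuous_on_disc_aut: "a \<in> ball 0 1 \<Longrightarrow> continuous_on (ball 0 1) (disc_aut a)"
  using disc_aut_has_field_derivative by (meson DERIV_isCont continuous_at_imp_continuous_on)

lemma disc_aut_measurable_bergman:
  assumes "a \<in> ball 0 1"
  shows "disc_aut a \<in> bergman_measure \<alpha> \<rightarrow>\<^sub>M bergman_measure \<alpha>"
  by (subst measurable_cong_sets[OF refl sets_bergman_measure])
     (use disc_aut_in_ball[OF assms] in \<open>auto intro!: measurable_restrict_space2 
       continuous_on_bergman_measurable continuous_on_disc_aut assms\<close>)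

lemma continuous_on_disc_aut_jac: "a \<in> ball 0 1 \<Longrightarrow> continuous_on (ball 0 1) (disc_aut_jac a)"
  unfolding disc_aut_jac_def
  by (intro continuous_intros) (use disc_aut_denominator_nonzero in auto)

lemma disc_aut_jac_powr_measurable:
  assumes "a \<in> ball 0 1"
  shows "(\<lambda>z. disc_aut_jac a z powr s) \<in> borel_measurable (bergman_measure \<alpha>)"
  by (intro continuous_on_bergman_measurable continuous_intros continuous_on_disc_aut_jac assms)
     (use disc_aut_jac_pos[OF assms] in \<open>auto simp: less_le\<close>)

lemma bergman_distr_disc_aut:
  assumes a: "a \<in> ball 0 1"
  shows "distr (density (bergman_measure \<alpha>) (\<lambda>z. ennreal (disc_aut_jac a z powr (2 + \<alpha>)))) (bergman_measure \<alpha>) (disc_aut a)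
    = bergman_measure \<alpha>"
proof -
  define \<phi>' where "\<phi>' = (\<lambda>z. - of_real (1 - (cmod a)\<^sup>2) / (1 - cnj a * z)\<^sup>2)"
  have n: "cmod (\<phi>' z) = disc_aut_jac a z" for z
    using one_minus_cmod_square_pos[OF a] unfolding \<phi>'_def disc_aut_jac_def
    by (simp only: norm_divide norm_minus_cancel norm_of_real norm_power)
  have "distr (density (bergman_measure \<alpha>) (\<lambda>z. ennreal (cmod (\<phi>' z) powr (2 + \<alpha>)))) (bergman_measure \<alpha>) (disc_aut a)
    = bergman_measure \<alpha>"
  proof (rule bergman_measure_change_of_variables[where \<psi> = "disc_aut a"])
    show "continuous_on (ball 0 1) \<phi>'"
      unfolding \<phi>'_def using disc_aut_denominator_nonzero[OF a] by (intro continuous_intros) auto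
    show "\<phi>' z \<noteq> 0" if "z \<in> ball 0 1" for z
      using disc_aut_jac_pos[OF a that] n[of z] by auto
    show "(disc_aut a has_field_derivative \<phi>' z) (at z)" if "z \<in> ball 0 1" for z
      unfolding \<phi>'_def by (rule disc_aut_has_field_derivative[OF a that])
    show "1 - (cmod (disc_aut a z))\<^sup>2 = cmod (\<phi>' z) * (1 - (cmod z)\<^sup>2)" if "z \<in> ball 0 1" for z
      unfolding n by (rule one_minus_disc_aut_square[OF a that])
  qed (intro disc_aut_in_ball disc_aut_involution a; assumption)+
  then show ?thesis by (simp add: n)
qed

lemma
  fixes f :: "complex \<Rightarrow> 'b::{banach, second_countable_topology}"
  assumes a: "a \<in> ball 0 1" and f: "f \<in> borel_measurable (bergman_measure \<alpha>)"
  shows bergman_integrable_disc_aut: "integrable (bergman_measure \<alpha>) f \<longleftrightarrow>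
      integrable (bergman_measure \<alpha>) (\<lambda>z. disc_aut_jac a z powr (2 + \<alpha>) *\<^sub>R f (disc_aut a z))"
    and bergman_integral_disc_aut: "integral\<^sup>L (bergman_measure \<alpha>) f =
      (\<integral>z. disc_aut_jac a z powr (2 + \<alpha>) *\<^sub>R f (disc_aut a z) \<partial>bergman_measure \<alpha>)"
  using integrable_weighted_substitution[OF bergman_distr_disc_aut[OF a] disc_aut_measurable_bergman[OF a]
      disc_aut_jac_powr_measurable[OF a] f]
    integral_weighted_substitution[OF bergman_distr_disc_aut[OF a] disc_aut_measurable_bergman[OF a]
      disc_aut_jac_powr_measurable[OF a] f]
  by simp_all

section \<open>Radial moments\<close>

text \<open>A half-line pulls back to the disc without a closed disc of radius
  \<open>sqrt x\<close>, whose area is known. Half-lines are enough to identify a measure on the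
  real line that is finite on them.\<close>

lemma emeasure_radial:
  "emeasure (distr (restrict_space lborel (ball 0 1 :: complex set)) borel (\<lambda>z. (cmod z)\<^sup>2)) {x<..}
    = ennreal (pi * (if x < 0 then 1 else if x < 1 then 1 - x else 0))"
proof -
  let ?D = "ball 0 1 :: complex set"
  have "emeasure (distr (restrict_space lborel ?D) borel (\<lambda>z. (cmod z)\<^sup>2)) {x<..}
    = emeasure lborel ({z. x < (cmod z)\<^sup>2} \<inter> ?D)"
  proof (subst emeasure_distr)
    show "(\<lambda>z. (cmod z)\<^sup>2) \<in> borel_measurable (restrict_space lborel ?D)"
      by (rule measurable_restrict_space1) simp
    have "(\<lambda>z. (cmod z)\<^sup>2) -` {x<..} \<inter> space (restrict_space lborel ?D) = {z. x < (cmod z)\<^sup>2} \<inter> ?D"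
      by (auto simp: space_restrict_space)
    then show "emeasure (restrict_space lborel ?D) ((\<lambda>z. (cmod z)\<^sup>2) -` {x<..} \<inter> space (restrict_space lborel ?D))
      = emeasure lborel ({z. x < (cmod z)\<^sup>2} \<inter> ?D)"
      by (simp add: emeasure_restrict_space)
  qed simp
  also have "\<dots> = ennreal (pi * (if x < 0 then 1 else if x < 1 then 1 - x else 0))"
  proof (cases "x < 0")
    case True
    then have "x < (cmod z)\<^sup>2" for z using zero_le_power2[of "cmod z"] by linarith
    then have "{z. x < (cmod z)\<^sup>2} \<inter> ?D = ?D" by auto
    then show ?thesis using True by (simp add: emeasure_ball unit_ball_vol_2)
  next
    case x0: False
    have eq: "{z. x < (cmod z)\<^sup>2} \<inter> ?D = ?D - cball 0 (sqrt x)"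
    proof -
      have "x < (cmod z)\<^sup>2 \<longleftrightarrow> \<not> cmod z \<le> sqrt x" for z
        using real_sqrt_less_iff[of x "(cmod z)\<^sup>2"] by (simp add: not_le)
      then show ?thesis by (simp only: set_eq_iff Int_iff Diff_iff mem_Collect_eq mem_cball_0) blast
    qed
    show ?thesis
    proof (cases "x < 1")
      case True
      have "sqrt x < 1" using True by simp
      then have sub: "cball 0 (sqrt x) \<subseteq> ?D" by (meson mem_ball_0 mem_cball_0 le_less_trans subsetI)
      have "emeasure lborel (?D - cball 0 (sqrt x)) = emeasure lborel ?D - emeasure lborel (cball 0 (sqrt x) :: complex set)"
        using True x0 emeasure_lborel_cball_finite[of "0::complex" "sqrt x"]
        by (intro emeasure_Diff sub) auto
      also have "\<dots> = ennreal pi - ennreal (pi * x)"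
        using True x0 by (simp add: emeasure_ball emeasure_cball unit_ball_vol_2)
      also have "\<dots> = ennreal (pi - pi * x)" using x0 by (intro ennreal_minus) simp
      finally show ?thesis unfolding eq using True x0 by (simp add: algebra_simps)
    next
      case False
      then have "1 \<le> sqrt x" by simp
      then have "?D \<subseteq> cball 0 (sqrt x)" by (meson mem_ball_0 mem_cball_0 less_le_trans less_imp_le subsetI)
      then have em: "?D - cball 0 (sqrt x) = {}" by blast
      show ?thesis unfolding eq em using False x0 by simp
    qed
  qed
  finally show ?thesis .
qed

text \<open>The substitution \<open>t = (cmod z)\<^sup>2\<close> plays the role of polar
  coordinates: area becomes pi times length, and radial integrals become integrals over an
  interval.\<close>

lemma distr_cmod_square_lborel_disc:
  "distr (restrict_space lborel (ball 0 1 :: complex set)) borel (\<lambda>z. (cmod z)\<^sup>2)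
    = density lborel (\<lambda>t. ennreal pi * indicator {0..<1} t)"
proof (rule measure_eqI_lessThan)
  fix x :: real
  show "emeasure (distr (restrict_space lborel (ball 0 1 :: complex set)) borel (\<lambda>z. (cmod z)\<^sup>2)) {x<..} < \<infinity>"
    unfolding emeasure_radial by simp
  have "emeasure (density lborel (\<lambda>t. ennreal pi * indicator {0..<1} t)) {x<..}
    = (\<integral>\<^sup>+t. ennreal pi * indicator ({0..<1} \<inter> {x<..}) t \<partial>lborel)"
    by (subst emeasure_density) (auto intro!: nn_integral_cong simp: indicator_def)
  also have "\<dots> = ennreal pi * emeasure lborel ({0..<1} \<inter> {x<..})"
    by (subst nn_integral_cmult_indicator) auto
  also have "{0..<1} \<inter> {x<..} = (if x < 0 then {0..<1} else {x<..<1})"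
    by auto
  also have "ennreal pi * emeasure lborel \<dots> = ennreal (pi * (if x < 0 then 1 else if x < 1 then 1 - x else 0))"
    by (auto simp: ennreal_mult' emeasure_lborel_Ioo)
  finally show "emeasure (distr (restrict_space lborel (ball 0 1 :: complex set)) borel (\<lambda>z. (cmod z)\<^sup>2)) {x<..}
    = emeasure (density lborel (\<lambda>t. ennreal pi * indicator {0..<1} t)) {x<..}"
    unfolding emeasure_radial by simp
qed auto

text \<open>In the variable \<open>t = (cmod z)\<^sup>2\<close> this is Euler's Beta integral. The
  exponent \<open>s\<close> is free because three values matter: 0 for norms of monomials, 1 for the
  extra weight, and \<open>-\<alpha>\<close>, where the density cancels and Euclidean area
  remains.\<close>

lemma bergman_moment:
  assumes \<alpha>: "\<alpha> > -1" and s: "\<alpha> + s > -1"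
  shows "has_bochner_integral (bergman_measure \<alpha>) (\<lambda>z. cmod z ^ (2 * k) * (1 - (cmod z)\<^sup>2) powr s)
    ((1 + \<alpha>) * Beta (real k + 1) (\<alpha> + s + 1))"
proof -
  let ?R = "restrict_space lborel (ball 0 1 :: complex set)"
  let ?h = "\<lambda>t::real. t ^ k * (1 - t) powr s"
  let ?w = "\<lambda>t::real. ennreal ((1 + \<alpha>) * (1 - t) powr \<alpha> / pi)"
  have B: "Beta (real k + 1) (\<alpha> + s + 1) \<ge> 0"
    using s by (simp add: Beta_def Gamma_real_nonneg)
  have m: "(\<lambda>z. (cmod z)\<^sup>2) \<in> ?R \<rightarrow>\<^sub>M borel" by (intro measurable_restrict_space1) auto
  have "(\<integral>\<^sup>+z. ennreal (cmod z ^ (2 * k) * (1 - (cmod z)\<^sup>2) powr s) \<partial>bergman_measure \<alpha>)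
    = (\<integral>\<^sup>+z. ?w ((cmod z)\<^sup>2) * ennreal (?h ((cmod z)\<^sup>2)) \<partial>?R)"
    unfolding bergman_measure_def
    by (subst nn_integral_density[OF bergman_density_measurable])
       (auto simp: power_mult intro!: measurable_restrict_space1)
  also have "\<dots> = (\<integral>\<^sup>+t. ?w t * ennreal (?h t) \<partial>distr ?R borel (\<lambda>z. (cmod z)\<^sup>2))"
    using m by (subst nn_integral_distr) auto
  also have "\<dots> = (\<integral>\<^sup>+t. (ennreal pi * indicator {0..<1} t) * (?w t * ennreal (?h t)) \<partial>lborel)"
    unfolding distr_cmod_square_lborel_disc by (subst nn_integral_density) auto
  also have "\<dots> = (\<integral>\<^sup>+t. ennreal (1 + \<alpha>) * ennreal (indicator {0..1} t * (t powr (real k + 1 - 1) * (1 - t) powr (\<alpha> + s + 1 - 1))) \<partial>lborel)"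
  proof (rule nn_integral_cong_AE)
    \<comment> \<open>At \<open>t = 0\<close> with \<open>k = 0\<close> the two integrands differ:
      \<open>0 ^ 0\<close> is 1, but \<open>0 powr 0\<close> is 0. Hence the endpoints are
      discarded.\<close>
    have "AE t in lborel. t \<noteq> (0::real) \<and> t \<noteq> 1"
      using AE_lborel_singleton[of "0::real"] AE_lborel_singleton[of "1::real"] by eventually_elim auto
    then show "AE t in lborel. (ennreal pi * indicator {0..<1} t) * (?w t * ennreal (?h t))
      = ennreal (1 + \<alpha>) * ennreal (indicator {0..1} t * (t powr (real k + 1 - 1) * (1 - t) powr (\<alpha> + s + 1 - 1)))"
    proof eventually_elim
      fix t :: real assume t: "t \<noteq> 0 \<and> t \<noteq> 1"
      show "(ennreal pi * indicator {0..<1} t) * (?w t * ennreal (?h t))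
      = ennreal (1 + \<alpha>) * ennreal (indicator {0..1} t * (t powr (real k + 1 - 1) * (1 - t) powr (\<alpha> + s + 1 - 1)))"
      proof (cases "t \<in> {0<..<1}")
        case True
        have "pi * (((1 + \<alpha>) * (1 - t) powr \<alpha> / pi) * ?h t) = (1 + \<alpha>) * (t powr (real k + 1 - 1) * (1 - t) powr (\<alpha> + s + 1 - 1))"
          using True by (simp add: powr_add powr_realpow)
        then have "ennreal (pi * (((1 + \<alpha>) * (1 - t) powr \<alpha> / pi) * ?h t))
          = ennreal ((1 + \<alpha>) * (t powr (real k + 1 - 1) * (1 - t) powr (\<alpha> + s + 1 - 1)))" by (rule arg_cong)
        moreover have "ennreal pi * (ennreal a * ennreal b) = ennreal (pi * (a * b))" if "0 \<le> a" "0 \<le> b" for a b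
          using that by (simp add: ennreal_mult)
        moreover have "ennreal (1 + \<alpha>) * ennreal b = ennreal ((1 + \<alpha>) * b)" for b
          using \<alpha> by (simp add: ennreal_mult')
        moreover have "0 \<le> (1 + \<alpha>) * (1 - t) powr \<alpha> / pi" "0 \<le> ?h t" using True \<alpha> by auto
        moreover have "indicator {0..<1} t = (1::ennreal)" "indicator {0..1} t = (1::real)" using True by auto
        ultimately show ?thesis
          by (simp only: mult_1_right mult_1_left)
      next
        case False
        then have "t < 0 \<or> t > 1" using t by auto
        then show ?thesis by (auto simp: indicator_def)
      qed
    qed
  qed
  also have "\<dots> = ennreal (1 + \<alpha>) * ennreal (Beta (real k + 1) (\<alpha> + s + 1))"
    using s by (subst nn_integral_cmult, simp, subst nn_integral_has_integral_lebesgue[OF _ has_integral_Beta_real]) auto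
  also have "\<dots> = ennreal ((1 + \<alpha>) * Beta (real k + 1) (\<alpha> + s + 1))"
    using \<alpha> by (simp add: ennreal_mult')
  finally show ?thesis
    using \<alpha> B
    by (intro has_bochner_integral_nn_integral AE_I2 borel_measurable_bergman) auto
qed

section \<open>The inner product of the Bergman space\<close>

lemma square_integrable_mult:
  fixes f g :: "'a \<Rightarrow> complex"
  assumes m: "f \<in> borel_measurable M" "g \<in> borel_measurable M"
    and i: "integrable M (\<lambda>z. (cmod (f z))\<^sup>2)" "integrable M (\<lambda>z. (cmod (g z))\<^sup>2)"
  shows "integrable M (\<lambda>z. f z * cnj (g z))"
proof (rule Bochner_Integration.integrable_bound[OF Bochner_Integration.integrable_add[OF i]])
  show "(\<lambda>z. f z * cnj (g z)) \<in> borel_measurable M"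
    using m by (intro borel_measurable_times measurable_compose[OF m(2)]) (auto intro: borel_measurable_continuous_onI continuous_intros)
  show "AE z in M. norm (f z * cnj (g z)) \<le> norm ((cmod (f z))\<^sup>2 + (cmod (g z))\<^sup>2)"
  proof (rule AE_I2)
    fix z
    have "0 \<le> (cmod (f z) - cmod (g z))\<^sup>2" by simp
    then have "2 * (cmod (f z) * cmod (g z)) \<le> (cmod (f z))\<^sup>2 + (cmod (g z))\<^sup>2"
      by (simp add: power2_diff)
    moreover have "0 \<le> cmod (f z) * cmod (g z)" by simp
    ultimately have "cmod (f z) * cmod (g z) \<le> (cmod (f z))\<^sup>2 + (cmod (g z))\<^sup>2" by linarith
    then show "norm (f z * cnj (g z)) \<le> norm ((cmod (f z))\<^sup>2 + (cmod (g z))\<^sup>2)"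
      by (simp add: norm_mult)
  qed
qed

text \<open>The quadratic \<open>\<integral> (c |f| - d |g|)\<^sup>2 \<ge> 0\<close> is optimised over the real scalars \<open>c\<close>, \<open>d\<close>.\<close>

lemma cauchy_schwarz_integral:
  fixes f g :: "'a \<Rightarrow> complex"
  assumes m: "f \<in> borel_measurable M" "g \<in> borel_measurable M"
    and i: "integrable M (\<lambda>z. (cmod (f z))\<^sup>2)" "integrable M (\<lambda>z. (cmod (g z))\<^sup>2)"
  shows "(cmod (\<integral>z. f z * cnj (g z) \<partial>M))\<^sup>2 \<le> (\<integral>z. (cmod (f z))\<^sup>2 \<partial>M) * (\<integral>z. (cmod (g z))\<^sup>2 \<partial>M)"
proof -
  let ?A = "\<integral>z. (cmod (f z))\<^sup>2 \<partial>M" and ?B = "\<integral>z. (cmod (g z))\<^sup>2 \<partial>M"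
  define P where "P = (\<integral>z. cmod (f z * cnj (g z)) \<partial>M)"
  have iP: "integrable M (\<lambda>z. cmod (f z * cnj (g z)))"
    using square_integrable_mult[OF m i] by (rule integrable_norm)
  have P0: "0 \<le> P" unfolding P_def by (intro integral_nonneg_AE) auto
  have q: "0 \<le> c\<^sup>2 * ?A - 2 * c * d * P + d\<^sup>2 * ?B" for c d :: real
  proof -
    have "0 \<le> (\<integral>z. (c * cmod (f z) - d * cmod (g z))\<^sup>2 \<partial>M)" by (intro integral_nonneg_AE) auto
    also have "\<dots> = (\<integral>z. c\<^sup>2 * (cmod (f z))\<^sup>2 - (2 * c * d) * cmod (f z * cnj (g z)) + d\<^sup>2 * (cmod (g z))\<^sup>2 \<partial>M)"
      by (intro Bochner_Integration.integral_cong) (auto simp: power2_eq_square norm_mult algebra_simps)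
    also have "\<dots> = c\<^sup>2 * ?A - 2 * c * d * P + d\<^sup>2 * ?B"
      using i iP unfolding P_def by simp
    finally show ?thesis .
  qed
  have A0: "0 \<le> ?A" and B0: "0 \<le> ?B" by (intro integral_nonneg_AE; auto)+
  have "P\<^sup>2 \<le> ?A * ?B"
  proof (cases "?B = 0")
    case True
    have "P = 0"
    proof (rule ccontr)
      assume "P \<noteq> 0"
      \<comment> \<open>With \<open>?B = 0\<close> the quadratic is linear in \<open>d\<close>, and
        this \<open>d\<close> makes it equal to \<open>- ?A - 2\<close>, which is negative.\<close>
      have "0 \<le> ?A - 2 * ((?A + 1) / P) * P" using q[of 1 "(?A + 1) / P"] True by simp
      then show False using \<open>P \<noteq> 0\<close> A0 by simp
    qed
    then show ?thesis using True by simp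
  next
    case False
    have "0 \<le> ?B\<^sup>2 * ?A - 2 * ?B * P * P + P\<^sup>2 * ?B" by (rule q)
    also have "\<dots> = ?B * (?A * ?B - P\<^sup>2)" by (simp add: power2_eq_square algebra_simps)
    finally show ?thesis using False B0 by (simp add: zero_le_mult_iff)
  qed
  moreover have "cmod (\<integral>z. f z * cnj (g z) \<partial>M) \<le> P" unfolding P_def by (rule integral_norm_bound)
  then have "(cmod (\<integral>z. f z * cnj (g z) \<partial>M))\<^sup>2 \<le> P\<^sup>2" by (intro power_mono) auto
  ultimately show ?thesis by linarith
qed

lemma bergman_space_holomorphic: "f \<in> bergman_space \<alpha> \<Longrightarrow> f holomorphic_on ball 0 1"
  and bergman_space_square_integrable:
    "f \<in> bergman_space \<alpha> \<Longrightarrow> integrable (bergman_measure \<alpha>) (\<lambda>z. (cmod (f z))\<^sup>2)"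
  by (simp_all add: bergman_space_def)

lemma bergman_space_measurable: "f \<in> bergman_space \<alpha> \<Longrightarrow> f \<in> borel_measurable (bergman_measure \<alpha>)"
  by (simp add: bergman_space_holomorphic continuous_on_bergman_measurable holomorphic_on_imp_continuous_on)

lemma bergman_inner_integrable:
  "f \<in> bergman_space \<alpha> \<Longrightarrow> g \<in> bergman_space \<alpha> \<Longrightarrow> integrable (bergman_measure \<alpha>) (\<lambda>z. f z * cnj (g z))"
  by (intro square_integrable_mult bergman_space_measurable bergman_space_square_integrable)

lemma bergman_norm_square: "(bergman_norm \<alpha> f)\<^sup>2 = (\<integral>z. (cmod (f z))\<^sup>2 \<partial>bergman_measure \<alpha>)"
  unfolding bergman_norm_def by (intro real_sqrt_pow2 integral_nonneg_AE) auto

lemma bergman_inner_self: "bergman_inner \<alpha> f f = of_real ((bergman_norm \<alpha> f)\<^sup>2)"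
  unfolding bergman_norm_square bergman_inner_def
  by (simp add: complex_norm_square[symmetric] del: of_real_power flip: integral_complex_of_real)

lemma bergman_inner_commute: "bergman_inner \<alpha> g f = cnj (bergman_inner \<alpha> f g)"
  unfolding bergman_inner_def by (simp add: mult.commute flip: Bochner_Integration.integral_cnj)

lemma bergman_cauchy_schwarz:
  "f \<in> bergman_space \<alpha> \<Longrightarrow> g \<in> bergman_space \<alpha> \<Longrightarrow>
    (cmod (bergman_inner \<alpha> f g))\<^sup>2 \<le> (bergman_norm \<alpha> f)\<^sup>2 * (bergman_norm \<alpha> g)\<^sup>2"
  unfolding bergman_norm_square bergman_inner_def
  by (intro cauchy_schwarz_integral bergman_space_measurable bergman_space_square_integrable)

lemma bergman_space_scale: "f \<in> bergman_space \<alpha> \<Longrightarrow> (\<lambda>z. c * f z) \<in> bergman_space \<alpha>"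
  unfolding bergman_space_def by (auto simp: norm_mult power_mult_distrib intro!: holomorphic_intros)

lemma bergman_space_add:
  assumes "f \<in> bergman_space \<alpha>" "g \<in> bergman_space \<alpha>"
  shows "(\<lambda>z. f z + g z) \<in> bergman_space \<alpha>"
proof -
  have "integrable (bergman_measure \<alpha>) (\<lambda>z. (cmod (f z + g z))\<^sup>2)"
  proof (rule Bochner_Integration.integrable_bound)
    show "integrable (bergman_measure \<alpha>) (\<lambda>z. 2 * (cmod (f z))\<^sup>2 + 2 * (cmod (g z))\<^sup>2)"
      using assms by (simp add: bergman_space_square_integrable)
    show "(\<lambda>z. (cmod (f z + g z))\<^sup>2) \<in> borel_measurable (bergman_measure \<alpha>)"
      using assms[THEN bergman_space_measurable] by measurable
    have "(cmod (f z + g z))\<^sup>2 \<le> 2 * (cmod (f z))\<^sup>2 + 2 * (cmod (g z))\<^sup>2" for z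
    proof -
      have "(cmod (f z + g z))\<^sup>2 \<le> (cmod (f z) + cmod (g z))\<^sup>2"
        by (intro power_mono norm_triangle_ineq) auto
      also have "\<dots> \<le> 2 * (cmod (f z))\<^sup>2 + 2 * (cmod (g z))\<^sup>2"
        using zero_le_power2[of "cmod (f z) - cmod (g z)"] by (simp add: power2_sum power2_diff)
      finally show ?thesis .
    qed
    then show "AE z in bergman_measure \<alpha>. norm ((cmod (f z + g z))\<^sup>2) \<le> norm (2 * (cmod (f z))\<^sup>2 + 2 * (cmod (g z))\<^sup>2)"
      by auto
  qed
  then show ?thesis
    using assms by (auto simp: bergman_space_def intro!: holomorphic_intros)
qed

lemma bergman_space_zero: "(\<lambda>z. 0) \<in> bergman_space \<alpha>"
  by (simp add: bergman_space_def)

lemma bergman_space_sum: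
  "(\<And>i. i \<in> I \<Longrightarrow> f i \<in> bergman_space \<alpha>) \<Longrightarrow> (\<lambda>z. \<Sum>i\<in>I. c i * f i z) \<in> bergman_space \<alpha>"
proof (induction I rule: infinite_finite_induct)
  case (insert i I)
  then have "(\<lambda>z. c i * f i z + (\<Sum>i\<in>I. c i * f i z)) \<in> bergman_space \<alpha>"
    by (intro bergman_space_add bergman_space_scale) auto
  then show ?case using insert by simp
qed (simp_all add: bergman_space_zero)

lemma bergman_inner_sum_left:
  assumes "\<And>i. i \<in> I \<Longrightarrow> f i \<in> bergman_space \<alpha>" "g \<in> bergman_space \<alpha>"
  shows "bergman_inner \<alpha> (\<lambda>z. \<Sum>i\<in>I. c i * f i z) g = (\<Sum>i\<in>I. c i * bergman_inner \<alpha> (f i) g)"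
proof -
  have "bergman_inner \<alpha> (\<lambda>z. \<Sum>i\<in>I. c i * f i z) g = (\<integral>z. (\<Sum>i\<in>I. c i * (f i z * cnj (g z))) \<partial>bergman_measure \<alpha>)"
    unfolding bergman_inner_def by (simp add: sum_distrib_right mult.assoc)
  also have "\<dots> = (\<Sum>i\<in>I. (\<integral>z. c i * (f i z * cnj (g z)) \<partial>bergman_measure \<alpha>))"
    using assms by (intro Bochner_Integration.integral_sum integrable_mult_right bergman_inner_integrable)
  also have "\<dots> = (\<Sum>i\<in>I. c i * bergman_inner \<alpha> (f i) g)"
    unfolding bergman_inner_def by simp
  finally show ?thesis .
qed

lemma bergman_inner_sum_right:
  assumes "\<And>i. i \<in> I \<Longrightarrow> f i \<in> bergman_space \<alpha>" "g \<in> bergman_space \<alpha>"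
  shows "bergman_inner \<alpha> g (\<lambda>z. \<Sum>i\<in>I. c i * f i z) = (\<Sum>i\<in>I. cnj (c i) * bergman_inner \<alpha> g (f i))"
  by (subst bergman_inner_commute) (simp add: bergman_inner_sum_left assms bergman_inner_commute[of \<alpha> g])

lemma bergman_inner_diff_left:
  assumes "f \<in> bergman_space \<alpha>" "g \<in> bergman_space \<alpha>" "h \<in> bergman_space \<alpha>"
  shows "bergman_inner \<alpha> (\<lambda>z. f z - g z) h = bergman_inner \<alpha> f h - bergman_inner \<alpha> g h"
  unfolding bergman_inner_def using assms
  by (subst Bochner_Integration.integral_diff[symmetric]) (auto intro!: bergman_inner_integrable simp: algebra_simps)

section \<open>Taylor coefficients\<close>

text \<open>The squared norm of the monomial \<open>z ^ k\<close>, that is, the value of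
  \<open>bergman_moment\<close> at exponent 0. Its inverse square root is the coefficient in
  \<open>bergman_basis\<close>.\<close>

definition bergman_sqnorm :: "real \<Rightarrow> nat \<Rightarrow> real" where
  "bergman_sqnorm \<alpha> k = (1 + \<alpha>) * Beta (real k + 1) (\<alpha> + 1)"

lemma bergman_sqnorm_Gamma:
  assumes "\<alpha> > -1"
  shows "bergman_sqnorm \<alpha> k = fact k * Gamma (2 + \<alpha>) / Gamma (real k + 2 + \<alpha>)"
proof -
  have "Gamma (\<alpha> + 1 + 1) = (\<alpha> + 1) * Gamma (\<alpha> + 1)"
    using assms by (intro Gamma_plus1) (auto elim!: nonpos_Ints_cases)
  moreover have "Gamma (real k + 1) = fact k" using Gamma_fact[of k] by (simp add: add.commute)
  ultimately show ?thesis unfolding bergman_sqnorm_def Beta_def by (simp add: add_ac)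
qed

lemma bergman_sqnorm_pos: "\<alpha> > -1 \<Longrightarrow> 0 < bergman_sqnorm \<alpha> k"
  by (simp add: bergman_sqnorm_Gamma Gamma_real_pos)

lemma bergman_basis_eq: "\<alpha> > -1 \<Longrightarrow> bergman_basis \<alpha> k = (\<lambda>z. of_real (1 / sqrt (bergman_sqnorm \<alpha> k)) * z ^ k)"
  unfolding bergman_basis_def[abs_def] by (simp add: bergman_sqnorm_Gamma real_sqrt_divide)

lemma bergman_sqnorm_Suc:
  assumes "\<alpha> > -1"
  shows "bergman_sqnorm \<alpha> (Suc k) * (real k + 2 + \<alpha>) = bergman_sqnorm \<alpha> k * (real k + 1)"
proof -
  have "Gamma (real k + 2 + \<alpha> + 1) = (real k + 2 + \<alpha>) * Gamma (real k + 2 + \<alpha>)"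
    using assms by (intro Gamma_plus1) (auto elim!: nonpos_Ints_cases)
  moreover have "real (Suc k) + 2 + \<alpha> = real k + 2 + \<alpha> + 1" by simp
  ultimately have e: "Gamma (real (Suc k) + 2 + \<alpha>) = (real k + 2 + \<alpha>) * Gamma (real k + 2 + \<alpha>)"
    by (simp only:)
  have "real k + 2 + \<alpha> \<noteq> 0" using assms by linarith
  then have "fact (Suc k) * Gamma (2 + \<alpha>) / ((real k + 2 + \<alpha>) * Gamma (real k + 2 + \<alpha>)) * (real k + 2 + \<alpha>)
      = fact k * Gamma (2 + \<alpha>) / Gamma (real k + 2 + \<alpha>) * (real k + 1)"
    by (simp add: add_ac)
  then show ?thesis by (simp only: bergman_sqnorm_Gamma[OF assms] e)
qed

lemma bergman_sqnorm_antimono: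
  assumes \<alpha>: "\<alpha> > -1" and "k \<le> l"
  shows "bergman_sqnorm \<alpha> l \<le> bergman_sqnorm \<alpha> k"
  using \<open>k \<le> l\<close>
proof (induction l rule: dec_induct)
  case (step n)
  have "bergman_sqnorm \<alpha> (Suc n) * (real n + 1) \<le> bergman_sqnorm \<alpha> (Suc n) * (real n + 2 + \<alpha>)"
    using \<alpha> bergman_sqnorm_pos[OF \<alpha>, of "Suc n"] by (intro mult_left_mono) auto
  also have "\<dots> = bergman_sqnorm \<alpha> n * (real n + 1)" by (rule bergman_sqnorm_Suc[OF \<alpha>])
  finally have "bergman_sqnorm \<alpha> (Suc n) \<le> bergman_sqnorm \<alpha> n" by (simp add: mult_le_cancel_right)
  then show ?case using step by simp
qed simp

text \<open>One step beyond degree \<open>L\<close> changes the squared norm by a factor of at most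
  \<open>1 + (1 + \<alpha>) / L\<close>, hence at most \<open>exp ((1 + \<alpha>) / L)\<close>. For
  \<open>j = 3 * L\<close> the total factor does not depend on \<open>L\<close>, so all monomials of
  degree between \<open>L\<close> and \<open>4 * L\<close> have comparable norms.\<close>

lemma bergman_sqnorm_le_exp:
  assumes \<alpha>: "\<alpha> > -1" and L: "L > 0"
  shows "bergman_sqnorm \<alpha> L \<le> exp (real j * (1 + \<alpha>) / real L) * bergman_sqnorm \<alpha> (L + j)"
proof (induction j)
  case (Suc j)
  let ?k = "L + j"
  have "bergman_sqnorm \<alpha> ?k = bergman_sqnorm \<alpha> (Suc ?k) * (1 + (1 + \<alpha>) / (real ?k + 1))"
    using bergman_sqnorm_Suc[OF \<alpha>, of ?k] by (simp add: field_simps)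
  also have "\<dots> \<le> bergman_sqnorm \<alpha> (Suc ?k) * exp ((1 + \<alpha>) / real L)"
  proof (intro mult_left_mono less_imp_le[OF bergman_sqnorm_pos[OF \<alpha>]])
    have "1 + (1 + \<alpha>) / (real ?k + 1) \<le> 1 + (1 + \<alpha>) / real L"
      using \<alpha> L by (intro add_left_mono divide_left_mono) auto
    also have "\<dots> \<le> exp ((1 + \<alpha>) / real L)" by (rule exp_ge_add_one_self)
    finally show "1 + (1 + \<alpha>) / (real ?k + 1) \<le> exp ((1 + \<alpha>) / real L)" .
  qed
  finally have "exp (real j * (1 + \<alpha>) / real L) * bergman_sqnorm \<alpha> ?k
     \<le> exp (real j * (1 + \<alpha>) / real L) * (bergman_sqnorm \<alpha> (Suc ?k) * exp ((1 + \<alpha>) / real L))"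
    by (intro mult_left_mono) auto
  also have "\<dots> = exp (real (Suc j) * (1 + \<alpha>) / real L) * bergman_sqnorm \<alpha> (Suc ?k)"
    by (simp add: exp_add[symmetric] add_divide_distrib algebra_simps)
  finally show ?case using Suc by simp
qed simp

lemma bergman_moment_0:
  assumes "\<alpha> > -1"
  shows "has_bochner_integral (bergman_measure \<alpha>) (\<lambda>z. cmod z ^ (2 * k)) (bergman_sqnorm \<alpha> k)"
proof -
  have "has_bochner_integral (bergman_measure \<alpha>) (\<lambda>z. cmod z ^ (2 * k) * (1 - (cmod z)\<^sup>2) powr 0) (bergman_sqnorm \<alpha> k)"
    using bergman_moment[of \<alpha> 0 k] assms by (simp add: bergman_sqnorm_def)
  then show ?thesis
    by (rule has_bochner_integral_cong[THEN iffD1, rotated -1]) (auto simp: abs_square_eq_1)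
qed

text \<open>The recurrence of the Gamma function in both places of the Beta function. The ratio to
  the unweighted moment is the origin of the multiplier \<open>real k + 2 + \<alpha>\<close> used
  later.\<close>

lemma bergman_moment_1:
  assumes \<alpha>: "\<alpha> > -1"
  shows "has_bochner_integral (bergman_measure \<alpha>) (\<lambda>z. cmod z ^ (2 * k) * (1 - (cmod z)\<^sup>2))
    ((1 + \<alpha>) / (real k + 2 + \<alpha>) * bergman_sqnorm \<alpha> k)"
proof -
  have g1: "Gamma (\<alpha> + 1 + 1) = (\<alpha> + 1) * Gamma (\<alpha> + 1)"
    using assms by (intro Gamma_plus1) (auto elim!: nonpos_Ints_cases)
  have g2: "Gamma (real k + 2 + \<alpha> + 1) = (real k + 2 + \<alpha>) * Gamma (real k + 2 + \<alpha>)"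
    using assms by (intro Gamma_plus1) (auto elim!: nonpos_Ints_cases)
  have "Gamma (real k + 2 + \<alpha>) > 0" using assms by (intro Gamma_real_pos) simp
  then have "Beta (real k + 1) (\<alpha> + 1 + 1) = (1 + \<alpha>) / (real k + 2 + \<alpha>) * Beta (real k + 1) (\<alpha> + 1)"
    using g1 g2 \<alpha> unfolding Beta_def by (simp add: add_ac divide_simps)
  then have "has_bochner_integral (bergman_measure \<alpha>) (\<lambda>z. cmod z ^ (2 * k) * (1 - (cmod z)\<^sup>2) powr 1)
    ((1 + \<alpha>) / (real k + 2 + \<alpha>) * bergman_sqnorm \<alpha> k)"
    using bergman_moment[of \<alpha> 1 k] \<alpha> by (simp add: bergman_sqnorm_def mult_ac)
  then show ?thesis
    by (rule has_bochner_integral_cong[THEN iffD1, rotated -1]) (auto simp: abs_square_le_1)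
qed

lemma finite_measure_bergman: "\<alpha> > -1 \<Longrightarrow> finite_measure (bergman_measure \<alpha>)"
  using bergman_moment_0[of \<alpha> 0]
  by (auto simp: has_bochner_integral_iff integrable_iff_bounded intro!: finite_measureI)

lemma bergman_integrable_bounded:
  fixes f :: "complex \<Rightarrow> 'b::{banach, second_countable_topology}"
  assumes "\<alpha> > -1" "f \<in> borel_measurable (bergman_measure \<alpha>)" "\<And>z. z \<in> ball 0 1 \<Longrightarrow> norm (f z) \<le> B"
  shows "integrable (bergman_measure \<alpha>) f"
  by (intro finite_measure.integrable_const_bound[OF finite_measure_bergman[OF assms(1)], where B = B] AE_I2 assms)
     (use assms(3) in auto)

section \<open>Orthogonality of monomials and extraction of Taylor coefficients\<close>

lemma cnj_measurable [measurable]: "cnj \<in> borel_measurable borel"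
  by (intro borel_measurable_continuous_onI continuous_intros)

text \<open>Rotation by the angle \<open>pi / (n - k)\<close> preserves the measure and the radial
  weight and multiplies the integrand by -1.\<close>

lemma bergman_monomials_orthogonal:
  assumes v: "v \<in> borel_measurable borel" and nk: "n \<noteq> k"
  shows "(\<integral>z. z ^ n * cnj z ^ k * of_real (v (cmod z)) \<partial>bergman_measure \<alpha>) = 0" (is "?I = 0")
proof -
  define u where "u = cis (pi / (real n - real k))"
  have "u ^ n * cnj u ^ k = cis (real n * (pi / (real n - real k)) + real k * - (pi / (real n - real k)))"
    by (simp only: u_def Complex.DeMoivre cis_cnj cis_mult)
  also have "real n * (pi / (real n - real k)) + real k * - (pi / (real n - real k)) = pi"
    using nk by (simp add: divide_simps) (simp add: algebra_simps)
  finally have u: "u ^ n * cnj u ^ k = -1" by simp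
  have "?I = (\<integral>z. (u * z) ^ n * cnj (u * z) ^ k * of_real (v (cmod (u * z))) \<partial>bergman_measure \<alpha>)"
    by (rule bergman_integral_rotation)
       (use v in \<open>auto simp: u_def intro!: borel_measurable_bergman\<close>)
  also have "\<dots> = (\<integral>z. (u ^ n * cnj u ^ k) * (z ^ n * cnj z ^ k * of_real (v (cmod z))) \<partial>bergman_measure \<alpha>)"
    by (intro Bochner_Integration.integral_cong) (auto simp: u_def norm_mult power_mult_distrib)
  also have "\<dots> = - ?I" unfolding u by simp
  finally show ?thesis by simp
qed

text \<open>Because \<open>v\<close> vanishes from radius \<open>r\<close> on, the Taylor series
  converges uniformly where the integrand lives and may be integrated term by term. Orthogonality
  leaves only the term of degree \<open>k\<close>.\<close>

lemma bergman_coefficient_truncated: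
  fixes f :: "complex \<Rightarrow> complex"
  assumes \<alpha>: "\<alpha> > -1" and f: "f holomorphic_on ball 0 1" and r: "0 < r" "r < 1"
    and v: "v \<in> borel_measurable borel" and v1: "\<And>t. 0 \<le> t \<Longrightarrow> t < 1 \<Longrightarrow> \<bar>v t\<bar> \<le> 1" and vr: "\<And>t. t \<ge> r \<Longrightarrow> v t = 0"
  shows "(\<integral>z. f z * cnj z ^ k * of_real (v (cmod z)) \<partial>bergman_measure \<alpha>) =
    (deriv ^^ k) f 0 / fact k * (\<integral>z. z ^ k * cnj z ^ k * of_real (v (cmod z)) \<partial>bergman_measure \<alpha>)"
proof -
  note [measurable] = v
  define a where "a = (\<lambda>n. (deriv ^^ n) f 0 / fact n)"
  have ser: "(\<lambda>n. a n * z ^ n) sums f z" if "z \<in> ball 0 1" for z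
    using holomorphic_power_series[OF f that] by (simp add: a_def)
  have mm: "(\<lambda>z. z ^ n * cnj z ^ k * of_real (v (cmod z))) \<in> borel_measurable (bergman_measure \<alpha>)" for n
    using v by (intro borel_measurable_bergman) measurable
  have bd: "norm (z ^ n * cnj z ^ k * of_real (v (cmod z))) \<le> (if cmod z < r then r ^ n else 0)"
    if "z \<in> ball 0 1" for z n
  proof (cases "cmod z < r")
    case True
    have "cmod z ^ n * (cmod z ^ k * \<bar>v (cmod z)\<bar>) \<le> r ^ n * (1 * 1)"
      using True that r v1 by (intro mult_mono power_mono power_le_one) auto
    then show ?thesis using True by (simp add: norm_mult norm_power mult.assoc)
  qed (simp add: vr)
  have int: "integrable (bergman_measure \<alpha>) (\<lambda>z. z ^ n * cnj z ^ k * of_real (v (cmod z)))" for n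
  proof (rule bergman_integrable_bounded[OF \<alpha> mm])
    show "norm (z ^ n * cnj z ^ k * of_real (v (cmod z))) \<le> 1" if "z \<in> ball 0 1" for z
      using bd[OF that, of n] power_le_one[of r n] r by (auto split: if_splits)
  qed
  have "(\<lambda>n. a n * of_real r ^ n) sums f (of_real r)" using r by (intro ser) auto
  then have sm: "summable (\<lambda>n. norm (a n) * r ^ n)"
  proof -
    \<comment> \<open>Convergence at a slightly larger radius gives absolute convergence at
      \<open>r\<close>, and with it a constant dominating function.\<close>
    obtain \<rho> where \<rho>: "r < \<rho>" "\<rho> < 1" using dense r by blast
    then have "summable (\<lambda>n. a n * of_real \<rho> ^ n)" using r ser[of "of_real \<rho>"] by (auto simp: sums_iff)
    then have "summable (\<lambda>n. norm (a n * of_real r ^ n))"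
      by (rule powser_insidea) (use r \<rho> in auto)
    then show ?thesis using r by (simp add: norm_mult norm_power)
  qed
  let ?s = "\<lambda>N z. (\<Sum>n<N. a n * z ^ n) * cnj z ^ k * of_real (v (cmod z))"
  have "(\<lambda>N. \<integral>z. ?s N z \<partial>bergman_measure \<alpha>) \<longlonglongrightarrow> (\<integral>z. f z * cnj z ^ k * of_real (v (cmod z)) \<partial>bergman_measure \<alpha>)"
  proof (rule integral_dominated_convergence[where w = "\<lambda>z. \<Sum>n. norm (a n) * r ^ n"])
    show "(\<lambda>z. f z * cnj z ^ k * of_real (v (cmod z))) \<in> borel_measurable (bergman_measure \<alpha>)"
      using f v by (intro borel_measurable_times continuous_on_bergman_measurable[of f] holomorphic_on_imp_continuous_on
        borel_measurable_bergman) measurable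
    show "?s N \<in> borel_measurable (bergman_measure \<alpha>)" for N
      using v by (intro borel_measurable_bergman) measurable
    show "integrable (bergman_measure \<alpha>) (\<lambda>z. \<Sum>n. norm (a n) * r ^ n)"
      by (intro finite_measure.integrable_const finite_measure_bergman \<alpha>)
    show "AE z in bergman_measure \<alpha>. (\<lambda>N. ?s N z) \<longlonglongrightarrow> f z * cnj z ^ k * of_real (v (cmod z))"
    proof (rule AE_I2)
      fix z assume "z \<in> space (bergman_measure \<alpha>)"
      then have "(\<lambda>N. \<Sum>n<N. a n * z ^ n) \<longlonglongrightarrow> f z" using ser by (simp add: sums_def)
      then show "(\<lambda>N. ?s N z) \<longlonglongrightarrow> f z * cnj z ^ k * of_real (v (cmod z))" by (intro tendsto_intros)
    qed
    show "AE z in bergman_measure \<alpha>. norm (?s N z) \<le> (\<Sum>n. norm (a n) * r ^ n)" for N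
    proof (rule AE_I2)
      fix z assume "z \<in> space (bergman_measure \<alpha>)"
      then have z: "z \<in> ball 0 1" by simp
      have "?s N z = (\<Sum>n<N. a n * (z ^ n * cnj z ^ k * of_real (v (cmod z))))"
        by (simp add: sum_distrib_right mult.assoc)
      also have "norm \<dots> \<le> (\<Sum>n<N. norm (a n) * r ^ n)"
      proof (rule sum_norm_le)
        fix n
        have "norm (z ^ n * cnj z ^ k * of_real (v (cmod z))) \<le> r ^ n"
          using bd[OF z, of n] r by (auto split: if_splits intro: order_trans)
        then show "norm (a n * (z ^ n * cnj z ^ k * of_real (v (cmod z)))) \<le> norm (a n) * r ^ n"
          unfolding norm_mult[of "a n"] by (intro mult_left_mono) auto
      qed
      also have "\<dots> \<le> (\<Sum>n. norm (a n) * r ^ n)"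
        using sm r by (intro sum_le_suminf) auto
      finally show "norm (?s N z) \<le> (\<Sum>n. norm (a n) * r ^ n)" .
    qed
  qed
  moreover have "\<forall>\<^sub>F N in sequentially. (\<integral>z. ?s N z \<partial>bergman_measure \<alpha>) =
      a k * (\<integral>z. z ^ k * cnj z ^ k * of_real (v (cmod z)) \<partial>bergman_measure \<alpha>)"
    using eventually_gt_at_top[of k]
  proof eventually_elim
    case (elim N)
    have "(\<integral>z. ?s N z \<partial>bergman_measure \<alpha>) = (\<integral>z. (\<Sum>n<N. a n * (z ^ n * cnj z ^ k * of_real (v (cmod z)))) \<partial>bergman_measure \<alpha>)"
      by (simp add: sum_distrib_right mult.assoc)
    also have "\<dots> = (\<Sum>n<N. a n * (\<integral>z. z ^ n * cnj z ^ k * of_real (v (cmod z)) \<partial>bergman_measure \<alpha>))"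
      using int by (subst Bochner_Integration.integral_sum) auto
    also have "\<dots> = (\<Sum>n<N. if n = k then a k * (\<integral>z. z ^ k * cnj z ^ k * of_real (v (cmod z)) \<partial>bergman_measure \<alpha>) else 0)"
      using bergman_monomials_orthogonal[OF v] by (intro sum.cong) auto
    finally show ?case using elim by simp
  qed
  then have "(\<lambda>N. \<integral>z. ?s N z \<partial>bergman_measure \<alpha>) \<longlonglongrightarrow>
      a k * (\<integral>z. z ^ k * cnj z ^ k * of_real (v (cmod z)) \<partial>bergman_measure \<alpha>)"
    by (rule tendsto_eventually)
  ultimately have "(\<integral>z. f z * cnj z ^ k * of_real (v (cmod z)) \<partial>bergman_measure \<alpha>)
      = a k * (\<integral>z. z ^ k * cnj z ^ k * of_real (v (cmod z)) \<partial>bergman_measure \<alpha>)"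
    by (rule LIMSEQ_unique)
  then show ?thesis by (simp only: a_def)
qed

text \<open>The Taylor series of \<open>f\<close> need not converge uniformly up to the circle, so
  the weight is cut off at radii \<open>r N\<close> tending to 1. The bound on \<open>v\<close>
  makes \<open>norm (g z)\<close> a dominating function; the limit is taken on both sides, with
  \<open>f\<close> and with \<open>z ^ k\<close> as \<open>g\<close>.\<close>

lemma bergman_coefficient:
  fixes f :: "complex \<Rightarrow> complex"
  assumes \<alpha>: "\<alpha> > -1" and f: "f holomorphic_on ball 0 1" and fi: "integrable (bergman_measure \<alpha>) f"
    and v: "v \<in> borel_measurable borel" and v1: "\<And>t. 0 \<le> t \<Longrightarrow> t < 1 \<Longrightarrow> \<bar>v t\<bar> \<le> 1"
  shows "(\<integral>z. f z * cnj z ^ k * of_real (v (cmod z)) \<partial>bergman_measure \<alpha>) =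
    (deriv ^^ k) f 0 / fact k * (\<integral>z. z ^ k * cnj z ^ k * of_real (v (cmod z)) \<partial>bergman_measure \<alpha>)"
proof -
  note [measurable] = v
  define r where "r = (\<lambda>N. 1 - 1 / (real N + 2))"
  have r: "0 < r N" "r N < 1" for N by (auto simp: r_def)
  have rlim: "r \<longlonglongrightarrow> 1" unfolding r_def by real_asymp
  define V where "V = (\<lambda>N t. if t < r N then v t else 0)"
  have V [measurable]: "V N \<in> borel_measurable borel" for N unfolding V_def using v by measurable
  have lim: "(\<lambda>N. \<integral>z. g z * cnj z ^ k * of_real (V N (cmod z)) \<partial>bergman_measure \<alpha>)
     \<longlonglongrightarrow> (\<integral>z. g z * cnj z ^ k * of_real (v (cmod z)) \<partial>bergman_measure \<alpha>)"
    if g: "integrable (bergman_measure \<alpha>) g" for g :: "complex \<Rightarrow> complex"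
  proof (rule integral_dominated_convergence[where w = "\<lambda>z. norm (g z)"])
    have gm: "g \<in> borel_measurable (bergman_measure \<alpha>)" using g by simp
    show "(\<lambda>z. g z * cnj z ^ k * of_real (v (cmod z))) \<in> borel_measurable (bergman_measure \<alpha>)"
      using v by (intro borel_measurable_times gm borel_measurable_bergman) measurable
    show "(\<lambda>z. g z * cnj z ^ k * of_real (V N (cmod z))) \<in> borel_measurable (bergman_measure \<alpha>)" for N
      using V by (intro borel_measurable_times gm borel_measurable_bergman) measurable
    show "integrable (bergman_measure \<alpha>) (\<lambda>z. norm (g z))" using g by simp
    show "AE z in bergman_measure \<alpha>. (\<lambda>N. g z * cnj z ^ k * of_real (V N (cmod z))) \<longlonglongrightarrow> g z * cnj z ^ k * of_real (v (cmod z))"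
    proof (rule AE_I2)
      fix z assume "z \<in> space (bergman_measure \<alpha>)"
      then have "\<forall>\<^sub>F N in sequentially. cmod z < r N" using order_tendstoD(1)[OF rlim] by simp
      then have "\<forall>\<^sub>F N in sequentially. g z * cnj z ^ k * of_real (v (cmod z)) = g z * cnj z ^ k * of_real (V N (cmod z))"
        by eventually_elim (simp add: V_def)
      then show "(\<lambda>N. g z * cnj z ^ k * of_real (V N (cmod z))) \<longlonglongrightarrow> g z * cnj z ^ k * of_real (v (cmod z))"
        by (rule Lim_transform_eventually[OF tendsto_const])
    qed
    show "AE z in bergman_measure \<alpha>. norm (g z * cnj z ^ k * of_real (V N (cmod z))) \<le> norm (g z)" for N
    proof (rule AE_I2)
      fix z assume "z \<in> space (bergman_measure \<alpha>)"
      then have z: "cmod z < 1" by simp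
      have "cmod (g z) * (cmod z ^ k * \<bar>V N (cmod z)\<bar>) \<le> cmod (g z) * (1 * 1)"
        using z v1 by (intro mult_left_mono mult_mono power_le_one) (auto simp: V_def)
      then show "norm (g z * cnj z ^ k * of_real (V N (cmod z))) \<le> norm (g z)"
        by (simp add: norm_mult norm_power mult.assoc)
    qed
  qed
  have zk: "integrable (bergman_measure \<alpha>) (\<lambda>z::complex. z ^ k)"
    by (rule bergman_integrable_bounded[OF \<alpha>, where B = 1])
       (auto intro!: borel_measurable_bergman power_le_one simp: norm_power)
  have "(\<integral>z. f z * cnj z ^ k * of_real (V N (cmod z)) \<partial>bergman_measure \<alpha>) =
    (deriv ^^ k) f 0 / fact k * (\<integral>z. z ^ k * cnj z ^ k * of_real (V N (cmod z)) \<partial>bergman_measure \<alpha>)" for N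
    by (rule bergman_coefficient_truncated[OF \<alpha> f r(1)[of N] r(2)[of N] V[of N]]) (auto simp: V_def v1)
  then have "(\<lambda>N. \<integral>z. f z * cnj z ^ k * of_real (V N (cmod z)) \<partial>bergman_measure \<alpha>) \<longlonglongrightarrow>
     (deriv ^^ k) f 0 / fact k * (\<integral>z. z ^ k * cnj z ^ k * of_real (v (cmod z)) \<partial>bergman_measure \<alpha>)"
    using tendsto_mult_left[OF lim[OF zk], of "(deriv ^^ k) f 0 / fact k"] by simp
  with lim[OF fi] show ?thesis by (rule LIMSEQ_unique)
qed

lemma bergman_space_integrable:
  assumes \<alpha>: "\<alpha> > -1" and f: "f \<in> bergman_space \<alpha>"
  shows "integrable (bergman_measure \<alpha>) f"
proof -
  have "(\<lambda>z. 1) \<in> bergman_space \<alpha>"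
    using finite_measure.integrable_const[OF finite_measure_bergman[OF \<alpha>], of "1::real"]
    by (simp add: bergman_space_def)
  from bergman_inner_integrable[OF f this] show ?thesis by simp
qed

lemma power_mult_cnj_power: "z ^ k * cnj z ^ k = of_real (cmod z ^ (2 * k))"
  by (simp add: power_mult_distrib[symmetric] complex_mult_cnj cmod_power2 power_mult)

lemma bergman_inner_monomial:
  assumes \<alpha>: "\<alpha> > -1" and f: "f \<in> bergman_space \<alpha>"
  shows "bergman_inner \<alpha> f (\<lambda>z. z ^ k) = (deriv ^^ k) f 0 / fact k * of_real (bergman_sqnorm \<alpha> k)"
proof -
  have "(\<integral>z. f z * cnj z ^ k * of_real 1 \<partial>bergman_measure \<alpha>) =
    (deriv ^^ k) f 0 / fact k * (\<integral>z. z ^ k * cnj z ^ k * of_real 1 \<partial>bergman_measure \<alpha>)"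
    by (rule bergman_coefficient[OF \<alpha> bergman_space_holomorphic[OF f] bergman_space_integrable[OF \<alpha> f]]) auto
  then show ?thesis
    using bergman_moment_0[OF \<alpha>, of k] unfolding power_mult_cnj_power
    by (simp add: bergman_inner_def has_bochner_integral_iff del: of_real_power)
qed

text \<open>Both pairings are the same Taylor coefficient of \<open>f\<close> times a radial moment
  of \<open>z ^ k\<close>, so they differ by the ratio of the two moments.\<close>

lemma bergman_weighted_coefficient:
  assumes \<alpha>: "\<alpha> > -1" and f: "f \<in> bergman_space \<alpha>"
  shows "of_real ((1 + \<alpha>) / (real k + 2 + \<alpha>)) * bergman_inner \<alpha> f (\<lambda>z. z ^ k) =
    (\<integral>z. f z * cnj z ^ k * of_real (1 - (cmod z)\<^sup>2) \<partial>bergman_measure \<alpha>)"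
proof -
  have "(\<integral>z. f z * cnj z ^ k * of_real (1 - (cmod z)\<^sup>2) \<partial>bergman_measure \<alpha>) =
    (deriv ^^ k) f 0 / fact k * (\<integral>z. z ^ k * cnj z ^ k * of_real (1 - (cmod z)\<^sup>2) \<partial>bergman_measure \<alpha>)"
    by (rule bergman_coefficient[OF \<alpha> bergman_space_holomorphic[OF f] bergman_space_integrable[OF \<alpha> f]])
       (auto simp: abs_square_le_1)
  also have "(\<integral>z. z ^ k * cnj z ^ k * of_real (1 - (cmod z)\<^sup>2) \<partial>bergman_measure \<alpha>)
    = of_real ((1 + \<alpha>) / (real k + 2 + \<alpha>) * bergman_sqnorm \<alpha> k)"
    using bergman_moment_1[OF \<alpha>, of k] unfolding power_mult_cnj_power of_real_mult[symmetric] integral_complex_of_real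
    by (simp add: has_bochner_integral_iff)
  finally show ?thesis by (simp add: bergman_inner_monomial[OF \<alpha> f] mult_ac)
qed

lemma monomial_bergman_space:
  assumes \<alpha>: "\<alpha> > -1"
  shows "(\<lambda>z. z ^ k) \<in> bergman_space \<alpha>"
proof -
  have "integrable (bergman_measure \<alpha>) (\<lambda>z. (cmod (z ^ k))\<^sup>2)"
    by (rule bergman_integrable_bounded[OF \<alpha>, where B = 1])
       (auto intro!: borel_measurable_bergman power_le_one simp: norm_power)
  then show ?thesis by (auto simp: bergman_space_def intro!: holomorphic_intros)
qed

lemma bergman_inner_monomials:
  assumes \<alpha>: "\<alpha> > -1"
  shows "bergman_inner \<alpha> (\<lambda>z. z ^ n) (\<lambda>z. z ^ k) = (if n = k then of_real (bergman_sqnorm \<alpha> k) else 0)"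
proof (cases "n = k")
  case True
  then show ?thesis using bergman_moment_0[OF \<alpha>, of k] unfolding bergman_inner_def
    by (simp add: power_mult_cnj_power has_bochner_integral_iff del: of_real_power)
next
  case False
  then show ?thesis using bergman_monomials_orthogonal[of "\<lambda>_. 1" n k \<alpha>] by (simp add: bergman_inner_def)
qed

lemma bergman_norm_polynomial:
  assumes \<alpha>: "\<alpha> > -1" and "finite I"
  shows "(bergman_norm \<alpha> (\<lambda>z. \<Sum>k\<in>I. c k * z ^ k))\<^sup>2 = (\<Sum>k\<in>I. (cmod (c k))\<^sup>2 * bergman_sqnorm \<alpha> k)"
proof -
  have "complex_of_real ((bergman_norm \<alpha> (\<lambda>z. \<Sum>k\<in>I. c k * z ^ k))\<^sup>2)
    = (\<Sum>n\<in>I. c n * (\<Sum>k\<in>I. cnj (c k) * bergman_inner \<alpha> (\<lambda>z. z ^ n) (\<lambda>z. z ^ k)))"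
    unfolding bergman_inner_self[symmetric]
    by (simp add: bergman_inner_sum_left bergman_inner_sum_right bergman_space_sum monomial_bergman_space[OF \<alpha>])
  also have "\<dots> = (\<Sum>n\<in>I. c n * (cnj (c n) * of_real (bergman_sqnorm \<alpha> n)))"
    using assms by (intro sum.cong refl) (simp add: bergman_inner_monomials[OF \<alpha>] if_distrib cong: if_cong)
  also have "\<dots> = (\<Sum>n\<in>I. of_real ((cmod (c n))\<^sup>2 * bergman_sqnorm \<alpha> n))"
    by (intro sum.cong refl) (simp add: of_real_cmod_square mult.assoc)
  also have "\<dots> = of_real (\<Sum>n\<in>I. (cmod (c n))\<^sup>2 * bergman_sqnorm \<alpha> n)" by simp
  finally show ?thesis by (simp only: of_real_eq_iff)
qed

lemma bergman_basis_bergman_space: "\<alpha> > -1 \<Longrightarrow> bergman_basis \<alpha> k \<in> bergman_space \<alpha>"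
  using bergman_space_scale[OF monomial_bergman_space, of \<alpha> "of_real (1 / sqrt (bergman_sqnorm \<alpha> k))" k]
  by (simp add: bergman_basis_eq)

lemma bergman_basis_orthonormal:
  assumes \<alpha>: "\<alpha> > -1"
  shows "bergman_inner \<alpha> (bergman_basis \<alpha> n) (bergman_basis \<alpha> k) = (if n = k then 1 else 0)"
proof -
  let ?g = "\<lambda>k. complex_of_real (1 / sqrt (bergman_sqnorm \<alpha> k))"
  have "bergman_inner \<alpha> (bergman_basis \<alpha> n) (bergman_basis \<alpha> k)
    = bergman_inner \<alpha> (\<lambda>z. \<Sum>i\<in>{n}. ?g i * z ^ i) (\<lambda>z. \<Sum>i\<in>{k}. ?g i * z ^ i)"
    using \<alpha> by (simp add: bergman_basis_eq)
  also have "\<dots> = ?g n * (cnj (?g k) * bergman_inner \<alpha> (\<lambda>z. z ^ n) (\<lambda>z. z ^ k))"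
    by (subst bergman_inner_sum_left, simp add: monomial_bergman_space[OF \<alpha>],
        simp add: bergman_space_scale monomial_bergman_space[OF \<alpha>] del: of_real_divide complex_cnj_complex_of_real)
       (subst bergman_inner_sum_right, auto simp: monomial_bergman_space[OF \<alpha>])
  also have "\<dots> = (if n = k then 1 else 0)"
    using bergman_sqnorm_pos[OF \<alpha>, of k]
    by (simp add: bergman_inner_monomials[OF \<alpha>] flip: of_real_mult)
  finally show ?thesis .
qed

text \<open>The mean value property. Transported by \<open>bergman_T\<close> it becomes evaluation
  at an arbitrary point, which is how the reproducing kernels enter.\<close>

lemma bergman_inner_basis_0:
  assumes \<alpha>: "\<alpha> > -1" and f: "f \<in> bergman_space \<alpha>"
  shows "bergman_inner \<alpha> f (bergman_basis \<alpha> 0) = f 0"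
proof -
  have "bergman_sqnorm \<alpha> 0 = 1" using \<alpha> by (simp add: bergman_sqnorm_Gamma Gamma_real_pos less_imp_neq[symmetric])
  then show ?thesis
    using bergman_inner_monomial[OF \<alpha> f, of 0] \<alpha> by (simp add: bergman_basis_eq)
qed

section \<open>Disc translations and the weighted Bessel bound\<close>

definition bergman_T_factor :: "real \<Rightarrow> complex \<Rightarrow> complex \<Rightarrow> complex" where
  "bergman_T_factor \<alpha> a z = exp (of_real ((2 + \<alpha>) / 2) * log_deriv_disc_aut a z)"

lemma bergman_T_eq: "bergman_T \<alpha> a f z = bergman_T_factor \<alpha> a z * f (disc_aut a z)"
  by (simp add: bergman_T_def bergman_T_factor_def)

text \<open>The chosen logarithm has real part \<open>ln (disc_aut_jac a z)\<close>, and its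
  imaginary part contributes only a phase. The result is the weight in
  \<open>bergman_distr_disc_aut\<close>, which makes \<open>bergman_T\<close> isometric.\<close>

lemma cmod_bergman_T_factor_square:
  assumes a: "a \<in> ball 0 1" and z: "z \<in> ball 0 1"
  shows "(cmod (bergman_T_factor \<alpha> a z))\<^sup>2 = disc_aut_jac a z powr (2 + \<alpha>)"
proof -
  have nz: "1 - cnj a * z \<noteq> 0" by (rule disc_aut_denominator_nonzero[OF a z])
  have "Re (log_deriv_disc_aut a z) = ln (1 - (cmod a)\<^sup>2) - 2 * ln (cmod (1 - cnj a * z))"
    using nz by (simp add: log_deriv_disc_aut_def)
  also have "\<dots> = ln (disc_aut_jac a z)"
    using nz one_minus_cmod_square_pos[OF a] unfolding disc_aut_jac_def by (simp add: ln_div ln_realpow)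
  finally have "cmod (bergman_T_factor \<alpha> a z) = exp ((2 + \<alpha>) / 2 * ln (disc_aut_jac a z))"
    by (simp add: bergman_T_factor_def)
  then have "(cmod (bergman_T_factor \<alpha> a z))\<^sup>2 = exp ((2 + \<alpha>) * ln (disc_aut_jac a z))"
    by (simp add: exp_double[symmetric])
  then show ?thesis using disc_aut_jac_pos[OF a z] by (simp add: powr_def)
qed

text \<open>The chain rule for the involution determines this sum only modulo
  \<open>2 * pi * \<i>\<close>. It is constant because \<open>1 - cnj a * disc_aut a z\<close> is a
  positive number divided by \<open>1 - cnj a * z\<close>, and on the right half-plane
  \<open>Ln\<close> respects that quotient.\<close>

lemma log_deriv_disc_aut_involution:
  assumes a: "a \<in> ball 0 1" and z: "z \<in> ball 0 1"
  shows "log_deriv_disc_aut a (disc_aut a z) + log_deriv_disc_aut a z = 2 * of_real pi * \<i>"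
proof -
  define w where "w = 1 - cnj a * z"
  have w: "Re w > 0" unfolding w_def by (rule disc_aut_denominator_Re_pos[OF a z])
  then have wn: "w \<notin> \<real>\<^sub>\<le>\<^sub>0" "w \<noteq> 0" by (auto simp: complex_nonpos_Reals_iff)
  have e: "1 - (cmod a)\<^sup>2 > 0" by (rule one_minus_cmod_square_pos[OF a])
  have "Ln (of_real (1 - (cmod a)\<^sup>2) * inverse w) = of_real (ln (1 - (cmod a)\<^sup>2)) + Ln (inverse w)"
  proof -
    have "inverse w \<noteq> 0" using wn by simp
    from Ln_times_of_real[OF e this] show ?thesis by (simp only: Ln_of_real[OF e])
  qed
  also have "\<dots> = of_real (ln (1 - (cmod a)\<^sup>2)) - Ln w"
    using wn by (simp add: Ln_inverse)
  finally have "Ln (1 - cnj a * disc_aut a z) = of_real (ln (1 - (cmod a)\<^sup>2)) - Ln w"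
    unfolding one_minus_cnj_mult_disc_aut[OF a z] w_def[symmetric] by (simp only: divide_inverse)
  then show ?thesis unfolding log_deriv_disc_aut_def w_def[symmetric] by simp
qed

lemma bergman_T_involution:
  assumes a: "a \<in> ball 0 1" and z: "z \<in> ball 0 1"
  shows "bergman_T \<alpha> a (bergman_T \<alpha> a f) z = exp (of_real ((2 + \<alpha>) * pi) * \<i>) * f z"
proof -
  have "bergman_T_factor \<alpha> a z * bergman_T_factor \<alpha> a (disc_aut a z)
    = exp (of_real ((2 + \<alpha>) / 2) * (log_deriv_disc_aut a (disc_aut a z) + log_deriv_disc_aut a z))"
    unfolding bergman_T_factor_def by (simp only: distrib_left exp_add) (simp only: mult.commute)
  also have "\<dots> = exp (of_real ((2 + \<alpha>) * pi) * \<i>)"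
    unfolding log_deriv_disc_aut_involution[OF a z] by (simp add: mult.assoc)
  finally show ?thesis
    unfolding bergman_T_eq disc_aut_involution[OF a z] by (simp add: mult.assoc[symmetric])
qed

lemma bergman_T_bergman_space:
  assumes a: "a \<in> ball 0 1" and f: "f \<in> bergman_space \<alpha>"
  shows "bergman_T \<alpha> a f \<in> bergman_space \<alpha>"
proof -
  have "bergman_T \<alpha> a f holomorphic_on ball 0 1"
  proof -
    have "disc_aut a holomorphic_on ball 0 1"
      using disc_aut_has_field_derivative[OF a] unfolding holomorphic_on_open[OF open_ball] by blast
    then have "(f \<circ> disc_aut a) holomorphic_on ball 0 1"
      using disc_aut_in_ball[OF a]
      by (intro holomorphic_on_compose_gen[OF _ bergman_space_holomorphic[OF f]]) blast+
    then have "(\<lambda>z. bergman_T_factor \<alpha> a z * (f \<circ> disc_aut a) z) holomorphic_on ball 0 1"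
      unfolding bergman_T_factor_def by (intro holomorphic_intros holomorphic_log_deriv_disc_aut a)
    then show ?thesis by (simp add: bergman_T_eq[abs_def])
  qed
  moreover have "integrable (bergman_measure \<alpha>) (\<lambda>z. (cmod (bergman_T \<alpha> a f z))\<^sup>2)"
  proof -
    have "integrable (bergman_measure \<alpha>) (\<lambda>z. disc_aut_jac a z powr (2 + \<alpha>) *\<^sub>R (cmod (f (disc_aut a z)))\<^sup>2)"
      using bergman_integrable_disc_aut[OF a, of "\<lambda>z. (cmod (f z))\<^sup>2" \<alpha>] bergman_space_square_integrable[OF f]
        bergman_space_measurable[OF f] by auto
    then show ?thesis
      by (rule Bochner_Integration.integrable_cong[THEN iffD1, rotated -1])
         (auto simp: bergman_T_eq norm_mult power_mult_distrib cmod_bergman_T_factor_square[OF a])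
  qed
  ultimately show ?thesis by (simp add: bergman_space_def)
qed

lemma bergman_T_isometry:
  assumes a: "a \<in> ball 0 1" and f: "f \<in> bergman_space \<alpha>" "g \<in> bergman_space \<alpha>"
  shows "bergman_inner \<alpha> (bergman_T \<alpha> a f) (bergman_T \<alpha> a g) = bergman_inner \<alpha> f g"
proof -
  have "bergman_inner \<alpha> f g = (\<integral>z. disc_aut_jac a z powr (2 + \<alpha>) *\<^sub>R (f (disc_aut a z) * cnj (g (disc_aut a z))) \<partial>bergman_measure \<alpha>)"
    unfolding bergman_inner_def
    by (rule bergman_integral_disc_aut[OF a]) (rule borel_measurable_integrable[OF bergman_inner_integrable[OF f]])
  also have "\<dots> = bergman_inner \<alpha> (bergman_T \<alpha> a f) (bergman_T \<alpha> a g)"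
    unfolding bergman_inner_def
  proof (rule Bochner_Integration.integral_cong[OF refl])
    fix z assume "z \<in> space (bergman_measure \<alpha>)"
    then have z: "z \<in> ball 0 1" by simp
    show "disc_aut_jac a z powr (2 + \<alpha>) *\<^sub>R (f (disc_aut a z) * cnj (g (disc_aut a z)))
      = bergman_T \<alpha> a f z * cnj (bergman_T \<alpha> a g z)"
      unfolding bergman_T_eq cmod_bergman_T_factor_square[OF a z, symmetric] scaleR_conv_of_real of_real_power
        of_real_cmod_square by simp
  qed
  finally show ?thesis by simp
qed

text \<open>An isometry that is its own inverse up to a unimodular constant is its own adjoint up to
  the same constant.\<close>

lemma bergman_inner_T_swap:
  assumes a: "a \<in> ball 0 1" and f: "f \<in> bergman_space \<alpha>" and g: "g \<in> bergman_space \<alpha>"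
  shows "bergman_inner \<alpha> (bergman_T \<alpha> a f) g = exp (of_real ((2 + \<alpha>) * pi) * \<i>) * bergman_inner \<alpha> f (bergman_T \<alpha> a g)"
proof -
  let ?k = "exp (of_real ((2 + \<alpha>) * pi) * \<i>)"
  have "bergman_inner \<alpha> f (bergman_T \<alpha> a g) = bergman_inner \<alpha> (bergman_T \<alpha> a f) (bergman_T \<alpha> a (bergman_T \<alpha> a g))"
    by (rule bergman_T_isometry[symmetric, OF a f bergman_T_bergman_space[OF a g]])
  also have "\<dots> = (\<integral>z. cnj ?k * (bergman_T \<alpha> a f z * cnj (g z)) \<partial>bergman_measure \<alpha>)"
    unfolding bergman_inner_def
    by (rule Bochner_Integration.integral_cong[OF refl]) (simp add: bergman_T_involution[OF a])
  also have "\<dots> = cnj ?k * bergman_inner \<alpha> (bergman_T \<alpha> a f) g"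
    unfolding bergman_inner_def by (rule integral_mult_right_zero)
  finally have "?k * bergman_inner \<alpha> f (bergman_T \<alpha> a g) = (?k * cnj ?k) * bergman_inner \<alpha> (bergman_T \<alpha> a f) g"
    by (simp only: mult.assoc)
  moreover have "?k * cnj ?k = 1"
    by (simp add: complex_norm_square[symmetric] del: of_real_power)
  ultimately show ?thesis by simp
qed

text \<open>Moving \<open>bergman_T\<close> to the other side turns the pairing into the value of
  \<open>bergman_T \<alpha> w f\<close> at 0, where \<open>disc_aut w\<close> takes the value
  \<open>w\<close>. So \<open>bergman_T \<alpha> w (bergman_basis \<alpha> 0)\<close> is the
  normalised reproducing kernel at \<open>w\<close>, up to a phase.\<close>

lemma bergman_inner_kernel:
  assumes \<alpha>: "\<alpha> > -1" and w: "w \<in> ball 0 1" and f: "f \<in> bergman_space \<alpha>"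
  shows "(cmod (bergman_inner \<alpha> (bergman_T \<alpha> w (bergman_basis \<alpha> 0)) f))\<^sup>2 = (1 - (cmod w)\<^sup>2) powr (2 + \<alpha>) * (cmod (f w))\<^sup>2"
proof -
  have "cmod (bergman_inner \<alpha> (bergman_T \<alpha> w (bergman_basis \<alpha> 0)) f) = cmod (bergman_inner \<alpha> f (bergman_T \<alpha> w (bergman_basis \<alpha> 0)))"
    by (subst bergman_inner_commute) simp
  also have "\<dots> = cmod (bergman_inner \<alpha> (bergman_T \<alpha> w f) (bergman_basis \<alpha> 0))"
    unfolding bergman_inner_T_swap[OF w f bergman_basis_bergman_space[OF \<alpha>]] by (simp add: norm_mult)
  also have "\<dots> = cmod (bergman_T \<alpha> w f 0)"
    by (simp only: bergman_inner_basis_0[OF \<alpha> bergman_T_bergman_space[OF w f]])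
  finally show ?thesis
    using cmod_bergman_T_factor_square[OF w, of 0 \<alpha>]
    by (simp add: bergman_T_eq norm_mult power_mult_distrib disc_aut_jac_def disc_aut_def)
qed

lemma bergman_norm_T_basis:
  assumes \<alpha>: "\<alpha> > -1" and w: "w \<in> ball 0 1"
  shows "(bergman_norm \<alpha> (bergman_T \<alpha> w (bergman_basis \<alpha> k)))\<^sup>2 = 1"
proof -
  have "complex_of_real ((bergman_norm \<alpha> (bergman_T \<alpha> w (bergman_basis \<alpha> k)))\<^sup>2) = 1"
    unfolding bergman_inner_self[symmetric] bergman_T_isometry[OF w bergman_basis_bergman_space[OF \<alpha>] bergman_basis_bergman_space[OF \<alpha>]]
    by (simp add: bergman_basis_orthonormal[OF \<alpha>])
  then show ?thesis by (simp only: of_real_eq_1_iff)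
qed

section \<open>Square integrals with the additional weight\<close>

lemma bergman_weighted_integrable:
  assumes "f \<in> bergman_space \<alpha>"
  shows "integrable (bergman_measure \<alpha>) (\<lambda>w. (cmod (f w))\<^sup>2 * (1 - (cmod w)\<^sup>2)\<^sup>2)"
proof (rule Bochner_Integration.integrable_bound[OF bergman_space_square_integrable[OF assms]])
  show "(\<lambda>w. (cmod (f w))\<^sup>2 * (1 - (cmod w)\<^sup>2)\<^sup>2) \<in> borel_measurable (bergman_measure \<alpha>)"
    using bergman_space_measurable[OF assms]
    by (intro borel_measurable_times borel_measurable_power borel_measurable_norm borel_measurable_bergman[of "\<lambda>w. 1 - (cmod w)\<^sup>2"]) auto
  show "AE w in bergman_measure \<alpha>. norm ((cmod (f w))\<^sup>2 * (1 - (cmod w)\<^sup>2)\<^sup>2) \<le> norm ((cmod (f w))\<^sup>2)"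
  proof (rule AE_I2)
    fix w assume "w \<in> space (bergman_measure \<alpha>)"
    then have "0 \<le> 1 - (cmod w)\<^sup>2" using one_minus_cmod_square_pos[of w] by simp
    then have "(1 - (cmod w)\<^sup>2)\<^sup>2 \<le> 1" by (intro power_le_one) auto
    then show "norm ((cmod (f w))\<^sup>2 * (1 - (cmod w)\<^sup>2)\<^sup>2) \<le> norm ((cmod (f w))\<^sup>2)"
      by (simp add: mult_left_le)
  qed
qed

text \<open>Testing the Bessel inequality on the normalised reproducing kernels and integrating against
  the Euclidean area of the disc.\<close>

lemma bessel_weighted_norms:
  assumes \<alpha>: "\<alpha> > -1" and I: "finite I" and y: "\<And>i. i \<in> I \<Longrightarrow> y i \<in> bergman_space \<alpha>"
    and bessel: "\<And>f. f \<in> bergman_space \<alpha> \<Longrightarrow> (\<Sum>i\<in>I. (cmod (bergman_inner \<alpha> f (y i)))\<^sup>2) \<le> C * (bergman_norm \<alpha> f)\<^sup>2"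
  shows "(\<Sum>i\<in>I. \<integral>w. (cmod (y i w))\<^sup>2 * (1 - (cmod w)\<^sup>2)\<^sup>2 \<partial>bergman_measure \<alpha>) \<le> C * (1 + \<alpha>)"
proof -
  have C: "(\<Sum>i\<in>I. (1 - (cmod w)\<^sup>2) powr (2 + \<alpha>) * (cmod (y i w))\<^sup>2) \<le> C" if w: "w \<in> ball 0 1" for w
    using bessel[OF bergman_T_bergman_space[OF w bergman_basis_bergman_space[OF \<alpha>], of 0]]
    by (simp add: bergman_inner_kernel[OF \<alpha> w y] bergman_norm_T_basis[OF \<alpha> w])
  \<comment> \<open>The exponent \<open>-\<alpha>\<close> cancels the density: the integral is
    \<open>(1 + \<alpha>) / pi\<close> times the area of the disc.\<close>
  have mom: "has_bochner_integral (bergman_measure \<alpha>) (\<lambda>w. (1 - (cmod w)\<^sup>2) powr (-\<alpha>)) (1 + \<alpha>)"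
    using bergman_moment[OF \<alpha>, of "-\<alpha>" 0] by (simp add: Beta_def Gamma_numeral)
  have "(\<Sum>i\<in>I. \<integral>w. (cmod (y i w))\<^sup>2 * (1 - (cmod w)\<^sup>2)\<^sup>2 \<partial>bergman_measure \<alpha>)
    = (\<integral>w. (\<Sum>i\<in>I. (cmod (y i w))\<^sup>2 * (1 - (cmod w)\<^sup>2)\<^sup>2) \<partial>bergman_measure \<alpha>)"
    using y by (intro Bochner_Integration.integral_sum[symmetric] bergman_weighted_integrable)
  also have "\<dots> \<le> (\<integral>w. C * (1 - (cmod w)\<^sup>2) powr (-\<alpha>) \<partial>bergman_measure \<alpha>)"
  proof (rule integral_mono_AE)
    show "integrable (bergman_measure \<alpha>) (\<lambda>w. \<Sum>i\<in>I. (cmod (y i w))\<^sup>2 * (1 - (cmod w)\<^sup>2)\<^sup>2)"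
      using y by (intro Bochner_Integration.integrable_sum bergman_weighted_integrable)
    show "integrable (bergman_measure \<alpha>) (\<lambda>w. C * (1 - (cmod w)\<^sup>2) powr (-\<alpha>))"
      using mom by (intro integrable_mult_right) (simp add: has_bochner_integral_iff)
    show "AE w in bergman_measure \<alpha>. (\<Sum>i\<in>I. (cmod (y i w))\<^sup>2 * (1 - (cmod w)\<^sup>2)\<^sup>2) \<le> C * (1 - (cmod w)\<^sup>2) powr (-\<alpha>)"
    proof (rule AE_I2)
      fix w assume "w \<in> space (bergman_measure \<alpha>)"
      then have w: "w \<in> ball 0 1" by simp
      then have p: "1 - (cmod w)\<^sup>2 > 0" by (rule one_minus_cmod_square_pos)
      have "x powr (2 + \<alpha>) * x powr (-\<alpha>) = x\<^sup>2" if "x > 0" for x :: real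
        using that by (simp flip: powr_add)
      from this[OF p] have pe: "(1 - (cmod w)\<^sup>2) powr (2 + \<alpha>) * (1 - (cmod w)\<^sup>2) powr (-\<alpha>) = (1 - (cmod w)\<^sup>2)\<^sup>2" .
      have "(\<Sum>i\<in>I. (cmod (y i w))\<^sup>2 * (1 - (cmod w)\<^sup>2)\<^sup>2) = (\<Sum>i\<in>I. (1 - (cmod w)\<^sup>2) powr (2 + \<alpha>) * (cmod (y i w))\<^sup>2) * (1 - (cmod w)\<^sup>2) powr (-\<alpha>)"
        unfolding pe[symmetric] sum_distrib_right by (simp only: mult_ac)
      also have "\<dots> \<le> C * (1 - (cmod w)\<^sup>2) powr (-\<alpha>)"
        using C[OF w] by (intro mult_right_mono) auto
      finally show "(\<Sum>i\<in>I. (cmod (y i w))\<^sup>2 * (1 - (cmod w)\<^sup>2)\<^sup>2) \<le> C * (1 - (cmod w)\<^sup>2) powr (-\<alpha>)" .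
    qed
  qed
  also have "\<dots> = C * (1 + \<alpha>)" using mom by (simp add: has_bochner_integral_iff)
  finally show ?thesis .
qed

text \<open>Under \<open>disc_aut a\<close> the weight \<open>1 - (cmod w)\<^sup>2\<close> becomes
  \<open>1 - (cmod z)\<^sup>2\<close> times \<open>disc_aut_jac a z\<close>; this produces both the
  division by \<open>1 - cnj a * z\<close> squared and the constant
  \<open>(1 - (cmod a)\<^sup>2)\<^sup>2\<close>. The denominator is conjugated so that it cancels
  when paired with the conjugate of a function carrying the same factor.\<close>

lemma bergman_T_weighted_integral:
  assumes a: "a \<in> ball 0 1" and f: "f \<in> bergman_space \<alpha>"
  shows "has_bochner_integral (bergman_measure \<alpha>)
      (\<lambda>z. (cmod (bergman_T \<alpha> a f z * of_real (1 - (cmod z)\<^sup>2) / cnj ((1 - cnj a * z)\<^sup>2)))\<^sup>2)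
      ((\<integral>w. (cmod (f w))\<^sup>2 * (1 - (cmod w)\<^sup>2)\<^sup>2 \<partial>bergman_measure \<alpha>) / (1 - (cmod a)\<^sup>2)\<^sup>2)"
proof -
  let ?h = "\<lambda>w. (cmod (f w))\<^sup>2 * (1 - (cmod w)\<^sup>2)\<^sup>2"
  have e: "1 - (cmod a)\<^sup>2 > 0" by (rule one_minus_cmod_square_pos[OF a])
  have h: "integrable (bergman_measure \<alpha>) ?h" by (rule bergman_weighted_integrable[OF f])
  have "has_bochner_integral (bergman_measure \<alpha>) (\<lambda>z. disc_aut_jac a z powr (2 + \<alpha>) *\<^sub>R ?h (disc_aut a z)) (integral\<^sup>L (bergman_measure \<alpha>) ?h)"
    using bergman_integrable_disc_aut[OF a borel_measurable_integrable[OF h]]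
      bergman_integral_disc_aut[OF a borel_measurable_integrable[OF h]] h
    by (simp add: has_bochner_integral_iff)
  then have "has_bochner_integral (bergman_measure \<alpha>)
    (\<lambda>z. (disc_aut_jac a z powr (2 + \<alpha>) *\<^sub>R ?h (disc_aut a z)) / (1 - (cmod a)\<^sup>2)\<^sup>2) (integral\<^sup>L (bergman_measure \<alpha>) ?h / (1 - (cmod a)\<^sup>2)\<^sup>2)"
    by (rule has_bochner_integral_divide_zero)
  then show ?thesis
  proof (rule has_bochner_integral_cong[THEN iffD1, rotated -1])
    fix z assume "z \<in> space (bergman_measure \<alpha>)"
    then have z: "z \<in> ball 0 1" by simp
    have n: "cmod (1 - cnj a * z) > 0" using disc_aut_denominator_nonzero[OF a z] by simp
    have "(1 - (cmod (disc_aut a z))\<^sup>2) / (1 - (cmod a)\<^sup>2) = (1 - (cmod z)\<^sup>2) / (cmod (1 - cnj a * z))\<^sup>2"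
      unfolding one_minus_disc_aut_square[OF a z] disc_aut_jac_def using e by simp
    then have eq: "((1 - (cmod (disc_aut a z))\<^sup>2) / (1 - (cmod a)\<^sup>2))\<^sup>2 = ((1 - (cmod z)\<^sup>2) / (cmod (1 - cnj a * z))\<^sup>2)\<^sup>2"
      by (rule arg_cong)
    have "disc_aut_jac a z powr (2 + \<alpha>) *\<^sub>R ?h (disc_aut a z) / (1 - (cmod a)\<^sup>2)\<^sup>2
      = disc_aut_jac a z powr (2 + \<alpha>) * (cmod (f (disc_aut a z)))\<^sup>2 * ((1 - (cmod (disc_aut a z))\<^sup>2) / (1 - (cmod a)\<^sup>2))\<^sup>2"
      by (simp only: real_scaleR_def power_divide times_divide_eq_right mult.assoc)
    also have "\<dots> = disc_aut_jac a z powr (2 + \<alpha>) * (cmod (f (disc_aut a z)))\<^sup>2 * ((1 - (cmod z)\<^sup>2) / (cmod (1 - cnj a * z))\<^sup>2)\<^sup>2"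
      by (simp only: eq)
    also have "\<dots> = (cmod (bergman_T \<alpha> a f z * of_real (1 - (cmod z)\<^sup>2) / cnj ((1 - cnj a * z)\<^sup>2)))\<^sup>2"
      unfolding bergman_T_eq norm_mult norm_divide power_mult_distrib power_divide
        cmod_bergman_T_factor_square[OF a z] complex_mod_cnj norm_power norm_of_real power2_abs
      by (simp only: times_divide_eq_right mult.assoc)
    finally show "disc_aut_jac a z powr (2 + \<alpha>) *\<^sub>R ?h (disc_aut a z) / (1 - (cmod a)\<^sup>2)\<^sup>2
      = (cmod (bergman_T \<alpha> a f z * of_real (1 - (cmod z)\<^sup>2) / cnj ((1 - cnj a * z)\<^sup>2)))\<^sup>2" .
  qed auto
qed

text \<open>The first order operator with eigenvalue \<open>real k + 2 + \<alpha>\<close> on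
  \<open>z ^ k\<close> undoes the ratio in \<open>bergman_weighted_coefficient\<close>. In exchange
  the integral gains the factor \<open>1 - (cmod z)\<^sup>2\<close>.\<close>

lemma bergman_inner_weighted_polynomial:
  fixes c :: "nat \<Rightarrow> complex"
  assumes \<alpha>: "\<alpha> > -1" and f: "f \<in> bergman_space \<alpha>"
  shows "(\<Sum>k<m. cnj (c k) * bergman_inner \<alpha> f (\<lambda>z. z ^ k)) * of_real (1 + \<alpha>) =
    (\<integral>z. f z * of_real (1 - (cmod z)\<^sup>2) * cnj (\<Sum>k<m. of_real (real k + 2 + \<alpha>) * c k * z ^ k) \<partial>bergman_measure \<alpha>)"
proof -
  let ?v = "\<lambda>z. complex_of_real (1 - (cmod z)\<^sup>2)"
  have int: "integrable (bergman_measure \<alpha>) (\<lambda>z. f z * cnj z ^ k * ?v z)" for k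
  proof (rule Bochner_Integration.integrable_bound[OF integrable_norm[OF bergman_space_integrable[OF \<alpha> f]]])
    show "(\<lambda>z. f z * cnj z ^ k * ?v z) \<in> borel_measurable (bergman_measure \<alpha>)"
      by (intro borel_measurable_times bergman_space_measurable[OF f] borel_measurable_bergman) measurable
    show "AE z in bergman_measure \<alpha>. norm (f z * cnj z ^ k * ?v z) \<le> norm (norm (f z))"
    proof (rule AE_I2)
      fix z assume "z \<in> space (bergman_measure \<alpha>)"
      then have z: "cmod z < 1" by simp
      then have p: "0 < 1 - (cmod z)\<^sup>2" using one_minus_cmod_square_pos[of z] by simp
      have v: "cmod (?v z) = 1 - (cmod z)\<^sup>2" unfolding norm_of_real using p by simp
      have "cmod (f z) * (cmod z ^ k * (1 - (cmod z)\<^sup>2)) \<le> cmod (f z) * (1 * 1)"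
        using z p by (intro mult_left_mono mult_mono power_le_one) auto
      then show "norm (f z * cnj z ^ k * ?v z) \<le> norm (norm (f z))"
        unfolding norm_mult v by (simp add: norm_power mult.assoc)
    qed
  qed
  have "cnj (c k) * bergman_inner \<alpha> f (\<lambda>z. z ^ k) * of_real (1 + \<alpha>)
    = of_real (real k + 2 + \<alpha>) * cnj (c k) * (\<integral>z. f z * cnj z ^ k * ?v z \<partial>bergman_measure \<alpha>)" for k
  proof -
    have "real k + 2 + \<alpha> \<noteq> 0" using \<alpha> by linarith
    then have "complex_of_real (real k + 2 + \<alpha>) * of_real ((1 + \<alpha>) / (real k + 2 + \<alpha>)) = of_real (1 + \<alpha>)"
      unfolding of_real_mult[symmetric] by simp
    then show ?thesis
      unfolding bergman_weighted_coefficient[OF \<alpha> f, symmetric] by (metis mult.assoc mult.commute)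
  qed
  then have "(\<Sum>k<m. cnj (c k) * bergman_inner \<alpha> f (\<lambda>z. z ^ k)) * of_real (1 + \<alpha>)
    = (\<Sum>k<m. of_real (real k + 2 + \<alpha>) * cnj (c k) * (\<integral>z. f z * cnj z ^ k * ?v z \<partial>bergman_measure \<alpha>))"
    by (simp only: sum_distrib_right)
  also have "\<dots> = (\<integral>z. (\<Sum>k<m. of_real (real k + 2 + \<alpha>) * cnj (c k) * (f z * cnj z ^ k * ?v z)) \<partial>bergman_measure \<alpha>)"
    using int by (subst Bochner_Integration.integral_sum) (auto simp: integral_mult_right_zero)
  also have "\<dots> = (\<integral>z. f z * ?v z * cnj (\<Sum>k<m. of_real (real k + 2 + \<alpha>) * c k * z ^ k) \<partial>bergman_measure \<alpha>)"
    by (intro Bochner_Integration.integral_cong refl)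
       (simp only: cnj_sum complex_cnj_mult complex_cnj_complex_of_real complex_cnj_power sum_distrib_left mult_ac)
  finally show ?thesis .
qed

text \<open>The combination \<open>Y\<close> carries the coefficients \<open>g\<close> themselves,
  so biorthogonality returns each \<open>g k\<close> and the pairing is a sum of squares. The choice
  of \<open>g\<close> is left open: the bound is strong when multiplication by
  \<open>(1 - cnj a * z)\<^sup>2\<close> makes \<open>q\<close> much smaller.\<close>

lemma biorthogonal_weighted_bound:
  fixes g :: "nat \<Rightarrow> complex"
  assumes \<alpha>: "\<alpha> > -1" and a: "a \<in> ball 0 1"
    and y: "\<And>j. j < m \<Longrightarrow> y j \<in> bergman_space \<alpha>"
    and biorth: "\<And>j k. j < m \<Longrightarrow> k < m \<Longrightarrow>
      bergman_inner \<alpha> (y j) (bergman_T \<alpha> a (bergman_basis \<alpha> k)) = (if j = k then 1 else 0)"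
  defines "q \<equiv> \<lambda>z. \<Sum>k<m. of_real (real k + 2 + \<alpha>) * (g k * of_real (1 / sqrt (bergman_sqnorm \<alpha> k))) * z ^ k"
  shows "(\<Sum>k<m. (cmod (g k))\<^sup>2) * ((1 + \<alpha>) * (1 - (cmod a)\<^sup>2))\<^sup>2 \<le>
    (\<Sum>j<m. \<integral>w. (cmod (y j w))\<^sup>2 * (1 - (cmod w)\<^sup>2)\<^sup>2 \<partial>bergman_measure \<alpha>) *
    (\<integral>z. (cmod (q z * (1 - cnj a * z)\<^sup>2))\<^sup>2 \<partial>bergman_measure \<alpha>)"
proof -
  let ?M = "bergman_measure \<alpha>"
  define s where "s = (\<lambda>k. complex_of_real (1 / sqrt (bergman_sqnorm \<alpha> k)))"
  define G where "G = (\<Sum>k<m. (cmod (g k))\<^sup>2)"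
  define Y where "Y = (\<lambda>z. \<Sum>j<m. g j * y j z)"
  define S where "S = (\<Sum>j<m. \<integral>w. (cmod (y j w))\<^sup>2 * (1 - (cmod w)\<^sup>2)\<^sup>2 \<partial>?M)"
  define Q where "Q = (\<integral>z. (cmod (q z * (1 - cnj a * z)\<^sup>2))\<^sup>2 \<partial>?M)"
  let ?\<kappa> = "exp (of_real ((2 + \<alpha>) * pi) * \<i>)"
  let ?TY = "bergman_T \<alpha> a Y"
  define F1 where "F1 = (\<lambda>z. ?TY z * of_real (1 - (cmod z)\<^sup>2) / cnj ((1 - cnj a * z)\<^sup>2))"
  define F2 where "F2 = (\<lambda>z. q z * (1 - cnj a * z)\<^sup>2)"
  have Y: "Y \<in> bergman_space \<alpha>" unfolding Y_def using y by (intro bergman_space_sum) auto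
  have TY: "?TY \<in> bergman_space \<alpha>" by (rule bergman_T_bergman_space[OF a Y])
  have e: "1 - (cmod a)\<^sup>2 > 0" by (rule one_minus_cmod_square_pos[OF a])
  have "bergman_inner \<alpha> Y (bergman_T \<alpha> a (bergman_basis \<alpha> k)) = g k" if "k < m" for k
  proof -
    have "bergman_inner \<alpha> Y (bergman_T \<alpha> a (bergman_basis \<alpha> k)) = (\<Sum>j<m. g j * (if j = k then 1 else 0))"
      unfolding Y_def
      by (subst bergman_inner_sum_left)
         (auto simp: y biorth that bergman_T_bergman_space[OF a bergman_basis_bergman_space[OF \<alpha>]] intro!: sum.cong)
    then show ?thesis using that by (simp add: if_distrib cong: if_cong)
  qed
  then have TYk: "bergman_inner \<alpha> ?TY (bergman_basis \<alpha> k) = ?\<kappa> * g k" if "k < m" for k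
    using bergman_inner_T_swap[OF a Y bergman_basis_bergman_space[OF \<alpha>]] that by simp
  have basis: "bergman_inner \<alpha> ?TY (bergman_basis \<alpha> k) = s k * bergman_inner \<alpha> ?TY (\<lambda>z. z ^ k)" for k
  proof -
    have "bergman_inner \<alpha> ?TY (bergman_basis \<alpha> k) = (\<integral>z. s k * (?TY z * cnj (z ^ k)) \<partial>?M)"
      unfolding bergman_inner_def bergman_basis_eq[OF \<alpha>] s_def
      by (intro Bochner_Integration.integral_cong) auto
    then show ?thesis unfolding bergman_inner_def by (simp only: integral_mult_right_zero)
  qed
  have "?\<kappa> * of_real G * of_real (1 + \<alpha>) = (\<Sum>k<m. cnj (g k * s k) * bergman_inner \<alpha> ?TY (\<lambda>z. z ^ k)) * of_real (1 + \<alpha>)"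
  proof -
    have "?\<kappa> * of_real G = (\<Sum>k<m. cnj (g k) * (?\<kappa> * g k))"
      unfolding G_def of_real_sum sum_distrib_left complex_norm_square by (simp only: mult_ac)
    also have "\<dots> = (\<Sum>k<m. cnj (g k) * (s k * bergman_inner \<alpha> ?TY (\<lambda>z. z ^ k)))"
      using TYk basis by (intro sum.cong) auto
    also have "\<dots> = (\<Sum>k<m. cnj (g k * s k) * bergman_inner \<alpha> ?TY (\<lambda>z. z ^ k))"
      by (simp add: s_def mult_ac)
    finally show ?thesis by (simp only:)
  qed
  also have "\<dots> = (\<integral>z. ?TY z * of_real (1 - (cmod z)\<^sup>2) * cnj (q z) \<partial>?M)"
    unfolding q_def s_def by (rule bergman_inner_weighted_polynomial[OF \<alpha> TY])
  \<comment> \<open>The factor \<open>(1 - cnj a * z)\<^sup>2\<close> is split off before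
    Cauchy--Schwarz because division by it is what the substitution \<open>disc_aut a\<close> turns
    into the plain weight for \<open>Y\<close>.\<close>
  also have "\<dots> = (\<integral>z. F1 z * cnj (F2 z) \<partial>?M)"
  proof (intro Bochner_Integration.integral_cong refl)
    fix z assume "z \<in> space ?M"
    then have "cnj ((1 - cnj a * z)\<^sup>2) \<noteq> 0"
      unfolding complex_cnj_zero_iff using disc_aut_denominator_nonzero[OF a] by simp
    moreover have "x / c * (y * c) = x * y" if "c \<noteq> 0" for x y c :: complex using that by simp
    ultimately show "?TY z * of_real (1 - (cmod z)\<^sup>2) * cnj (q z) = F1 z * cnj (F2 z)"
      unfolding F1_def F2_def complex_cnj_mult[of "q z"] by simp
  qed
  finally have eq: "?\<kappa> * of_real G * of_real (1 + \<alpha>) = (\<integral>z. F1 z * cnj (F2 z) \<partial>?M)" .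
  have G0: "G \<ge> 0" unfolding G_def by (intro sum_nonneg) auto
  have "(G * (1 + \<alpha>))\<^sup>2 = (cmod (?\<kappa> * of_real G * of_real (1 + \<alpha>)))\<^sup>2"
    unfolding norm_mult norm_of_real using \<alpha> G0 by simp
  also have "\<dots> = (cmod (\<integral>z. F1 z * cnj (F2 z) \<partial>?M))\<^sup>2" by (simp only: eq)
  also have "\<dots> \<le> (\<integral>z. (cmod (F1 z))\<^sup>2 \<partial>?M) * (\<integral>z. (cmod (F2 z))\<^sup>2 \<partial>?M)"
  proof (rule cauchy_schwarz_integral)
    have nz: "cnj ((1 - cnj a * z)\<^sup>2) \<noteq> 0" if "z \<in> ball 0 1" for z
      unfolding complex_cnj_zero_iff using disc_aut_denominator_nonzero[OF a that] by simp
    have "continuous_on (ball 0 1) F1"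
      unfolding F1_def
      by (intro continuous_intros holomorphic_on_imp_continuous_on[OF bergman_space_holomorphic[OF TY]])
         (use nz in blast)
    then show "F1 \<in> borel_measurable ?M" by (rule continuous_on_bergman_measurable)
    have F2c: "continuous_on (cball 0 1) F2"
      unfolding F2_def q_def by (intro continuous_intros)
    then have "continuous_on (ball 0 1) F2" by (rule continuous_on_subset) auto
    then show F2m: "F2 \<in> borel_measurable ?M" by (rule continuous_on_bergman_measurable)
    show "integrable ?M (\<lambda>z. (cmod (F1 z))\<^sup>2)"
      using bergman_T_weighted_integral[OF a Y] unfolding F1_def by (simp only: has_bochner_integral_iff)
    have "bounded (F2 ` cball 0 1)"
      by (intro compact_imp_bounded compact_continuous_image F2c compact_cball)
    then obtain B where B: "\<And>z. z \<in> cball 0 1 \<Longrightarrow> cmod (F2 z) \<le> B"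
      unfolding bounded_iff by (metis imageI)
    show "integrable ?M (\<lambda>z. (cmod (F2 z))\<^sup>2)"
    proof (rule bergman_integrable_bounded[OF \<alpha>, where B = "B\<^sup>2"])
      show "(\<lambda>z. (cmod (F2 z))\<^sup>2) \<in> borel_measurable ?M" using F2m by measurable
      show "norm ((cmod (F2 z))\<^sup>2) \<le> B\<^sup>2" if "z \<in> ball 0 1" for z
        using B[of z] that by (auto intro!: power_mono)
    qed
  qed
  also have "(\<integral>z. (cmod (F2 z))\<^sup>2 \<partial>?M) = Q" by (simp add: Q_def F2_def)
  also have "(\<integral>z. (cmod (F1 z))\<^sup>2 \<partial>?M) = (\<integral>w. (cmod (Y w))\<^sup>2 * (1 - (cmod w)\<^sup>2)\<^sup>2 \<partial>?M) / (1 - (cmod a)\<^sup>2)\<^sup>2"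
    using bergman_T_weighted_integral[OF a Y] unfolding F1_def by (simp only: has_bochner_integral_iff)
  finally have main: "(G * (1 + \<alpha>))\<^sup>2 \<le> (\<integral>w. (cmod (Y w))\<^sup>2 * (1 - (cmod w)\<^sup>2)\<^sup>2 \<partial>?M) / (1 - (cmod a)\<^sup>2)\<^sup>2 * Q" .
  have Q0: "Q \<ge> 0" unfolding Q_def by (intro integral_nonneg_AE) auto
  \<comment> \<open>Cauchy--Schwarz at each point costs one factor \<open>G\<close>. The left side
    of \<open>main\<close> contains \<open>G\<close> squared, so one power cancels in the
    end.\<close>
  have "(\<integral>w. (cmod (Y w))\<^sup>2 * (1 - (cmod w)\<^sup>2)\<^sup>2 \<partial>?M) \<le> (\<integral>w. G * (\<Sum>j<m. (cmod (y j w))\<^sup>2 * (1 - (cmod w)\<^sup>2)\<^sup>2) \<partial>?M)"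
  proof (rule integral_mono_AE)
    show "integrable ?M (\<lambda>w. (cmod (Y w))\<^sup>2 * (1 - (cmod w)\<^sup>2)\<^sup>2)" by (rule bergman_weighted_integrable[OF Y])
    show "integrable ?M (\<lambda>w. G * (\<Sum>j<m. (cmod (y j w))\<^sup>2 * (1 - (cmod w)\<^sup>2)\<^sup>2))"
      using y by (intro integrable_mult_right Bochner_Integration.integrable_sum bergman_weighted_integrable) auto
    show "AE w in ?M. (cmod (Y w))\<^sup>2 * (1 - (cmod w)\<^sup>2)\<^sup>2 \<le> G * (\<Sum>j<m. (cmod (y j w))\<^sup>2 * (1 - (cmod w)\<^sup>2)\<^sup>2)"
    proof (rule AE_I2)
      fix w
      have "cmod (Y w) \<le> (\<Sum>j<m. cmod (g j) * cmod (y j w))"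
        unfolding Y_def by (rule order_trans[OF norm_sum]) (simp add: norm_mult)
      then have "(cmod (Y w))\<^sup>2 \<le> (\<Sum>j<m. cmod (g j) * cmod (y j w))\<^sup>2"
        by (intro power_mono) auto
      also have "\<dots> \<le> G * (\<Sum>j<m. (cmod (y j w))\<^sup>2)"
        unfolding G_def by (rule Cauchy_Schwarz_ineq_sum)
      finally have "(cmod (Y w))\<^sup>2 * (1 - (cmod w)\<^sup>2)\<^sup>2 \<le> G * (\<Sum>j<m. (cmod (y j w))\<^sup>2) * (1 - (cmod w)\<^sup>2)\<^sup>2"
        by (intro mult_right_mono) auto
      then show "(cmod (Y w))\<^sup>2 * (1 - (cmod w)\<^sup>2)\<^sup>2 \<le> G * (\<Sum>j<m. (cmod (y j w))\<^sup>2 * (1 - (cmod w)\<^sup>2)\<^sup>2)"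
        by (simp add: sum_distrib_right mult.assoc)
    qed
  qed
  also have "\<dots> = G * S"
    unfolding S_def using y
    by (subst integral_mult_right_zero, subst Bochner_Integration.integral_sum) (auto intro: bergman_weighted_integrable)
  finally have "(\<integral>w. (cmod (Y w))\<^sup>2 * (1 - (cmod w)\<^sup>2)\<^sup>2 \<partial>?M) / (1 - (cmod a)\<^sup>2)\<^sup>2 * Q \<le> G * S / (1 - (cmod a)\<^sup>2)\<^sup>2 * Q"
    using Q0 by (intro mult_right_mono divide_right_mono) auto
  with main have "(G * (1 + \<alpha>))\<^sup>2 \<le> G * S / (1 - (cmod a)\<^sup>2)\<^sup>2 * Q" by linarith
  then have "(G * (1 + \<alpha>))\<^sup>2 * (1 - (cmod a)\<^sup>2)\<^sup>2 \<le> G * S * Q"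
    using e by (simp add: pos_le_divide_eq)
  then have GG: "G * (G * ((1 + \<alpha>) * (1 - (cmod a)\<^sup>2))\<^sup>2) \<le> G * (S * Q)"
    by (simp add: power2_eq_square mult_ac)
  have S0: "S \<ge> 0" unfolding S_def by (intro sum_nonneg integral_nonneg_AE) auto
  have "G * ((1 + \<alpha>) * (1 - (cmod a)\<^sup>2))\<^sup>2 \<le> S * Q"
  proof (cases "G = 0")
    case True
    then show ?thesis using S0 Q0 by simp
  next
    case False
    then show ?thesis using GG G0 by (simp add: mult_le_cancel_left)
  qed
  then show ?thesis by (simp only: G_def S_def Q_def)
qed

section \<open>The density bound at a single point\<close>

lemma poly_sum_lessThan:
  fixes p :: "'a::comm_semiring_1 poly"
  assumes "degree p < N"
  shows "poly p x = (\<Sum>i<N. coeff p i * x ^ i)"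
  unfolding poly_altdef using assms
  by (intro sum.mono_neutral_left) (auto simp: coeff_eq_0)

text \<open>Three is the least power that serves: \<open>(1 - u)\<^sup>2\<close> consumes two
  geometric sums, and a mere square would leave a bounded number of monomials and lose a factor
  \<open>L\<close>. The shift by \<open>L\<close> keeps all degrees between \<open>L\<close> and
  \<open>4 * L\<close>, where \<open>real k + 2 + \<alpha>\<close> and \<open>bergman_sqnorm\<close>
  vary by bounded factors.\<close>

definition cubed_geometric_poly :: "nat \<Rightarrow> complex poly" where
  "cubed_geometric_poly L = monom 1 L * (\<Sum>k<L. monom 1 k) ^ 3"

lemma poly_cubed_geometric: "poly (cubed_geometric_poly L) u = u ^ L * (\<Sum>k<L. u ^ k) ^ 3"
  by (simp add: cubed_geometric_poly_def poly_monom poly_sum)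

lemma degree_cubed_geometric:
  assumes "L > 0"
  shows "degree (cubed_geometric_poly L) < 4 * L"
proof -
  have "degree (\<Sum>k<L. monom (1::complex) k) \<le> L - 1"
    by (rule degree_sum_le) (auto simp: degree_monom_eq)
  then have "degree ((\<Sum>k<L. monom (1::complex) k) ^ 3) \<le> (L - 1) * 3"
    using degree_power_le[of "\<Sum>k<L. monom (1::complex) k" 3] by (meson le_trans mult_le_mono1)
  moreover have "degree (cubed_geometric_poly L) \<le> L + degree ((\<Sum>k<L. monom (1::complex) k) ^ 3)"
    unfolding cubed_geometric_poly_def by (rule order_trans[OF degree_mult_le]) (simp add: degree_monom_eq)
  ultimately show ?thesis using assms by linarith
qed

lemma coeff_cubed_geometric_low: "k < L \<Longrightarrow> coeff (cubed_geometric_poly L) k = 0"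
  by (simp add: cubed_geometric_poly_def coeff_monom_mult)

text \<open>The coefficients add up to the value at 1, which is \<open>L ^ 3\<close>. There are at
  most \<open>3 * L\<close> of them, so Cauchy--Schwarz gives
  \<open>L ^ 6 / (3 * L)\<close>.\<close>

lemma sum_coeff_square_cubed_geometric:
  assumes L: "L > 0"
  shows "real L ^ 5 / 3 \<le> (\<Sum>k\<in>{L..<4*L}. (cmod (coeff (cubed_geometric_poly L) k))\<^sup>2)" (is "_ \<le> ?S")
proof -
  let ?b = "coeff (cubed_geometric_poly L)"
  have "of_nat L ^ 3 = poly (cubed_geometric_poly L) 1" by (simp add: poly_cubed_geometric)
  also have "\<dots> = (\<Sum>k<4*L. ?b k)"
    using poly_sum_lessThan[OF degree_cubed_geometric[OF L], of 1] by simp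
  also have "\<dots> = (\<Sum>k\<in>{L..<4*L}. ?b k)"
    by (intro sum.mono_neutral_right) (auto simp: coeff_cubed_geometric_low)
  finally have "cmod (of_nat L ^ 3) = cmod (\<Sum>k\<in>{L..<4*L}. ?b k)" by (rule arg_cong)
  then have "real L ^ 3 \<le> (\<Sum>k\<in>{L..<4*L}. 1 * cmod (?b k))"
    using norm_sum[of ?b "{L..<4*L}"] by (simp add: norm_power)
  then have "(real L ^ 3)\<^sup>2 \<le> (\<Sum>k\<in>{L..<4*L}. 1 * cmod (?b k))\<^sup>2" by (intro power_mono) auto
  also have "\<dots> \<le> (\<Sum>k\<in>{L..<4*L}. 1\<^sup>2) * ?S" by (rule Cauchy_Schwarz_ineq_sum)
  also have "\<dots> = 3 * real L * ?S" by simp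
  finally have "real L * real L ^ 5 \<le> real L * (3 * ?S)" by (simp add: power2_eq_square power_numeral_reduce mult_ac)
  then have "real L ^ 5 \<le> 3 * ?S" using L by (simp add: mult_le_cancel_left)
  then show ?thesis by simp
qed

text \<open>Each factor \<open>1 - u\<close> telescopes one geometric sum to
  \<open>1 - u ^ L\<close>; the shift turns the remaining one into a block of monomials with
  coefficients 1.\<close>

lemma geometric_cubed_identity:
  fixes u :: complex
  shows "u ^ L * (\<Sum>k<L. u ^ k) ^ 3 * (1 - u)\<^sup>2 = (\<Sum>k\<in>{L..<2*L}. u ^ k) * (1 - u ^ L)\<^sup>2"
proof -
  have s: "(\<Sum>k\<in>{L..<2*L}. u ^ k) = u ^ L * (\<Sum>k<L. u ^ k)"
    unfolding mult_2 using sum.shift_bounds_nat_ivl[of "\<lambda>k. u ^ k" 0 L L]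
    by (simp add: sum_distrib_left power_add atLeast0LessThan mult.commute)
  show ?thesis
    unfolding s one_diff_power_eq[of u L] by (simp add: power2_eq_square power3_eq_cube mult_ac)
qed

text \<open>In the geometric case 96 is 16 times 6: 16 bounds \<open>cmod (1 - u ^ L) ^ 4\<close>,
  and 6 collects the 1/3 from the coefficient sum and the 1/2 from the powers of
  \<open>cmod a\<close>. The factor \<open>6 + \<alpha>\<close> bounds
  \<open>(real k + 2 + \<alpha>) / L\<close> for \<open>k < 4 * L\<close>, the exponential compares
  norms between degrees \<open>L\<close> and \<open>4 * L\<close>, and the denominator comes from
  the passage to the extra weight.\<close>

definition density_const :: "real \<Rightarrow> real" where
  "density_const \<alpha> = 96 * (6 + \<alpha>)\<^sup>2 * exp (3 * (1 + \<alpha>)) / (1 + \<alpha>)\<^sup>2"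

context
  fixes \<alpha> :: real and a :: complex and m :: nat and y :: "nat \<Rightarrow> complex \<Rightarrow> complex"
  assumes \<alpha>: "\<alpha> > -1" and a: "a \<in> ball 0 1"
    and y: "\<And>j. j < m \<Longrightarrow> y j \<in> bergman_space \<alpha>"
    and biorth: "\<And>j k. j < m \<Longrightarrow> k < m \<Longrightarrow>
      bergman_inner \<alpha> (y j) (bergman_T \<alpha> a (bergman_basis \<alpha> k)) = (if j = k then 1 else 0)"
begin

text \<open>The constant polynomial as test function, with
  \<open>cmod (1 - cnj a * z) \<le> 2\<close>. It is good enough when the minimum of
  \<open>m\<close> and \<open>1 / (1 - (cmod a)\<^sup>2)\<close> is bounded; its constant is
  enlarged to agree with the geometric case.\<close>

lemma biorthogonal_bound_constant:
  assumes "m \<ge> 1"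
  shows "(1 - (cmod a)\<^sup>2)\<^sup>2 \<le> density_const \<alpha> *
    (\<Sum>j<m. \<integral>w. (cmod (y j w))\<^sup>2 * (1 - (cmod w)\<^sup>2)\<^sup>2 \<partial>bergman_measure \<alpha>)" (is "_ \<le> _ * ?S")
proof -
  define g where "g = (\<lambda>k::nat. if k = 0 then 1 else 0 :: complex)"
  have n0: "bergman_sqnorm \<alpha> 0 = 1" using \<alpha> by (simp add: bergman_sqnorm_Gamma Gamma_real_pos less_imp_neq[symmetric])
  have G: "(\<Sum>k<m. (cmod (g k))\<^sup>2) = 1"
  proof -
    have "(\<Sum>k<m. (cmod (g k))\<^sup>2) = (\<Sum>k<m. if k = 0 then 1 else 0)"
      by (intro sum.cong refl) (simp add: g_def)
    then show ?thesis using assms by simp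
  qed
  have q: "(\<Sum>k<m. of_real (real k + 2 + \<alpha>) * (g k * of_real (1 / sqrt (bergman_sqnorm \<alpha> k))) * z ^ k) = of_real (2 + \<alpha>)" for z
  proof -
    have "(\<Sum>k<m. of_real (real k + 2 + \<alpha>) * (g k * of_real (1 / sqrt (bergman_sqnorm \<alpha> k))) * z ^ k)
      = (\<Sum>k<m. if k = 0 then of_real (2 + \<alpha>) else 0)"
      by (intro sum.cong refl) (simp add: g_def n0)
    then show ?thesis using assms by simp
  qed
  have "(\<integral>z. (cmod (of_real (2 + \<alpha>) * (1 - cnj a * z)\<^sup>2))\<^sup>2 \<partial>bergman_measure \<alpha>) \<le> (\<integral>z. 16 * (2 + \<alpha>)\<^sup>2 * (cmod z ^ (2 * 0)) \<partial>bergman_measure \<alpha>)"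
  proof (rule integral_mono_AE)
    have bd: "(cmod (of_real (2 + \<alpha>) * (1 - cnj a * z)\<^sup>2))\<^sup>2 \<le> 16 * (2 + \<alpha>)\<^sup>2" if "z \<in> ball 0 1" for z
    proof -
      have "cmod (cnj a * z) \<le> 1 * 1" unfolding norm_mult using a that by (intro mult_mono) auto
      then have "cmod (1 - cnj a * z) \<le> 2" using norm_triangle_ineq4[of 1 "cnj a * z"] by simp
      then have "cmod (1 - cnj a * z) ^ 4 \<le> 2 ^ 4" by (intro power_mono) auto
      then have "(2 + \<alpha>)\<^sup>2 * cmod (1 - cnj a * z) ^ 4 \<le> (2 + \<alpha>)\<^sup>2 * 16" by (intro mult_left_mono) auto
      moreover have "(cmod (of_real (2 + \<alpha>) * (1 - cnj a * z)\<^sup>2))\<^sup>2 = (2 + \<alpha>)\<^sup>2 * cmod (1 - cnj a * z) ^ 4"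
        unfolding norm_mult norm_of_real power_mult_distrib power2_abs norm_power power_mult[symmetric] by simp
      ultimately show ?thesis by simp
    qed
    show "integrable (bergman_measure \<alpha>) (\<lambda>z. (cmod (of_real (2 + \<alpha>) * (1 - cnj a * z)\<^sup>2))\<^sup>2)"
      by (rule bergman_integrable_bounded[OF \<alpha>, where B = "16 * (2 + \<alpha>)\<^sup>2"])
         (use bd in \<open>auto intro!: borel_measurable_bergman simp del: of_real_add\<close>)
    show "integrable (bergman_measure \<alpha>) (\<lambda>z. 16 * (2 + \<alpha>)\<^sup>2 * (cmod z ^ (2 * 0)))"
      using bergman_moment_0[OF \<alpha>, of 0] by (intro integrable_mult_right) (simp only: has_bochner_integral_iff)
    show "AE z in bergman_measure \<alpha>. (cmod (of_real (2 + \<alpha>) * (1 - cnj a * z)\<^sup>2))\<^sup>2 \<le> 16 * (2 + \<alpha>)\<^sup>2 * (cmod z ^ (2 * 0))"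
      by (rule AE_I2) (use bd in \<open>simp del: of_real_add\<close>)
  qed
  also have "\<dots> = 16 * (2 + \<alpha>)\<^sup>2"
    using bergman_moment_0[OF \<alpha>, of 0] by (subst integral_mult_right_zero) (simp only: has_bochner_integral_iff n0 mult_1_right)
  finally have Q: "(\<integral>z. (cmod (of_real (2 + \<alpha>) * (1 - cnj a * z)\<^sup>2))\<^sup>2 \<partial>bergman_measure \<alpha>) \<le> 16 * (2 + \<alpha>)\<^sup>2" .
  have S0: "?S \<ge> 0" by (intro sum_nonneg integral_nonneg_AE) auto
  have "((1 + \<alpha>) * (1 - (cmod a)\<^sup>2))\<^sup>2 \<le> ?S * (\<integral>z. (cmod (of_real (2 + \<alpha>) * (1 - cnj a * z)\<^sup>2))\<^sup>2 \<partial>bergman_measure \<alpha>)"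
    using biorthogonal_weighted_bound[OF \<alpha> a y biorth, of m g] unfolding G q mult_1_left by simp
  also have "\<dots> \<le> ?S * (16 * (2 + \<alpha>)\<^sup>2)" using Q S0 by (intro mult_left_mono)
  also have "\<dots> \<le> ?S * (96 * (6 + \<alpha>)\<^sup>2 * exp (3 * (1 + \<alpha>)))"
  proof (intro mult_left_mono S0)
    have "16 * (2 + \<alpha>)\<^sup>2 \<le> 96 * (6 + \<alpha>)\<^sup>2" using \<alpha> by (intro mult_mono power_mono) auto
    also have "\<dots> \<le> 96 * (6 + \<alpha>)\<^sup>2 * exp (3 * (1 + \<alpha>))" using \<alpha> by (simp add: mult_le_cancel_left1)
    finally show "16 * (2 + \<alpha>)\<^sup>2 \<le> 96 * (6 + \<alpha>)\<^sup>2 * exp (3 * (1 + \<alpha>))" .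
  qed
  finally show ?thesis using \<alpha> unfolding density_const_def
    by (simp add: power_mult_distrib pos_le_divide_eq mult_ac)
qed

text \<open>The assumptions on \<open>L\<close> are the two caps: the test polynomial has degree
  below \<open>4 * L\<close>, hence below \<open>m\<close>, and up to that degree the powers of
  \<open>cmod a\<close> stay bounded below. The integral on the right is then of order
  \<open>L * ?n L\<close>, against \<open>L ^ 3 * ?n L\<close> for the squares of
  \<open>g\<close>.\<close>

lemma biorthogonal_bound_cubed_geometric:
  assumes L: "L > 0" "4 * L \<le> m" "8 * real L * (1 - (cmod a)\<^sup>2) \<le> 1"
  shows "(real L * (1 - (cmod a)\<^sup>2))\<^sup>2 \<le> density_const \<alpha> *
    (\<Sum>j<m. \<integral>w. (cmod (y j w))\<^sup>2 * (1 - (cmod w)\<^sup>2)\<^sup>2 \<partial>bergman_measure \<alpha>)" (is "_ \<le> _ * ?S")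
proof -
  let ?M = "bergman_measure \<alpha>"
  let ?n = "bergman_sqnorm \<alpha>"
  define b where "b = coeff (cubed_geometric_poly L)"
  \<comment> \<open>Solved backwards: with this \<open>g\<close> the polynomial \<open>q\<close> of
    \<open>biorthogonal_weighted_bound\<close> is the cubed geometric one at
    \<open>cnj a * z\<close>.\<close>
  define g where "g = (\<lambda>k. b k * cnj a ^ k * of_real (sqrt (?n k) / (real k + 2 + \<alpha>)))"
  define e where "e = 1 - (cmod a)\<^sup>2"
  have e: "e > 0" unfolding e_def by (rule one_minus_cmod_square_pos[OF a])
  have npos: "?n k > 0" for k by (rule bergman_sqnorm_pos[OF \<alpha>])
  have q: "(\<Sum>k<m. of_real (real k + 2 + \<alpha>) * (g k * of_real (1 / sqrt (?n k))) * z ^ k)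
     = poly (cubed_geometric_poly L) (cnj a * z)" for z
  proof -
    have "of_real (real k + 2 + \<alpha>) * (g k * of_real (1 / sqrt (?n k))) * z ^ k = b k * (cnj a * z) ^ k" for k
    proof -
      have "real k + 2 + \<alpha> \<noteq> 0" using \<alpha> by linarith
      then have "(real k + 2 + \<alpha>) * (sqrt (?n k) / (real k + 2 + \<alpha>)) * (1 / sqrt (?n k)) = 1"
        using npos[of k] by simp
      from arg_cong[OF this, of complex_of_real]
      have one: "complex_of_real (real k + 2 + \<alpha>) * of_real (sqrt (?n k) / (real k + 2 + \<alpha>)) * of_real (1 / sqrt (?n k)) = 1"
        by (simp only: of_real_mult of_real_1)
      have "of_real (real k + 2 + \<alpha>) * (g k * of_real (1 / sqrt (?n k))) * z ^ k
        = b k * (cnj a * z) ^ k * (of_real (real k + 2 + \<alpha>) * of_real (sqrt (?n k) / (real k + 2 + \<alpha>)) * of_real (1 / sqrt (?n k)))"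
        unfolding g_def power_mult_distrib by (simp only: mult_ac)
      then show ?thesis unfolding one by simp
    qed
    moreover have "degree (cubed_geometric_poly L) < m" using degree_cubed_geometric[OF L(1)] L(2) by linarith
    ultimately show ?thesis by (simp only: poly_sum_lessThan[of "cubed_geometric_poly L" m] b_def)
  qed
  have Q: "(\<integral>z. (cmod (poly (cubed_geometric_poly L) (cnj a * z) * (1 - cnj a * z)\<^sup>2))\<^sup>2 \<partial>?M) \<le> 16 * (real L * ?n L)"
  proof -
    let ?p = "\<lambda>z. \<Sum>k\<in>{L..<2*L}. cnj a ^ k * z ^ k"
    have p: "?p \<in> bergman_space \<alpha>" by (intro bergman_space_sum monomial_bergman_space \<alpha>)
    have bd: "(cmod (poly (cubed_geometric_poly L) (cnj a * z) * (1 - cnj a * z)\<^sup>2))\<^sup>2 \<le> 16 * (cmod (?p z))\<^sup>2" if "z \<in> ball 0 1" for z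
    proof -
      have "cmod (cnj a * z) \<le> 1 * 1" unfolding norm_mult using a that by (intro mult_mono) auto
      then have "cmod ((cnj a * z) ^ L) \<le> 1" unfolding norm_power by (intro power_le_one) auto
      then have "cmod (1 - (cnj a * z) ^ L) \<le> 2" using norm_triangle_ineq4[of 1 "(cnj a * z) ^ L"] by simp
      then have "cmod (1 - (cnj a * z) ^ L) ^ 4 \<le> 2 ^ 4" by (intro power_mono) auto
      then have "(cmod (?p z))\<^sup>2 * cmod (1 - (cnj a * z) ^ L) ^ 4 \<le> (cmod (?p z))\<^sup>2 * 16" by (intro mult_left_mono) auto
      moreover have "poly (cubed_geometric_poly L) (cnj a * z) * (1 - cnj a * z)\<^sup>2 = ?p z * (1 - (cnj a * z) ^ L)\<^sup>2"
        unfolding poly_cubed_geometric geometric_cubed_identity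
        by (intro arg_cong2[where f = "(*)"] sum.cong refl power_mult_distrib)
      ultimately show ?thesis
        by (simp add: norm_mult norm_power power_mult_distrib power_mult[symmetric] mult.commute)
    qed
    have "(\<integral>z. (cmod (poly (cubed_geometric_poly L) (cnj a * z) * (1 - cnj a * z)\<^sup>2))\<^sup>2 \<partial>?M) \<le> (\<integral>z. 16 * (cmod (?p z))\<^sup>2 \<partial>?M)"
    proof (rule integral_mono_AE)
      show i: "integrable ?M (\<lambda>z. 16 * (cmod (?p z))\<^sup>2)"
        by (intro integrable_mult_right bergman_space_square_integrable p)
      show "integrable ?M (\<lambda>z. (cmod (poly (cubed_geometric_poly L) (cnj a * z) * (1 - cnj a * z)\<^sup>2))\<^sup>2)"
      proof (rule Bochner_Integration.integrable_bound[OF i])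
        show "(\<lambda>z. (cmod (poly (cubed_geometric_poly L) (cnj a * z) * (1 - cnj a * z)\<^sup>2))\<^sup>2) \<in> borel_measurable ?M"
          by (intro continuous_on_bergman_measurable continuous_intros)
        show "AE z in ?M. norm ((cmod (poly (cubed_geometric_poly L) (cnj a * z) * (1 - cnj a * z)\<^sup>2))\<^sup>2) \<le> norm (16 * (cmod (?p z))\<^sup>2)"
          by (rule AE_I2) (use bd in simp)
      qed
      show "AE z in ?M. (cmod (poly (cubed_geometric_poly L) (cnj a * z) * (1 - cnj a * z)\<^sup>2))\<^sup>2 \<le> 16 * (cmod (?p z))\<^sup>2"
        by (rule AE_I2) (use bd in simp)
    qed
    also have "\<dots> = 16 * (bergman_norm \<alpha> ?p)\<^sup>2" by (simp add: bergman_norm_square)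
    also have "(bergman_norm \<alpha> ?p)\<^sup>2 = (\<Sum>k\<in>{L..<2*L}. (cmod (cnj a ^ k))\<^sup>2 * ?n k)"
      by (rule bergman_norm_polynomial[OF \<alpha>]) simp
    also have "\<dots> \<le> (\<Sum>k\<in>{L..<2*L}. 1 * ?n L)"
    proof (intro sum_mono mult_mono)
      fix k assume k: "k \<in> {L..<2*L}"
      show "(cmod (cnj a ^ k))\<^sup>2 \<le> 1" using a by (auto simp: norm_power intro!: power_le_one)
      show "?n k \<le> ?n L" using k by (intro bergman_sqnorm_antimono[OF \<alpha>]) auto
    qed (use npos in \<open>auto simp: less_imp_le\<close>)
    also have "\<dots> = real L * ?n L" by simp
    finally show ?thesis by simp
  qed
  \<comment> \<open>Bernoulli's inequality: \<open>(1 - e) ^ (4 * L)\<close> is at least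
    \<open>1 - 4 * L * e\<close>, and the assumption on \<open>L\<close> makes the subtracted term
    at most 1/2.\<close>
  have half: "1 / 2 \<le> cmod a ^ (2 * k)" if "k < 4 * L" for k
  proof -
    have a1: "0 \<le> (cmod a)\<^sup>2" "(cmod a)\<^sup>2 \<le> 1" using e by (auto simp: e_def)
    have "1 - real (4 * L) * e \<le> (1 - e) ^ (4 * L)"
      using Bernoulli_inequality[of "-e" "4 * L"] a1
      by (simp only: mult_minus_right add_uminus_conv_diff) (simp add: e_def)
    moreover have "real (4 * L) * e \<le> 1 / 2" using L(3) by (simp add: e_def)
    ultimately have "1 / 2 \<le> ((cmod a)\<^sup>2) ^ (4 * L)" by (simp add: e_def)
    also have "\<dots> \<le> ((cmod a)\<^sup>2) ^ k" using that a1 by (intro power_decreasing) auto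
    finally show ?thesis by (simp add: power_mult)
  qed
  define E where "E = exp (3 * (1 + \<alpha>))"
  define D where "D = 6 + \<alpha>"
  have E: "E > 0" by (simp add: E_def)
  have D: "D > 0" using \<alpha> by (simp add: D_def)
  have G: "real L ^ 3 * ?n L / (6 * E * D\<^sup>2) \<le> (\<Sum>k<m. (cmod (g k))\<^sup>2)"
  proof -
    \<comment> \<open>Of the five powers of \<open>L\<close> from the coefficient sum, two pay for
      the division by \<open>(real k + 2 + \<alpha>)\<^sup>2\<close>.\<close>
    have "real L ^ 3 * ?n L / (6 * E * D\<^sup>2) = real L ^ 5 / 3 * (1 / 2 * (?n L / E) / (real L * D)\<^sup>2)"
      using L(1) E D by (simp add: field_simps power2_eq_square power_numeral_reduce)
    also have "\<dots> \<le> (\<Sum>k\<in>{L..<4*L}. (cmod (b k))\<^sup>2) * (1 / 2 * (?n L / E) / (real L * D)\<^sup>2)"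
      unfolding b_def using E npos[of L]
      by (intro mult_right_mono sum_coeff_square_cubed_geometric[OF L(1)]) auto
    also have "\<dots> = (\<Sum>k\<in>{L..<4*L}. (cmod (b k))\<^sup>2 * (1 / 2 * (?n L / E) / (real L * D)\<^sup>2))"
      by (rule sum_distrib_right)
    also have "\<dots> \<le> (\<Sum>k\<in>{L..<4*L}. (cmod (g k))\<^sup>2)"
    proof (rule sum_mono)
      fix k assume k: "k \<in> {L..<4*L}"
      have nk: "?n L / E \<le> ?n k"
      proof -
        have "?n L \<le> exp (real (3 * L) * (1 + \<alpha>) / real L) * ?n (L + 3 * L)" by (rule bergman_sqnorm_le_exp[OF \<alpha> L(1)])
        also have "real (3 * L) * (1 + \<alpha>) / real L = 3 * (1 + \<alpha>)" using L(1) by simp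
        also have "exp (3 * (1 + \<alpha>)) * ?n (L + 3 * L) \<le> exp (3 * (1 + \<alpha>)) * ?n k"
          using k by (intro mult_left_mono bergman_sqnorm_antimono[OF \<alpha>]) auto
        finally show ?thesis using E by (simp add: E_def pos_divide_le_eq mult.commute)
      qed
      have kp: "real k + 2 + \<alpha> > 0" using \<alpha> by linarith
      have kD: "real k + 2 + \<alpha> \<le> real L * D"
      proof -
        have "2 + \<alpha> \<le> real L * (2 + \<alpha>)" using L(1) \<alpha> by (simp add: mult_le_cancel_right1)
        moreover have "real k \<le> 4 * real L" using k by auto
        ultimately show ?thesis by (simp add: D_def algebra_simps)
      qed
      have "1 / 2 * (?n L / E) / (real L * D)\<^sup>2 \<le> cmod a ^ (2 * k) * ?n k / (real k + 2 + \<alpha>)\<^sup>2"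
      proof (intro frac_le mult_mono power_mono)
        show "1 / 2 \<le> cmod a ^ (2 * k)" using half[of k] k by simp
      qed (use nk kp kD npos E in \<open>auto simp: less_imp_le\<close>)
      then have "(cmod (b k))\<^sup>2 * (1 / 2 * (?n L / E) / (real L * D)\<^sup>2) \<le> (cmod (b k))\<^sup>2 * (cmod a ^ (2 * k) * ?n k / (real k + 2 + \<alpha>)\<^sup>2)"
        by (intro mult_left_mono) auto
      also have "\<dots> = (cmod (g k))\<^sup>2"
        unfolding g_def norm_mult norm_of_real power_mult_distrib power2_abs power_divide norm_power complex_mod_cnj
        using npos[of k] by (simp add: less_imp_le power_mult[symmetric] mult_ac)
      finally show "(cmod (b k))\<^sup>2 * (1 / 2 * (?n L / E) / (real L * D)\<^sup>2) \<le> (cmod (g k))\<^sup>2" .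
    qed
    also have "\<dots> \<le> (\<Sum>k<m. (cmod (g k))\<^sup>2)"
      using L(2) by (intro sum_mono2) auto
    finally show ?thesis .
  qed
  have S0: "?S \<ge> 0" by (intro sum_nonneg integral_nonneg_AE) auto
  have "real L ^ 3 * ?n L / (6 * E * D\<^sup>2) * ((1 + \<alpha>) * e)\<^sup>2 \<le> (\<Sum>k<m. (cmod (g k))\<^sup>2) * ((1 + \<alpha>) * e)\<^sup>2"
    using G by (intro mult_right_mono) auto
  also have "\<dots> \<le> ?S * (\<integral>z. (cmod (poly (cubed_geometric_poly L) (cnj a * z) * (1 - cnj a * z)\<^sup>2))\<^sup>2 \<partial>?M)"
    using biorthogonal_weighted_bound[OF \<alpha> a y biorth, of m g] unfolding q e_def by simp
  also have "\<dots> \<le> ?S * (16 * (real L * ?n L))" using Q S0 by (intro mult_left_mono)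
  finally have fin: "real L ^ 3 * ?n L / (6 * E * D\<^sup>2) * ((1 + \<alpha>) * e)\<^sup>2 \<le> ?S * (16 * (real L * ?n L))" .
  \<comment> \<open>Both sides contain \<open>real L * ?n L\<close>; after cancelling it the norms
    of monomials are gone and \<open>(real L * e)\<^sup>2\<close> remains.\<close>
  have "real L ^ 3 * ?n L / (6 * E * D\<^sup>2) * ((1 + \<alpha>) * e)\<^sup>2 = (real L * ?n L / (6 * E * D\<^sup>2)) * ((real L * e)\<^sup>2 * (1 + \<alpha>)\<^sup>2)"
    by (simp add: power_mult_distrib power2_eq_square power3_eq_cube)
  moreover have "?S * (16 * (real L * ?n L)) = (real L * ?n L / (6 * E * D\<^sup>2)) * (?S * (96 * D\<^sup>2 * E))"
    using E D by simp
  moreover have "real L * ?n L / (6 * E * D\<^sup>2) > 0" using L(1) npos[of L] E D by simp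
  ultimately have "(real L * e)\<^sup>2 * (1 + \<alpha>)\<^sup>2 \<le> ?S * (96 * D\<^sup>2 * E)"
    using fin by (simp only: mult_le_cancel_left_pos)
  then show ?thesis
    using \<alpha> unfolding density_const_def e_def[symmetric] E_def[symmetric] D_def[symmetric]
    by (simp add: pos_le_divide_eq mult_ac)
qed

text \<open>With \<open>x = min (real m) (1 / e)\<close> the left side is
  \<open>(x * e)\<^sup>2\<close>. For \<open>x < 8\<close> the constant test function loses a
  bounded factor. Otherwise the integer part \<open>L\<close> of \<open>x / 8\<close> meets both
  caps and \<open>x < 8 * (L + 1) \<le> 16 * L\<close>, whence 256 as the square of 16.\<close>

lemma biorthogonal_density_bound:
  assumes m: "m \<ge> 1"
  shows "(min (real m * (1 - (cmod a)\<^sup>2)) 1)\<^sup>2 \<le> 256 * density_const \<alpha> *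
    (\<Sum>j<m. \<integral>w. (cmod (y j w))\<^sup>2 * (1 - (cmod w)\<^sup>2)\<^sup>2 \<partial>bergman_measure \<alpha>)" (is "_ \<le> 256 * _ * ?S")
proof -
  define e where "e = 1 - (cmod a)\<^sup>2"
  have e: "e > 0" unfolding e_def by (rule one_minus_cmod_square_pos[OF a])
  have S0: "?S \<ge> 0" by (intro sum_nonneg integral_nonneg_AE) auto
  have K0: "density_const \<alpha> \<ge> 0" by (simp add: density_const_def)
  define x where "x = min (real m) (1 / e)"
  have xe: "min (real m * e) 1 = x * e" using e by (auto simp: x_def min_def field_simps)
  have x0: "x \<ge> 0" using e by (simp add: x_def)
  have "\<exists>c. 0 \<le> c \<and> c\<^sup>2 \<le> density_const \<alpha> * ?S \<and> x * e \<le> 16 * c"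
  proof (cases "x < 8")
    case True
    show ?thesis
    proof (intro exI conjI)
      show "e\<^sup>2 \<le> density_const \<alpha> * ?S" unfolding e_def by (rule biorthogonal_bound_constant[OF m])
      show "x * e \<le> 16 * e" using True e by simp
    qed (use e in simp)
  next
    case False
    define L where "L = nat \<lfloor>x / 8\<rfloor>"
    have fl: "real L = of_int \<lfloor>x / 8\<rfloor>" using False by (simp add: L_def)
    have L8: "8 * real L \<le> x" "x < 8 * (real L + 1)"
    proof -
      have "real L \<le> x / 8" "x / 8 < real L + 1"
        unfolding fl by (rule of_int_floor_le, rule real_of_int_floor_add_one_gt)
      then show "8 * real L \<le> x" "x < 8 * (real L + 1)" by (simp_all add: field_simps)
    qed
    have L1: "L > 0" using False by (simp add: L_def)
    show ?thesis
    proof (intro exI conjI)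
      show "(real L * e)\<^sup>2 \<le> density_const \<alpha> * ?S"
        unfolding e_def
      proof (rule biorthogonal_bound_cubed_geometric[OF L1])
        have "8 * real L \<le> real m" using L8 by (simp add: x_def)
        then show "4 * L \<le> m" by linarith
        have "8 * real L \<le> 1 / e" using L8 by (simp add: x_def)
        then show "8 * real L * (1 - (cmod a)\<^sup>2) \<le> 1" using e by (simp add: e_def[symmetric] pos_le_divide_eq)
      qed
      have "1 \<le> real L" using L1 by simp
      then have "8 * (real L + 1) \<le> 16 * real L" by simp
      then have "x \<le> 16 * real L" using L8(2) by (rule order_trans[OF less_imp_le, rotated])
      then show "x * e \<le> 16 * (real L * e)" using e by simp
    qed (use e in simp)
  qed
  then obtain c where c: "0 \<le> c" "c\<^sup>2 \<le> density_const \<alpha> * ?S" "x * e \<le> 16 * c" by blast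
  have "(x * e)\<^sup>2 \<le> (16 * c)\<^sup>2" using c x0 e by (intro power_mono) auto
  also have "\<dots> = 256 * c\<^sup>2" by (simp add: power_mult_distrib)
  also have "\<dots> \<le> 256 * (density_const \<alpha> * ?S)" using c by simp
  finally show ?thesis unfolding e_def[symmetric] xe by simp
qed

end

section \<open>Riesz--Fischer systems\<close>

text \<open>The vectors \<open>s + t\<close> and \<open>s - t\<close> differ by
  \<open>2 * t\<close>, so at least one of them is as long as \<open>t\<close>.\<close>

lemma exists_sign_norm_add:
  fixes s t :: complex
  shows "\<exists>\<sigma>. \<bar>\<sigma>\<bar> = (1::real) \<and> norm t \<le> norm (s + of_real \<sigma> * t)"
proof (rule ccontr)
  assume "\<not> ?thesis"
  then have "norm (s + of_real 1 * t) < norm t" "norm (s + of_real (-1) * t) < norm t"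
    by (metis abs_1 abs_minus not_le)+
  then have "norm (s + t) < norm t" "norm (s - t) < norm t" by auto
  moreover have "(s + t) - (s - t) = 2 * t" by simp
  then have "2 * norm t \<le> norm (s + t) + norm (s - t)"
    using norm_triangle_ineq4[of "s + t" "s - t"] by (metis norm_mult norm_numeral)
  ultimately show False by simp
qed

text \<open>Gliding hump: if the conclusion failed, there would be unit vectors \<open>e n\<close>, finitely
  supported in \<open>F n\<close>, with \<open>N (F n) (e n) \<le> (1/4)\<^sup>n\<close>. The series of the vectors
  \<open>\<sigma>\<^sub>n (1/3)\<^sup>n e n\<close>, with each sign chosen so that the partial sum does not cancel against
  \<open>e n\<close>, is then a square-summable family whose pairing with \<open>e n\<close> is at least \<open>(1/3)\<^sup>n / 2\<close>.\<close>

lemma uniform_boundedness_finite_support: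
  fixes N :: "'i set \<Rightarrow> ('i \<Rightarrow> complex) \<Rightarrow> real"
  assumes N0: "\<And>F a. 0 \<le> N F a"
    and scale: "\<And>F a c. finite F \<Longrightarrow> F \<subseteq> J \<Longrightarrow> c > 0 \<Longrightarrow> N F (\<lambda>i. of_real c * a i) = c * N F a"
    and bound: "\<And>v. (\<lambda>i. (cmod (v i))\<^sup>2) summable_on J \<Longrightarrow>
      \<exists>B. \<forall>F a. finite F \<longrightarrow> F \<subseteq> J \<longrightarrow> cmod (\<Sum>i\<in>F. v i * cnj (a i)) \<le> B * N F a"
  shows "\<exists>C. \<forall>F a. finite F \<longrightarrow> F \<subseteq> J \<longrightarrow> (\<Sum>i\<in>F. (cmod (a i))\<^sup>2) \<le> C * (N F a)\<^sup>2"
proof (rule ccontr)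
  assume neg: "\<not> ?thesis"
  have "\<exists>F b. finite F \<and> F \<subseteq> J \<and> (\<Sum>i\<in>F. (cmod (b i))\<^sup>2) = 1 \<and> N F b \<le> (1/4) ^ n" for n :: nat
  proof -
    \<comment> \<open>The constant that fails is taken as \<open>16 ^ n\<close>, the square of
      \<open>4 ^ n\<close>; after normalisation this becomes the decay rate
      \<open>(1/4) ^ n\<close>.\<close>
    obtain F a where F: "finite F" "F \<subseteq> J" and big: "(\<Sum>i\<in>F. (cmod (a i))\<^sup>2) > 16 ^ n * (N F a)\<^sup>2"
    proof -
      have "\<not> (\<forall>F a. finite F \<longrightarrow> F \<subseteq> J \<longrightarrow> (\<Sum>i\<in>F. (cmod (a i))\<^sup>2) \<le> 16 ^ n * (N F a)\<^sup>2)"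
        using neg by blast
      then show thesis using that by (auto simp: not_le)
    qed
    define s where "s = sqrt (\<Sum>i\<in>F. (cmod (a i))\<^sup>2)"
    have "0 \<le> 16 ^ n * (N F a)\<^sup>2" by simp
    then have s0: "0 < (\<Sum>i\<in>F. (cmod (a i))\<^sup>2)" using big by linarith
    then have s: "s > 0" "s\<^sup>2 = (\<Sum>i\<in>F. (cmod (a i))\<^sup>2)"
      unfolding s_def by (simp, intro real_sqrt_pow2 less_imp_le)
    define b where "b = (\<lambda>i. of_real (1 / s) * a i)"
    have "(4 ^ n)\<^sup>2 = (16::real) ^ n"
      using power_mult[of "4::real" 2 n] power_mult[of "4::real" n 2] by (simp add: mult.commute)
    then have "(4 ^ n * N F a)\<^sup>2 \<le> s\<^sup>2"
      unfolding s(2) power_mult_distrib using less_imp_le[OF big] by (simp only:)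
    then have "4 ^ n * N F a \<le> s" by (rule power2_le_imp_le) (use s(1) in simp)
    then have "1 / s * N F a \<le> (1/4) ^ n" using s(1) by (simp add: field_simps power_divide)
    then have Nb: "N F b \<le> (1/4) ^ n" unfolding b_def using s(1) scale[OF F, of "1 / s"] by simp
    have "(\<Sum>i\<in>F. (cmod (b i))\<^sup>2) = (\<Sum>i\<in>F. (cmod (a i))\<^sup>2 / s\<^sup>2)"
      unfolding b_def norm_mult norm_of_real by (simp add: power_mult_distrib power_divide)
    also have "\<dots> = 1" using s0 by (simp add: s(2) flip: sum_divide_distrib)
    finally show ?thesis using F Nb by blast
  qed
  then obtain F b where F: "\<And>n. finite (F n)" "\<And>n. F n \<subseteq> J"
    and b1: "\<And>n. (\<Sum>i\<in>F n. (cmod (b n i))\<^sup>2) = 1" and Nb: "\<And>n. N (F n) (b n) \<le> (1/4) ^ n"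
    by metis
  define e where "e = (\<lambda>n i. if i \<in> F n then b n i else 0)"
  have e1: "L2_set (\<lambda>i. cmod (e n i)) G \<le> 1" if G: "finite G" for n G
  proof -
    have "(\<Sum>i\<in>G. (cmod (e n i))\<^sup>2) = (\<Sum>i\<in>G \<inter> F n. (cmod (b n i))\<^sup>2)"
      using G by (intro sum.mono_neutral_cong_right) (auto simp: e_def)
    also have "\<dots> \<le> (\<Sum>i\<in>F n. (cmod (b n i))\<^sup>2)" using F by (intro sum_mono2) auto
    finally show ?thesis by (simp add: L2_set_def b1)
  qed
  have ei: "cmod (e n i) \<le> 1" for n i
    using e1[of "{i}" n] by (simp add: L2_set_def)
  define ip where "ip = (\<lambda>v n. \<Sum>i\<in>F n. v i * cnj (e n i))"
  have ipe: "ip (e n) n = 1" for n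
  proof -
    have "ip (e n) n = (\<Sum>i\<in>F n. of_real ((cmod (b n i))\<^sup>2))"
      unfolding ip_def by (intro sum.cong refl) (simp add: e_def complex_norm_square[symmetric] del: of_real_power)
    also have "\<dots> = of_real (\<Sum>i\<in>F n. (cmod (b n i))\<^sup>2)" by simp
    finally show ?thesis by (simp only: b1 of_real_1)
  qed
  have ip_bound: "cmod (ip (e k) n) \<le> 1" for k n
  proof -
    have "cmod (ip (e k) n) \<le> (\<Sum>i\<in>F n. \<bar>cmod (e k i)\<bar> * \<bar>cmod (e n i)\<bar>)"
      unfolding ip_def by (rule order_trans[OF norm_sum]) (simp add: norm_mult)
    also have "\<dots> \<le> L2_set (\<lambda>i. cmod (e k i)) (F n) * L2_set (\<lambda>i. cmod (e n i)) (F n)"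
      by (rule L2_set_mult_ineq)
    also have "\<dots> \<le> 1 * 1" by (intro mult_mono e1 F) (auto simp: L2_set_def sum_nonneg)
    finally show ?thesis by simp
  qed
  define sg where "sg = (\<lambda>n v. SOME \<sigma>. \<bar>\<sigma>\<bar> = (1::real) \<and>
      norm (complex_of_real ((1/3) ^ n)) \<le> norm (ip v n + of_real \<sigma> * complex_of_real ((1/3) ^ n)))"
  have sg: "\<bar>sg n v\<bar> = 1" "(1/3) ^ n \<le> cmod (ip v n + of_real (sg n v) * complex_of_real ((1/3) ^ n))" for n v
  proof -
    have "\<bar>sg n v\<bar> = 1 \<and>
      norm (complex_of_real ((1/3) ^ n)) \<le> norm (ip v n + of_real (sg n v) * complex_of_real ((1/3) ^ n))"
      unfolding sg_def by (rule someI_ex) (rule exists_sign_norm_add)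
    then show "\<bar>sg n v\<bar> = 1" "(1/3) ^ n \<le> cmod (ip v n + of_real (sg n v) * complex_of_real ((1/3) ^ n))"
      unfolding norm_of_real by simp_all
  qed
  define p where "p = rec_nat (\<lambda>i. 0) (\<lambda>n v i. v i + of_real (sg n v) * of_real ((1/3) ^ n) * e n i)"
  define d where "d = (\<lambda>n i. of_real (sg n (p n)) * complex_of_real ((1/3) ^ n) * e n i)"
  have p0: "p 0 = (\<lambda>i. 0)" and pS: "p (Suc n) = (\<lambda>i. p n i + d n i)" for n
    by (simp_all add: p_def d_def)
  have pd: "p n i = (\<Sum>k<n. d k i)" for n i by (induction n) (simp_all add: p0 pS)
  have dn: "cmod (d n i) \<le> (1/3) ^ n" for n i
    unfolding d_def norm_mult norm_of_real sg(1) using mult_left_mono[OF ei[of n i], of "(1/3) ^ n"] by simp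
  have geo: "summable (\<lambda>n. (1/3::real) ^ n)" by (rule summable_geometric) simp
  have ds: "summable (\<lambda>n. d n i)" for i by (rule summable_comparison_test'[OF geo, of 0]) (use dn in auto)
  define v where "v = (\<lambda>i. \<Sum>n. d n i)"
  have plim: "(\<lambda>n. p n i) \<longlonglongrightarrow> v i" for i
    unfolding pd v_def using ds by (rule summable_LIMSEQ)
  \<comment> \<open>Minkowski's inequality bounds each partial sum by the geometric series 3/2,
    rounded up to 2. The bound is the same for every \<open>G\<close>.\<close>
  have "(\<Sum>i\<in>G. (cmod (v i))\<^sup>2) \<le> 4" if G: "finite G" for G
  proof -
    have "L2_set (\<lambda>i. cmod (p n i)) G \<le> (\<Sum>k<n. (1/3) ^ k)" for n
    proof (induction n)
      case (Suc n)
      have "L2_set (\<lambda>i. cmod (p (Suc n) i)) G \<le> L2_set (\<lambda>i. cmod (p n i) + cmod (d n i)) G"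
        by (intro L2_set_mono) (auto simp: pS norm_triangle_ineq)
      also have "\<dots> \<le> L2_set (\<lambda>i. cmod (p n i)) G + L2_set (\<lambda>i. cmod (d n i)) G"
        by (rule L2_set_triangle_ineq)
      also have "L2_set (\<lambda>i. cmod (d n i)) G = L2_set (\<lambda>i. (1/3) ^ n * cmod (e n i)) G"
        unfolding d_def norm_mult norm_of_real sg(1) by simp
      also have "\<dots> = (1/3) ^ n * L2_set (\<lambda>i. cmod (e n i)) G"
        by (rule L2_set_right_distrib[symmetric]) simp
      also have "\<dots> \<le> (1/3) ^ n * 1" by (intro mult_left_mono e1 G) auto
      finally show ?case using Suc by simp
    qed (simp add: p0 L2_set_def)
    also have "(\<Sum>k<n. (1/3::real) ^ k) \<le> 2" for n
      using sum_le_suminf[OF geo, of "{..<n}"] suminf_geometric[of "1/3::real"] by simp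
    finally have "(L2_set (\<lambda>i. cmod (p n i)) G)\<^sup>2 \<le> 2\<^sup>2" for n
      by (intro power_mono) (auto simp: L2_set_def sum_nonneg)
    then have "(\<Sum>i\<in>G. (cmod (p n i))\<^sup>2) \<le> 4" for n by (simp add: L2_set_def sum_nonneg)
    moreover have "(\<lambda>n. \<Sum>i\<in>G. (cmod (p n i))\<^sup>2) \<longlonglongrightarrow> (\<Sum>i\<in>G. (cmod (v i))\<^sup>2)"
      by (intro tendsto_intros plim)
    ultimately show ?thesis by (intro LIMSEQ_le_const2) auto
  qed
  then have "(\<lambda>i. (cmod (v i))\<^sup>2) summable_on J"
    by (intro nonneg_bdd_above_summable_on bdd_aboveI2[where M = 4]) auto
  from bound[OF this] obtain B where B: "\<And>n. cmod (\<Sum>i\<in>F n. v i * cnj (b n i)) \<le> B * N (F n) (b n)"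
    using F by meson
  have lower: "(1/3) ^ n / 2 \<le> \<bar>B\<bar> * (1/4) ^ n" for n
  proof -
    have "ip v n = (\<Sum>i\<in>F n. (p (Suc n) i + (\<Sum>k. d (k + Suc n) i)) * cnj (e n i))"
    proof -
      have "v i = p (Suc n) i + (\<Sum>k. d (k + Suc n) i)" for i
        using suminf_split_initial_segment[OF ds, of i "Suc n"] by (simp add: v_def pd add.commute)
      then show ?thesis by (simp add: ip_def)
    qed
    also have "\<dots> = ip (p (Suc n)) n + (\<Sum>i\<in>F n. (\<Sum>k. d (k + Suc n) i) * cnj (e n i))"
      by (simp add: ip_def distrib_right sum.distrib)
    also have "ip (p (Suc n)) n = ip (p n) n + of_real (sg n (p n)) * complex_of_real ((1/3) ^ n)"
    proof -
      have "ip (p (Suc n)) n = ip (p n) n + (\<Sum>i\<in>F n. d n i * cnj (e n i))"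
        by (simp add: ip_def pS distrib_right sum.distrib)
      also have "(\<Sum>i\<in>F n. d n i * cnj (e n i)) = of_real (sg n (p n)) * complex_of_real ((1/3) ^ n) * ip (e n) n"
        unfolding ip_def d_def sum_distrib_left by (simp only: mult.assoc)
      finally show ?thesis by (simp only: ipe mult_1_right)
    qed
    also have "(\<Sum>i\<in>F n. (\<Sum>k. d (k + Suc n) i) * cnj (e n i)) = (\<Sum>k. \<Sum>i\<in>F n. d (k + Suc n) i * cnj (e n i))"
    proof -
      have sm: "summable (\<lambda>k. d (k + Suc n) i)" for i using ds[of i] summable_ignore_initial_segment by blast
      then have "(\<Sum>i\<in>F n. (\<Sum>k. d (k + Suc n) i) * cnj (e n i)) = (\<Sum>i\<in>F n. \<Sum>k. d (k + Suc n) i * cnj (e n i))"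
        by (intro sum.cong refl suminf_mult2)
      also have "\<dots> = (\<Sum>k. \<Sum>i\<in>F n. d (k + Suc n) i * cnj (e n i))"
        using sm by (intro suminf_sum[symmetric] summable_mult2)
      finally show ?thesis .
    qed
    finally have split: "ip v n = (ip (p n) n + of_real (sg n (p n)) * complex_of_real ((1/3) ^ n))
       + (\<Sum>k. \<Sum>i\<in>F n. d (k + Suc n) i * cnj (e n i))" .
    \<comment> \<open>With ratio 1/3 the terms after the one of index \<open>n\<close> add up to
      exactly half of it, so later humps cannot undo the one at \<open>n\<close>.\<close>
    have tail: "cmod (\<Sum>k. \<Sum>i\<in>F n. d (k + Suc n) i * cnj (e n i)) \<le> (1/3) ^ n / 2"
    proof -
      have t: "cmod (\<Sum>i\<in>F n. d k i * cnj (e n i)) \<le> (1/3) ^ k" for k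
      proof -
        have "(\<Sum>i\<in>F n. d k i * cnj (e n i)) = of_real (sg k (p k)) * complex_of_real ((1/3) ^ k) * ip (e k) n"
          unfolding ip_def d_def sum_distrib_left by (simp only: mult.assoc)
        then have "cmod (\<Sum>i\<in>F n. d k i * cnj (e n i)) = (1/3) ^ k * cmod (ip (e k) n)"
          by (simp only: norm_mult norm_of_real sg(1)) simp
        also have "\<dots> \<le> (1/3) ^ k * 1" by (intro mult_left_mono ip_bound) auto
        finally show ?thesis by simp
      qed
      have sg3: "summable (\<lambda>k. (1/3::real) ^ (k + Suc n))" using geo by (rule summable_ignore_initial_segment)
      have "cmod (\<Sum>k. \<Sum>i\<in>F n. d (k + Suc n) i * cnj (e n i)) \<le> (\<Sum>k. (1/3::real) ^ (k + Suc n))"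
        by (rule norm_suminf_le[OF t sg3])
      also have "\<dots> = (\<Sum>k. (1/3::real) ^ Suc n * (1/3) ^ k)" by (simp add: power_add mult.commute)
      also have "\<dots> = (1/3) ^ Suc n * (\<Sum>k. (1/3) ^ k)" by (rule suminf_mult[OF geo])
      also have "\<dots> = (1/3) ^ n / 2" using suminf_geometric[of "1/3::real"] by simp
      finally show ?thesis .
    qed
    have "(1/3) ^ n - (1/3) ^ n / 2 \<le> cmod (ip v n)"
      unfolding split using sg(2)[of n "p n"] tail
        norm_diff_ineq[of "ip (p n) n + of_real (sg n (p n)) * complex_of_real ((1/3) ^ n)"
          "\<Sum>k. \<Sum>i\<in>F n. d (k + Suc n) i * cnj (e n i)"] by linarith
    also have "ip v n = (\<Sum>i\<in>F n. v i * cnj (b n i))" unfolding ip_def by (intro sum.cong) (auto simp: e_def)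
    also have "cmod \<dots> \<le> B * N (F n) (b n)" by (rule B)
    also have "\<dots> \<le> \<bar>B\<bar> * (1/4) ^ n" using Nb[of n] N0[of "F n" "b n"] by (intro mult_mono) auto
    finally show ?thesis by simp
  qed
  \<comment> \<open>The contradiction comes from the gap between the rates: the vectors shrink like
    \<open>(1/3) ^ n\<close>, but their \<open>N\<close> like \<open>(1/4) ^ n\<close>.\<close>
  have "(4/3) ^ n \<le> 2 * \<bar>B\<bar>" for n :: nat
    using lower[of n] by (simp add: power_divide field_simps)
  moreover obtain n where "2 * \<bar>B\<bar> < (4/3) ^ n" using real_arch_pow[of "4/3::real"] by auto
  ultimately show False by (meson not_le)
qed

text \<open>Orthogonal projection onto a finite span, expressed through inner products. Adding
  \<open>x k\<close> is a Gram--Schmidt step: \<open>g\<close> and \<open>r\<close> are the parts of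
  \<open>f\<close> and \<open>x k\<close> orthogonal to the earlier functions, and the projection of
  \<open>f\<close> gains the multiple \<open>t\<close> of \<open>r\<close>.\<close>

lemma bergman_gram_projection:
  assumes "finite F" "\<And>i. i \<in> F \<Longrightarrow> x i \<in> bergman_space \<alpha>" "f \<in> bergman_space \<alpha>"
  shows "\<exists>c. \<forall>j\<in>F. bergman_inner \<alpha> f (x j) = (\<Sum>i\<in>F. c i * bergman_inner \<alpha> (x i) (x j))"
  using assms
proof (induction F arbitrary: f rule: finite_induct)
  case (insert k F)
  let ?ip = "bergman_inner \<alpha>"
  have x: "\<And>i. i \<in> F \<Longrightarrow> x i \<in> bergman_space \<alpha>" "x k \<in> bergman_space \<alpha>" using insert by auto
  have diffs: "(\<lambda>z. g z - h z) \<in> bergman_space \<alpha>" if "g \<in> bergman_space \<alpha>" "h \<in> bergman_space \<alpha>" for g h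
    using bergman_space_add[OF that(1) bergman_space_scale[OF that(2), of "-1"]] by simp
  obtain c where c: "\<And>j. j \<in> F \<Longrightarrow> ?ip f (x j) = (\<Sum>i\<in>F. c i * ?ip (x i) (x j))"
    using insert.IH[OF x(1) insert.prems(2)] by blast
  obtain d where d: "\<And>j. j \<in> F \<Longrightarrow> ?ip (x k) (x j) = (\<Sum>i\<in>F. d i * ?ip (x i) (x j))"
    using insert.IH[OF x] by blast
  define g where "g = (\<lambda>z. f z - (\<Sum>i\<in>F. c i * x i z))"
  define r where "r = (\<lambda>z. x k z - (\<Sum>i\<in>F. d i * x i z))"
  have sums: "(\<lambda>z. \<Sum>i\<in>F. c i * x i z) \<in> bergman_space \<alpha>" "(\<lambda>z. \<Sum>i\<in>F. d i * x i z) \<in> bergman_space \<alpha>"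
    using x by (intro bergman_space_sum; simp)+
  have g: "g \<in> bergman_space \<alpha>" and r: "r \<in> bergman_space \<alpha>"
    unfolding g_def r_def by (intro diffs sums x insert.prems(2))+
  have gx: "?ip g h = ?ip f h - (\<Sum>i\<in>F. c i * ?ip (x i) h)"
    and rx: "?ip r h = ?ip (x k) h - (\<Sum>i\<in>F. d i * ?ip (x i) h)" if "h \<in> bergman_space \<alpha>" for h
    unfolding g_def r_def using sums x insert.prems(2) that
    by (simp_all add: bergman_inner_diff_left bergman_inner_sum_left)
  have g0: "?ip g (x j) = 0" and r0: "?ip r (x j) = 0" if "j \<in> F" for j
    using gx[of "x j"] rx[of "x j"] c[OF that] d[OF that] x that by auto
  have hr: "?ip h r = ?ip h (x k)" if h: "h \<in> bergman_space \<alpha>" and "\<And>j. j \<in> F \<Longrightarrow> ?ip h (x j) = 0" for h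
  proof -
    have "?ip h r = cnj (?ip (x k) h - (\<Sum>i\<in>F. d i * ?ip (x i) h))"
      using rx[OF h] bergman_inner_commute[of \<alpha> h r] by (metis complex_cnj_cnj)
    also have "(\<Sum>i\<in>F. d i * ?ip (x i) h) = 0"
      using that(2) bergman_inner_commute[of \<alpha> _ h] by (intro sum.neutral) auto
    finally show ?thesis using bergman_inner_commute[of \<alpha> h "x k"] by simp
  qed
  \<comment> \<open>If \<open>x k\<close> depends on the earlier functions, \<open>r\<close> has
    norm 0 and the division by zero yields 0. Cauchy--Schwarz then gives
    \<open>?ip g (x k) = 0\<close> too, so the defining equation of \<open>t\<close>
    persists.\<close>
  define t where "t = ?ip g (x k) / ?ip r (x k)"
  have t: "t * ?ip r (x k) = ?ip g (x k)"
  proof (cases "?ip r (x k) = 0")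
    case True
    then have "(bergman_norm \<alpha> r)\<^sup>2 = 0"
      using hr[OF r r0] bergman_inner_self[of \<alpha> r] by (metis of_real_eq_0_iff)
    then have "?ip g r = 0" using bergman_cauchy_schwarz[OF g r] by simp
    then show ?thesis using True hr[OF g g0] by simp
  qed (simp add: t_def)
  define c' where "c' = (\<lambda>i. if i = k then t else c i - t * d i)"
  have c'F: "(\<Sum>i\<in>F. c' i * h i) = (\<Sum>i\<in>F. c i * h i) - t * (\<Sum>i\<in>F. d i * h i)" for h :: "_ \<Rightarrow> complex"
    unfolding sum_distrib_left sum_subtractf[symmetric]
    using insert.hyps by (intro sum.cong) (auto simp: c'_def algebra_simps)
  have "?ip f (x j) = (\<Sum>i\<in>insert k F. c' i * ?ip (x i) (x j))" if "j \<in> insert k F" for j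
  proof -
    have xj: "x j \<in> bergman_space \<alpha>" using that x by auto
    have "?ip g (x j) = t * ?ip r (x j)" using that g0 r0 t by auto
    then have "?ip f (x j) = (\<Sum>i\<in>F. c i * ?ip (x i) (x j)) + t * (?ip (x k) (x j) - (\<Sum>i\<in>F. d i * ?ip (x i) (x j)))"
      using gx[OF xj] rx[OF xj] by (simp add: algebra_simps)
    also have "\<dots> = (\<Sum>i\<in>insert k F. c' i * ?ip (x i) (x j))"
      using insert.hyps by (simp add: c'F) (simp add: c'_def algebra_simps)
    finally show ?thesis .
  qed
  then show ?case by blast
qed simp

text \<open>The dual of \<open>x k\<close> is its component \<open>u\<close> orthogonal to the
  others, rescaled. Since \<open>u\<close> has coefficient 1 at \<open>k\<close>, the lower bound
  keeps its norm away from 0. For the Bessel inequality, the numbers \<open>?ip f (y k)\<close> are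
  the coefficients of the projection of \<open>f\<close>, to which the same lower bound applies with
  the same constant.\<close>

lemma bergman_dual_system:
  assumes F: "finite F" and x: "\<And>i. i \<in> F \<Longrightarrow> x i \<in> bergman_space \<alpha>"
    and lower: "\<And>a. (\<Sum>i\<in>F. (cmod (a i))\<^sup>2) \<le> C * (bergman_norm \<alpha> (\<lambda>z. \<Sum>i\<in>F. a i * x i z))\<^sup>2"
    and C: "C \<ge> 0"
  obtains y where "\<And>i. y i \<in> bergman_space \<alpha>"
    and "\<And>i j. i \<in> F \<Longrightarrow> j \<in> F \<Longrightarrow> bergman_inner \<alpha> (y i) (x j) = (if i = j then 1 else 0)"
    and "\<And>f. f \<in> bergman_space \<alpha> \<Longrightarrow> (\<Sum>i\<in>F. (cmod (bergman_inner \<alpha> f (y i)))\<^sup>2) \<le> C * (bergman_norm \<alpha> f)\<^sup>2"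
proof -
  let ?ip = "bergman_inner \<alpha>"
  have "\<exists>B. \<forall>j\<in>F. ?ip (\<lambda>z. \<Sum>i\<in>F. B i * x i z) (x j) = (if k = j then 1 else 0)" if k: "k \<in> F" for k
  proof -
    obtain d where d: "\<And>j. j \<in> F - {k} \<Longrightarrow> ?ip (x k) (x j) = (\<Sum>i\<in>F - {k}. d i * ?ip (x i) (x j))"
      using bergman_gram_projection[of "F - {k}" x \<alpha> "x k"] F x k by blast
    define A where "A = (\<lambda>i. if i = k then 1 else - d i)"
    define u where "u = (\<lambda>z. \<Sum>i\<in>F. A i * x i z)"
    have u: "u \<in> bergman_space \<alpha>" unfolding u_def using x by (intro bergman_space_sum)
    have ux: "?ip u h = (\<Sum>i\<in>F. A i * ?ip (x i) h)" if "h \<in> bergman_space \<alpha>" for h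
      unfolding u_def using x that by (intro bergman_inner_sum_left)
    have u0: "?ip u (x j) = 0" if j: "j \<in> F" "j \<noteq> k" for j
    proof -
      have "?ip u (x j) = ?ip (x k) (x j) + (\<Sum>i\<in>F - {k}. - d i * ?ip (x i) (x j))"
        unfolding ux[OF x[OF j(1)]] sum.remove[OF F k] by (auto simp: A_def intro!: sum.cong)
      then show ?thesis using d[of j] j by (simp add: sum_negf)
    qed
    have "?ip u u = (\<Sum>i\<in>F. cnj (A i) * ?ip u (x i))"
      using x u unfolding u_def[symmetric] by (subst (2) u_def) (intro bergman_inner_sum_right)
    also have "\<dots> = ?ip u (x k)"
      unfolding sum.remove[OF F k] using u0 by (simp add: A_def)
    finally have uk: "?ip u (x k) = of_real ((bergman_norm \<alpha> u)\<^sup>2)" by (simp add: bergman_inner_self)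
    have "1 \<le> (\<Sum>i\<in>F. (cmod (A i))\<^sup>2)"
      using member_le_sum[OF k, of "\<lambda>i. (cmod (A i))\<^sup>2"] F by (simp add: A_def)
    also have "\<dots> \<le> C * (bergman_norm \<alpha> u)\<^sup>2" unfolding u_def by (rule lower)
    finally have "bergman_norm \<alpha> u \<noteq> 0" by auto
    then have nz: "?ip u (x k) \<noteq> 0" unfolding uk by simp
    have "?ip (\<lambda>z. \<Sum>i\<in>F. A i / ?ip u (x k) * x i z) (x j) = (if k = j then 1 else 0)" if j: "j \<in> F" for j
    proof -
      have "?ip (\<lambda>z. \<Sum>i\<in>F. A i / ?ip u (x k) * x i z) (x j) = ?ip u (x j) / ?ip u (x k)"
        unfolding ux[OF x[OF j]] using x j
        by (subst bergman_inner_sum_left) (auto simp: sum_divide_distrib)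
      then show ?thesis using u0[OF j] nz by auto
    qed
    then show ?thesis by (intro exI[of _ "\<lambda>i. A i / ?ip u (x k)"]) auto
  qed
  then have "\<forall>k\<in>F. \<exists>B. \<forall>j\<in>F. ?ip (\<lambda>z. \<Sum>i\<in>F. B i * x i z) (x j) = (if k = j then 1 else 0)"
    by (rule ballI)
  from bchoice[OF this] obtain B where
    B: "\<And>k j. k \<in> F \<Longrightarrow> j \<in> F \<Longrightarrow> ?ip (\<lambda>z. \<Sum>i\<in>F. B k i * x i z) (x j) = (if k = j then 1 else 0)"
    by blast
  define y where "y = (\<lambda>k z. \<Sum>i\<in>F. B k i * x i z)"
  have y: "y k \<in> bergman_space \<alpha>" for k unfolding y_def using x by (intro bergman_space_sum)
  have yx: "?ip (y k) (x j) = (if k = j then 1 else 0)" if "k \<in> F" "j \<in> F" for k j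
    using B[OF that] by (simp add: y_def)
  have "(\<Sum>i\<in>F. (cmod (?ip f (y i)))\<^sup>2) \<le> C * (bergman_norm \<alpha> f)\<^sup>2" if f: "f \<in> bergman_space \<alpha>" for f
  proof -
    obtain c where c: "\<And>j. j \<in> F \<Longrightarrow> ?ip f (x j) = (\<Sum>i\<in>F. c i * ?ip (x i) (x j))"
      using bergman_gram_projection[of F x \<alpha> f] F x f by blast
    define h where "h = (\<lambda>z. \<Sum>i\<in>F. c i * x i z)"
    have h: "h \<in> bergman_space \<alpha>" unfolding h_def using x by (intro bergman_space_sum)
    have hx: "?ip h w = (\<Sum>i\<in>F. c i * ?ip (x i) w)" if "w \<in> bergman_space \<alpha>" for w
      unfolding h_def using x that by (intro bergman_inner_sum_left)
    \<comment> \<open>The duals lie in the span of the \<open>x i\<close>, where \<open>f\<close>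
      can be replaced by its projection \<open>h\<close>.\<close>
    have span: "?ip f (\<lambda>z. \<Sum>i\<in>F. b i * x i z) = ?ip h (\<lambda>z. \<Sum>i\<in>F. b i * x i z)" for b
      using x f h c hx by (simp add: bergman_inner_sum_right)
    have fy: "?ip f (y k) = c k" if k: "k \<in> F" for k
    proof -
      have "?ip f (y k) = ?ip h (y k)" unfolding y_def by (rule span)
      also have "\<dots> = (\<Sum>i\<in>F. c i * cnj (?ip (y k) (x i)))"
        unfolding hx[OF y] by (intro sum.cong refl arg_cong2[where f = "(*)"] bergman_inner_commute)
      also have "\<dots> = (\<Sum>i\<in>F. if k = i then c i else 0)"
        using k by (intro sum.cong refl) (simp add: yx)
      finally show ?thesis using F k by simp
    qed
    have "(bergman_norm \<alpha> h)\<^sup>2 \<le> (bergman_norm \<alpha> f)\<^sup>2"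
    proof (cases "(bergman_norm \<alpha> h)\<^sup>2 = 0")
      case False
      have "?ip f h = ?ip h h" using span[of c] by (simp add: h_def)
      then have "((bergman_norm \<alpha> h)\<^sup>2)\<^sup>2 \<le> (bergman_norm \<alpha> f)\<^sup>2 * (bergman_norm \<alpha> h)\<^sup>2"
        using bergman_cauchy_schwarz[OF f h] unfolding bergman_inner_self by (simp only: norm_of_real power2_abs)
      moreover have "0 < (bergman_norm \<alpha> h)\<^sup>2" using False by simp
      ultimately show ?thesis
        unfolding power2_eq_square[of "(bergman_norm \<alpha> h)\<^sup>2"] by (simp only: mult_le_cancel_right_pos)
    qed simp
    then have "C * (bergman_norm \<alpha> h)\<^sup>2 \<le> C * (bergman_norm \<alpha> f)\<^sup>2" using C by (intro mult_left_mono)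
    moreover have "(\<Sum>i\<in>F. (cmod (?ip f (y i)))\<^sup>2) = (\<Sum>i\<in>F. (cmod (c i))\<^sup>2)" using fy by simp
    ultimately show ?thesis using lower[of c] by (simp add: h_def)
  qed
  with y yx show thesis by (rule that)
qed

section \<open>The theorem\<close>

text \<open>Biorthogonality is asked only within one point; different points interact through the
  Bessel bound alone. This lets a sampling system in, whose functions at different points need not
  be orthogonal. The bound does not depend on \<open>F\<close>.\<close>

lemma bessel_biorthogonal_density:
  fixes y :: "complex \<Rightarrow> nat \<Rightarrow> complex \<Rightarrow> complex"
  assumes \<alpha>: "\<alpha> > -1" and F: "finite F" "F \<subseteq> ball 0 1" and m: "\<And>a. a \<in> F \<Longrightarrow> m a \<ge> 1"
    and y: "\<And>a j. a \<in> F \<Longrightarrow> j < m a \<Longrightarrow> y a j \<in> bergman_space \<alpha>"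
    and biorth: "\<And>a j k. a \<in> F \<Longrightarrow> j < m a \<Longrightarrow> k < m a \<Longrightarrow>
      bergman_inner \<alpha> (y a j) (bergman_T \<alpha> a (bergman_basis \<alpha> k)) = (if j = k then 1 else 0)"
    and bessel: "\<And>f. f \<in> bergman_space \<alpha> \<Longrightarrow>
      (\<Sum>a\<in>F. \<Sum>j<m a. (cmod (bergman_inner \<alpha> f (y a j)))\<^sup>2) \<le> C * (bergman_norm \<alpha> f)\<^sup>2"
  shows "(\<Sum>a\<in>F. (min (real (m a) * (1 - (cmod a)\<^sup>2)) 1)\<^sup>2) \<le> 256 * density_const \<alpha> * (C * (1 + \<alpha>))"
proof -
  let ?w = "\<lambda>a j. \<integral>w. (cmod (y a j w))\<^sup>2 * (1 - (cmod w)\<^sup>2)\<^sup>2 \<partial>bergman_measure \<alpha>"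
  let ?I = "SIGMA a:F. {..<m a}"
  have "(\<Sum>i\<in>?I. \<integral>w. (cmod ((case i of (a, j) \<Rightarrow> y a j) w))\<^sup>2 * (1 - (cmod w)\<^sup>2)\<^sup>2 \<partial>bergman_measure \<alpha>) \<le> C * (1 + \<alpha>)"
  proof (rule bessel_weighted_norms[OF \<alpha>])
    show "finite ?I" using F by auto
    show "(case i of (a, j) \<Rightarrow> y a j) \<in> bergman_space \<alpha>" if "i \<in> ?I" for i using that y by auto
    show "(\<Sum>i\<in>?I. (cmod (bergman_inner \<alpha> f (case i of (a, j) \<Rightarrow> y a j)))\<^sup>2) \<le> C * (bergman_norm \<alpha> f)\<^sup>2"
      if "f \<in> bergman_space \<alpha>" for f
      using bessel[OF that] F by (subst (asm) sum.Sigma) (auto simp: case_prod_unfold)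
  qed
  then have S: "(\<Sum>a\<in>F. \<Sum>j<m a. ?w a j) \<le> C * (1 + \<alpha>)"
    using F by (subst sum.Sigma) (auto simp: case_prod_unfold)
  have "(\<Sum>a\<in>F. (min (real (m a) * (1 - (cmod a)\<^sup>2)) 1)\<^sup>2) \<le> (\<Sum>a\<in>F. 256 * density_const \<alpha> * (\<Sum>j<m a. ?w a j))"
    using F by (intro sum_mono biorthogonal_density_bound \<alpha> y biorth m) auto
  also have "\<dots> = 256 * density_const \<alpha> * (\<Sum>a\<in>F. \<Sum>j<m a. ?w a j)" by (rule sum_distrib_left[symmetric])
  also have "\<dots> \<le> 256 * density_const \<alpha> * (C * (1 + \<alpha>))"
    using S by (intro mult_left_mono) (auto simp: density_const_def)
  finally show ?thesis .
qed

text \<open>Each point with \<open>f a \<ge> 1\<close> contributes 1 to the truncated sum, so there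
  are finitely many of them. They add a fixed finite amount, which \<open>K\<close> does not
  control; elsewhere the truncation changes nothing.\<close>

lemma summable_on_from_truncated:
  fixes f :: "'a \<Rightarrow> real"
  assumes f: "\<And>a. a \<in> A \<Longrightarrow> f a \<ge> 0"
    and bd: "\<And>F. finite F \<Longrightarrow> F \<subseteq> A \<Longrightarrow> (\<Sum>a\<in>F. (min (f a) 1)\<^sup>2) \<le> K"
  shows "(\<lambda>a. (f a)\<^sup>2) summable_on A"
proof -
  define B where "B = {a \<in> A. f a \<ge> 1}"
  have "finite B"
  proof (rule ccontr)
    assume "infinite B"
    then obtain F where F: "F \<subseteq> B" "finite F" "card F = Suc (nat \<lceil>K\<rceil>)"
      using infinite_arbitrarily_large[OF \<open>infinite B\<close>, of "Suc (nat \<lceil>K\<rceil>)"] by blast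
    have "(\<Sum>a\<in>F. (min (f a) 1)\<^sup>2) = (\<Sum>a\<in>F. 1)"
      using F by (intro sum.cong) (auto simp: B_def min_def)
    also have "\<dots> = real (card F)" by simp
    finally have "(\<Sum>a\<in>F. (min (f a) 1)\<^sup>2) = real (card F)" .
    moreover have "K < real (card F)" unfolding F(3) by linarith
    moreover have "F \<subseteq> A" using F(1) by (auto simp: B_def)
    ultimately show False using bd[OF F(2)] by simp
  qed
  have "(\<Sum>a\<in>F. (f a)\<^sup>2) \<le> K + (\<Sum>a\<in>B. (f a)\<^sup>2)" if F: "finite F" "F \<subseteq> A" for F
  proof -
    have "(\<Sum>a\<in>F. (f a)\<^sup>2) = (\<Sum>a\<in>F - B. (f a)\<^sup>2) + (\<Sum>a\<in>F \<inter> B. (f a)\<^sup>2)"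
      using sum.Int_Diff[OF F(1), of "\<lambda>a. (f a)\<^sup>2" B] by simp
    also have "(\<Sum>a\<in>F - B. (f a)\<^sup>2) = (\<Sum>a\<in>F - B. (min (f a) 1)\<^sup>2)"
      using F by (intro sum.cong) (auto simp: B_def min_def)
    also have "\<dots> \<le> K" using F by (intro bd) auto
    also have "(\<Sum>a\<in>F \<inter> B. (f a)\<^sup>2) \<le> (\<Sum>a\<in>B. (f a)\<^sup>2)"
      using \<open>finite B\<close> by (intro sum_mono2) auto
    finally show ?thesis by simp
  qed
  then show ?thesis
    by (intro nonneg_bdd_above_summable_on bdd_aboveI2[where M = "K + (\<Sum>a\<in>B. (f a)\<^sup>2)"]) auto
qed

lemma sampling_divisor_bessel:
  assumes "sampling_divisor \<alpha> \<Lambda> m"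
  obtains C where "\<And>F f. finite F \<Longrightarrow> F \<subseteq> \<Lambda> \<Longrightarrow> f \<in> bergman_space \<alpha> \<Longrightarrow>
    (\<Sum>a\<in>F. \<Sum>j<m a. (cmod (bergman_inner \<alpha> f (bergman_T \<alpha> a (bergman_basis \<alpha> j))))\<^sup>2) \<le> C * (bergman_norm \<alpha> f)\<^sup>2"
proof -
  let ?S = "\<lambda>f a. \<Sum>j<m a. (cmod (bergman_inner \<alpha> f (bergman_T \<alpha> a (bergman_basis \<alpha> j))))\<^sup>2"
  obtain C where C: "C > 0" and S: "\<And>f. f \<in> bergman_space \<alpha> \<Longrightarrow>
      ?S f summable_on \<Lambda> \<and> 1 / C * (\<Sum>\<^sub>\<infinity>a\<in>\<Lambda>. ?S f a) \<le> (bergman_norm \<alpha> f)\<^sup>2"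
    using assms unfolding sampling_divisor_def Let_def by blast
  have "(\<Sum>a\<in>F. ?S f a) \<le> C * (bergman_norm \<alpha> f)\<^sup>2" if "finite F" "F \<subseteq> \<Lambda>" "f \<in> bergman_space \<alpha>" for F f
  proof -
    have "(\<Sum>a\<in>F. ?S f a) \<le> (\<Sum>\<^sub>\<infinity>a\<in>\<Lambda>. ?S f a)"
      using S[OF that(3)] that by (intro finite_sum_le_infsum) (auto intro: sum_nonneg)
    also have "\<dots> \<le> C * (bergman_norm \<alpha> f)\<^sup>2"
      using S[OF that(3)] C by (simp add: field_simps)
    finally show ?thesis .
  qed
  then show thesis by (rule that)
qed

text \<open>If \<open>f\<close> interpolates \<open>v\<close>, the pairing of \<open>v\<close> with
  \<open>c\<close> is the inner product of \<open>f\<close> with the combination of the atoms, so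
  Cauchy--Schwarz bounds it by the norm of \<open>f\<close>. That bound depends on \<open>v\<close>
  only, which is the pointwise boundedness that \<open>uniform_boundedness_finite_support\<close>
  makes uniform.\<close>

lemma interpolating_divisor_riesz_fischer:
  assumes \<alpha>: "\<alpha> > -1" and D: "divisor \<Lambda> m" and I: "interpolating_divisor \<alpha> \<Lambda> m"
  shows "\<exists>C. \<forall>F c. finite F \<longrightarrow> F \<subseteq> (SIGMA a:\<Lambda>. {..<m a}) \<longrightarrow>
    (\<Sum>i\<in>F. (cmod (c i))\<^sup>2) \<le> C * (bergman_norm \<alpha> (\<lambda>z. \<Sum>i\<in>F. c i * bergman_T \<alpha> (fst i) (bergman_basis \<alpha> (snd i)) z))\<^sup>2"
proof (rule uniform_boundedness_finite_support)
  let ?J = "SIGMA a:\<Lambda>. {..<m a}"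
  let ?x = "\<lambda>i. bergman_T \<alpha> (fst i) (bergman_basis \<alpha> (snd i))"
  have x: "?x i \<in> bergman_space \<alpha>" if "i \<in> ?J" for i
    using that D by (intro bergman_T_bergman_space bergman_basis_bergman_space \<alpha>) (auto simp: divisor_def)
  show "0 \<le> bergman_norm \<alpha> (\<lambda>z. \<Sum>i\<in>F. c i * ?x i z)" for F c
    unfolding bergman_norm_def by (intro real_sqrt_ge_zero integral_nonneg_AE) auto
  show "bergman_norm \<alpha> (\<lambda>z. \<Sum>i\<in>F. (of_real t * c i) * ?x i z) = t * bergman_norm \<alpha> (\<lambda>z. \<Sum>i\<in>F. c i * ?x i z)"
    if "t > 0" for F c t
  proof -
    have "(\<Sum>i\<in>F. (of_real t * c i) * ?x i z) = of_real t * (\<Sum>i\<in>F. c i * ?x i z)" for z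
      by (simp add: sum_distrib_left mult.assoc)
    then show ?thesis using that
      by (simp add: bergman_norm_def norm_mult power_mult_distrib real_sqrt_mult)
  qed
  fix v :: "complex \<times> nat \<Rightarrow> complex"
  assume v: "(\<lambda>i. (cmod (v i))\<^sup>2) summable_on ?J"
  have "(\<lambda>a. \<Sum>j<m a. (cmod (v (a, j)))\<^sup>2) summable_on \<Lambda>"
  proof (intro nonneg_bdd_above_summable_on bdd_aboveI2)
    fix F assume F: "F \<in> {F. F \<subseteq> \<Lambda> \<and> finite F}"
    then have "(\<Sum>a\<in>F. \<Sum>j<m a. (cmod (v (a, j)))\<^sup>2) = (\<Sum>i\<in>(SIGMA a:F. {..<m a}). (cmod (v i))\<^sup>2)"
      by (subst sum.Sigma) (auto simp: case_prod_unfold)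
    also have "\<dots> \<le> (\<Sum>\<^sub>\<infinity>i\<in>?J. (cmod (v i))\<^sup>2)"
      using F v by (intro finite_sum_le_infsum) auto
    finally show "(\<Sum>a\<in>F. \<Sum>j<m a. (cmod (v (a, j)))\<^sup>2) \<le> (\<Sum>\<^sub>\<infinity>i\<in>?J. (cmod (v i))\<^sup>2)" .
  qed (auto intro: sum_nonneg)
  then have "(\<lambda>a j. v (a, j)) \<in> l2_divisor \<Lambda> m" by (simp add: l2_divisor_def)
  from bspec[OF I[unfolded interpolating_divisor_def] this]
  obtain f where f: "f \<in> bergman_space \<alpha>"
    and fv: "\<forall>a\<in>\<Lambda>. \<forall>j<m a. bergman_inner \<alpha> f (bergman_T \<alpha> a (bergman_basis \<alpha> j)) = v (a, j)"
    by (rule bexE)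
  have "cmod (\<Sum>i\<in>F. v i * cnj (c i)) \<le> bergman_norm \<alpha> f * bergman_norm \<alpha> (\<lambda>z. \<Sum>i\<in>F. c i * ?x i z)"
    if F: "finite F" "F \<subseteq> ?J" for F c
  proof -
    let ?g = "\<lambda>z. \<Sum>i\<in>F. c i * ?x i z"
    have g: "?g \<in> bergman_space \<alpha>" using F x by (intro bergman_space_sum) auto
    have "bergman_inner \<alpha> f ?g = (\<Sum>i\<in>F. cnj (c i) * bergman_inner \<alpha> f (?x i))"
      using F x f by (intro bergman_inner_sum_right) auto
    also have "\<dots> = (\<Sum>i\<in>F. v i * cnj (c i))"
      using F fv by (intro sum.cong) auto
    finally have "(cmod (\<Sum>i\<in>F. v i * cnj (c i)))\<^sup>2 \<le> (bergman_norm \<alpha> f * bergman_norm \<alpha> ?g)\<^sup>2"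
      using bergman_cauchy_schwarz[OF f g] by (simp add: power_mult_distrib)
    then show ?thesis
      by (rule power2_le_imp_le)
         (auto simp: bergman_norm_def intro!: mult_nonneg_nonneg real_sqrt_ge_zero integral_nonneg_AE)
  qed
  then show "\<exists>B. \<forall>F c. finite F \<longrightarrow> F \<subseteq> ?J \<longrightarrow>
      cmod (\<Sum>i\<in>F. v i * cnj (c i)) \<le> B * bergman_norm \<alpha> (\<lambda>z. \<Sum>i\<in>F. c i * ?x i z)"
    by blast
qed

theorem mainTheorem4:
  fixes \<alpha> :: real and \<Lambda> :: "complex set" and m :: "complex \<Rightarrow> nat"
  assumes "\<alpha> > -1"
    and "divisor \<Lambda> m"
    and "sampling_divisor \<alpha> \<Lambda> m \<or> interpolating_divisor \<alpha> \<Lambda> m"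
  shows "(\<lambda>a. (real (m a) * (1 - (cmod a)\<^sup>2))\<^sup>2) summable_on \<Lambda>"
proof -
  note \<alpha> = assms(1)
  let ?x = "\<lambda>a j. bergman_T \<alpha> a (bergman_basis \<alpha> j)"
  have ball: "\<And>a. a \<in> \<Lambda> \<Longrightarrow> a \<in> ball 0 1" and m: "\<And>a. a \<in> \<Lambda> \<Longrightarrow> m a \<ge> 1"
    using assms(2) by (auto simp: divisor_def)
  have x: "?x a j \<in> bergman_space \<alpha>" if "a \<in> \<Lambda>" for a j
    using that by (intro bergman_T_bergman_space bergman_basis_bergman_space \<alpha> ball)
  \<comment> \<open>The constant is fixed before \<open>F\<close>, while the family \<open>y\<close>
    may change with \<open>F\<close>; this is the common form of the two cases.\<close>
  obtain C where C: "\<And>F. finite F \<Longrightarrow> F \<subseteq> \<Lambda> \<Longrightarrow> \<exists>y.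
      (\<forall>a\<in>F. \<forall>j<m a. y a j \<in> bergman_space \<alpha>) \<and>
      (\<forall>a\<in>F. \<forall>j<m a. \<forall>k<m a. bergman_inner \<alpha> (y a j) (?x a k) = (if j = k then 1 else 0)) \<and>
      (\<forall>f\<in>bergman_space \<alpha>. (\<Sum>a\<in>F. \<Sum>j<m a. (cmod (bergman_inner \<alpha> f (y a j)))\<^sup>2) \<le> C * (bergman_norm \<alpha> f)\<^sup>2)"
    using assms(3)
  proof (elim disjE)
    assume s: "sampling_divisor \<alpha> \<Lambda> m"
    obtain C where C: "\<And>F f. finite F \<Longrightarrow> F \<subseteq> \<Lambda> \<Longrightarrow> f \<in> bergman_space \<alpha> \<Longrightarrow>
        (\<Sum>a\<in>F. \<Sum>j<m a. (cmod (bergman_inner \<alpha> f (?x a j)))\<^sup>2) \<le> C * (bergman_norm \<alpha> f)\<^sup>2"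
      by (rule sampling_divisor_bessel[OF s]) (rule that)
    show thesis
    proof (rule that[of C], intro exI[of _ ?x] allI impI conjI ballI)
      \<comment> \<open>At a single point the atoms are the isometric image of an orthonormal
        system, hence biorthogonal to themselves.\<close>
      fix F a j k assume "F \<subseteq> \<Lambda>" "a \<in> F"
      then show "bergman_inner \<alpha> (?x a j) (?x a k) = (if j = k then 1 else 0)"
        using ball by (subst bergman_T_isometry) (auto intro: bergman_basis_bergman_space \<alpha> simp: bergman_basis_orthonormal[OF \<alpha>])
    qed (use x C in auto)
  next
    assume "interpolating_divisor \<alpha> \<Lambda> m"
    from interpolating_divisor_riesz_fischer[OF assms(1,2) this]
    obtain C where C: "\<And>F c. finite F \<Longrightarrow> F \<subseteq> (SIGMA a:\<Lambda>. {..<m a}) \<Longrightarrow>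
      (\<Sum>i\<in>F. (cmod (c i))\<^sup>2) \<le> C * (bergman_norm \<alpha> (\<lambda>z. \<Sum>i\<in>F. c i * ?x (fst i) (snd i) z))\<^sup>2"
      by (elim exE) (rule that, blast)
    show thesis
    \<comment> \<open>The constant obtained from uniform boundedness carries no sign, while
      \<open>bergman_dual_system\<close> compares multiples of squared norms and asks for a
      nonnegative one.\<close>
    proof (rule that[of "\<bar>C\<bar>"])
      fix F assume F: "finite F" "F \<subseteq> \<Lambda>"
      let ?I = "SIGMA a:F. {..<m a}"
      obtain y where y: "\<And>i. y i \<in> bergman_space \<alpha>"
        and yx: "\<And>i j. i \<in> ?I \<Longrightarrow> j \<in> ?I \<Longrightarrow> bergman_inner \<alpha> (y i) (?x (fst j) (snd j)) = (if i = j then 1 else 0)"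
        and yb: "\<And>f. f \<in> bergman_space \<alpha> \<Longrightarrow> (\<Sum>i\<in>?I. (cmod (bergman_inner \<alpha> f (y i)))\<^sup>2) \<le> \<bar>C\<bar> * (bergman_norm \<alpha> f)\<^sup>2"
      proof (rule bergman_dual_system[of ?I "\<lambda>i. ?x (fst i) (snd i)" \<alpha> "\<bar>C\<bar>"])
        show "finite ?I" using F by auto
        show "?x (fst i) (snd i) \<in> bergman_space \<alpha>" if "i \<in> ?I" for i using that F x by auto
        fix c :: "complex \<times> nat \<Rightarrow> complex"
        let ?N = "(bergman_norm \<alpha> (\<lambda>z. \<Sum>i\<in>?I. c i * ?x (fst i) (snd i) z))\<^sup>2"
        have "(\<Sum>i\<in>?I. (cmod (c i))\<^sup>2) \<le> C * ?N" using F by (intro C) auto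
        also have "\<dots> \<le> \<bar>C\<bar> * ?N" by (intro mult_right_mono) auto
        finally show "(\<Sum>i\<in>?I. (cmod (c i))\<^sup>2) \<le> \<bar>C\<bar> * ?N" .
      qed (simp, rule that)
      show "\<exists>y. (\<forall>a\<in>F. \<forall>j<m a. y a j \<in> bergman_space \<alpha>) \<and>
        (\<forall>a\<in>F. \<forall>j<m a. \<forall>k<m a. bergman_inner \<alpha> (y a j) (?x a k) = (if j = k then 1 else 0)) \<and>
        (\<forall>f\<in>bergman_space \<alpha>. (\<Sum>a\<in>F. \<Sum>j<m a. (cmod (bergman_inner \<alpha> f (y a j)))\<^sup>2) \<le> \<bar>C\<bar> * (bergman_norm \<alpha> f)\<^sup>2)"
      proof (intro exI[of _ "\<lambda>a j. y (a, j)"] conjI ballI allI impI)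
        show "y (a, j) \<in> bergman_space \<alpha>" if "a \<in> F" "j < m a" for a j using y that by auto
        show "bergman_inner \<alpha> (y (a, j)) (?x a k) = (if j = k then 1 else 0)"
          if "a \<in> F" "j < m a" "k < m a" for a j k
          using yx[of "(a, j)" "(a, k)"] that by simp
        show "(\<Sum>a\<in>F. \<Sum>j<m a. (cmod (bergman_inner \<alpha> f (y (a, j))))\<^sup>2) \<le> \<bar>C\<bar> * (bergman_norm \<alpha> f)\<^sup>2"
          if "f \<in> bergman_space \<alpha>" for f
          using yb[OF that] F by (subst sum.Sigma) (auto simp: case_prod_unfold)
      qed
    qed
  qed
  show ?thesis
  proof (rule summable_on_from_truncated)
    show "0 \<le> real (m a) * (1 - (cmod a)\<^sup>2)" if "a \<in> \<Lambda>" for a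
      using one_minus_cmod_square_pos[OF ball[OF that]] by simp
    fix F assume F: "finite F" "F \<subseteq> \<Lambda>"
    from C[OF F] obtain y where Y: "(\<forall>a\<in>F. \<forall>j<m a. y a j \<in> bergman_space \<alpha>) \<and>
      (\<forall>a\<in>F. \<forall>j<m a. \<forall>k<m a. bergman_inner \<alpha> (y a j) (?x a k) = (if j = k then 1 else 0)) \<and>
      (\<forall>f\<in>bergman_space \<alpha>. (\<Sum>a\<in>F. \<Sum>j<m a. (cmod (bergman_inner \<alpha> f (y a j)))\<^sup>2) \<le> C * (bergman_norm \<alpha> f)\<^sup>2)"
      by (rule exE)
    note y = Y[THEN conjunct1, rule_format] Y[THEN conjunct2, THEN conjunct1, rule_format]
      Y[THEN conjunct2, THEN conjunct2, rule_format]
    show "(\<Sum>a\<in>F. (min (real (m a) * (1 - (cmod a)\<^sup>2)) 1)\<^sup>2) \<le> 256 * density_const \<alpha> * (C * (1 + \<alpha>))"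
      using F(2) ball m by (intro bessel_biorthogonal_density[OF \<alpha> F(1) _ _ y]) blast+
  qed
qed

end
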